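(* Let $a\in\mathcal P$ be an element of antighost number $i>0$ satisfying $\delta a=0$. Then there exists $b\in\mathcal P$ (of antighost number $i+1$) such that $a=\delta b$. In other words, the homology $H_i(\delta)$ of the covariant Koszul–Tate differential $\delta$ vanishes for all antighost numbers $i>0$.
   Context: Spacetime is $\mathbb R^n$ with the Minkowski metric, used to raise and lower spacetime indices $\mu,\nu,\dots$. $G$ is a simple Lie group with Lie algebra basis indices $a,b,c$ and structure constants $C^a_{bc}$; internal indices are moved with an invariant nondegenerate metric, so that $C_{abc}$ is totally antisymmetric. $\lambda$ is a real coupling constant. The Chapline–Manton model has fields $A^a_\mu$ and $B_{\mu\nu}=-B_{\nu\mu}$, with $F^a_{\mu\nu}=\partial_\mu A^a_\nu-\partial_\nu A^a_\mu-C^a_{bc}A^b_\mu A^c_\nu$ and $H_{\mu\nu\rho}=\partial_\mu B_{\nu\rho}+\partial_\nu B_{\rho\mu}+\partial_\rho B_{\mu\nu}-2\lambda C_{abc}A^a_\mu A^b_\nu A^c_\rho-2\lambda(A^a_\mu F_{a\nu\rho}+A^a_\nu F_{a\rho\mu}+A^a_\rho F_{a\mu\nu})$, and Lagrangian $-\frac14F^a_{\mu\nu}F_a^{\mu\nu}-\frac1{12}H_{\mu\nu\rho}H^{\mu\nu\rho}$. One adds ghosts $C^a$ (Grassmann odd), $\eta_\mu$ (odd), $\rho$ (even) and antifields $A^{*\mu}_a$ (odd), $C^*_a$ (even), $B^{*\mu\nu}=-B^{*\nu\mu}$ (odd), $\eta^{*\mu}$ (even), $\rho^*$ (odd). $\mathcal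 P$ is the algebra of spacetime exterior forms whose coefficients are polynomials in all these variables and their partial derivatives of all orders. $D_\mu$ is the gauge covariant derivative in the adjoint representation, $D_\mu X^a=\partial_\mu X^a-C^a_{bc}A^b_\mu X^c$ (indices moved with the invariant metric). The differential $\delta$ is the odd derivation of $\mathcal P$ commuting with $\partial_\mu$ defined by: $\delta$ vanishes on $A^a_\mu,B_{\mu\nu},C^a,\eta_\mu,\rho$; $\delta B^{*\mu\nu}=\partial_\rho H^{\rho\mu\nu}$, $\delta\eta^{*\mu}=-\partial_\nu B^{*\nu\mu}$, $\delta\rho^*=-\partial_\mu\eta^{*\mu}$, $\delta A^{*\mu}_a=D_\nu F_a^{\nu\mu}+2\lambda H^{\mu\nu\rho}F_{a\nu\rho}$, $\delta C^*_a=2\lambda B^{*\mu\nu}F_{a\mu\nu}-D_\mu A^{*\mu}_a$. The antighost number is the grading with: fields and ghosts $0$; $A^{*\mu}_a$ and $B^{*\mu\nu}$: $1$; $C^*_a$ and $\eta^{*\mu}$: $2$; $\rho^*$: $3$ ($\delta$ lowers it by one).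
   Formalization: The formal theorem assumes spacetime dimension n ≥ 3; for n ≤ 2 the claim fails (for n = 2, H vanishes identically, so B*^{01} is a δ-cycle of antighost number 1 that is not a boundary). *)

theory Defs
  imports "HOL-Library.Poly_Mapping" "HOL-Library.Countable" "HOL-Analysis.Analysis"
begin

text \<open>Spacetime indices: a finite linearly ordered type 'n (dimension CARD('n)).
  Lie algebra indices: a finite type 'g.\<close>

datatype ('n, 'g) fld =
    FA 'g 'n
  | FB 'n 'n        \<comment> \<open>B_{mu nu}, only mu < nu used, even\<close>
  | FC 'g           \<comment> \<open>ghost C^a, odd\<close>
  | Feta 'n         \<comment> \<open>ghost eta_mu, odd\<close>
  | Frho            \<comment> \<open>ghost rho, even\<close>
  | FAs 'g 'n       \<comment> \<open>antifield A*^mu_a, odd\<close>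
  | FCs 'g          \<comment> \<open>antifield C*_a, even\<close>
  | FBs 'n 'n       \<comment> \<open>antifield B*^{mu nu}, only mu < nu used, odd\<close>
  | Fetas 'n        \<comment> \<open>antifield eta*^mu, even\<close>
  | Frhos           \<comment> \<open>antifield rho*, odd\<close>

text \<open>A generator is either a jet coordinate (a field/antifield/ghost together with a
  multi-index J, J mu = number of derivatives in direction mu) or a differential dx^mu.\<close>
datatype ('n, 'g) gen = Jet "('n, 'g) fld" "'n \<Rightarrow> nat" | Dx 'n

instance fld :: (countable, countable) countable by countable_datatype
fun gen_code :: "('n, 'g) gen \<Rightarrow> (('n, 'g) fld \<times> ('n \<Rightarrow> nat)) + 'n" where
  "gen_code (Jet f J) = Inl (f, J)" | "gen_code (Dx m) = Inr m"

instance gen :: (finite, countable) countable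
proof
  have "inj (gen_code :: ('a, 'b) gen \<Rightarrow> _)"
    by (rule injI) (case_tac x; case_tac y; auto)
  then show "\<exists>to_nat :: ('a, 'b) gen \<Rightarrow> nat. inj to_nat"
    by (intro exI[of _ "to_nat \<circ> gen_code"]) (simp add: inj_compose)
qed

fun fld_odd :: "('n, 'g) fld \<Rightarrow> bool" where
  "fld_odd (FA a m) = False" | "fld_odd (FB m n) = False" | "fld_odd (FC a) = True"
| "fld_odd (Feta m) = True" | "fld_odd Frho = False" | "fld_odd (FAs a m) = True"
| "fld_odd (FCs a) = False" | "fld_odd (FBs m n) = True" | "fld_odd (Fetas m) = False"
| "fld_odd Frhos = True"

fun gen_odd :: "('n, 'g) gen \<Rightarrow> bool" where
  "gen_odd (Jet f J) = fld_odd f" | "gen_odd (Dx m) = True"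

fun fld_agh :: "('n, 'g) fld \<Rightarrow> nat" where
  "fld_agh (FAs a m) = 1" | "fld_agh (FBs m n) = 1" | "fld_agh (FCs a) = 2"
| "fld_agh (Fetas m) = 2" | "fld_agh Frhos = 3" | "fld_agh _ = 0"

fun gen_agh :: "('n, 'g) gen \<Rightarrow> nat" where
  "gen_agh (Jet f J) = fld_agh f" | "gen_agh (Dx m) = 0"

text \<open>Only independent components of the antisymmetric B and B* are generators.\<close>
fun gen_ok :: "('n::linorder, 'g) gen \<Rightarrow> bool" where
  "gen_ok (Jet (FB m n) J) = (m < n)" | "gen_ok (Jet (FBs m n) J) = (m < n)"
| "gen_ok _ = True"

text \<open>A monomial is (E, O): a multiset E of even generators times the product of the
  finitely many distinct odd generators in O, taken in increasing order of to_nat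
  (a fixed enumeration). Elements are finite real linear combinations of monomials.\<close>

type_synonym ('n, 'g) mon = "('n, 'g) gen multiset \<times> ('n, 'g) gen set"
type_synonym ('n, 'g) poly = "('n, 'g) mon \<Rightarrow>\<^sub>0 real"

definition mon_ok :: "('n::{finite,countable,linorder}, 'g::countable) mon \<Rightarrow> bool" where
  "mon_ok m = ((\<forall>x\<in>#fst m. \<not> gen_odd x \<and> gen_ok x) \<and> finite (snd m) \<and>
               (\<forall>x\<in>snd m. gen_odd x \<and> gen_ok x))"

definition PP :: "('n::{finite,countable,linorder}, 'g::countable) poly set" where
  "PP = {p. \<forall>m\<in>Poly_Mapping.keys p. mon_ok m}"

text \<open>Sign of the permutation sorting the concatenation O1 O2 (each sorted).\<close>
definition osign :: "('n::{finite,countable}, 'g::countable) gen set \<Rightarrow> ('n, 'g) gen set \<Rightarrow> real" where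
  "osign O1 O2 = (-1) ^ card {(x, y). x \<in> O1 \<and> y \<in> O2 \<and> to_nat y < to_nat x}"

definition mmul :: "real \<Rightarrow> ('n::{finite,countable}, 'g::countable) mon \<Rightarrow> ('n, 'g) mon \<Rightarrow> ('n, 'g) poly" where
  "mmul c m1 m2 = (if snd m1 \<inter> snd m2 \<noteq> {} then 0
      else Poly_Mapping.single (fst m1 + fst m2, snd m1 \<union> snd m2) (osign (snd m1) (snd m2) * c))"

definition pmul :: "('n::{finite,countable}, 'g::countable) poly \<Rightarrow> ('n, 'g) poly \<Rightarrow> ('n, 'g) poly"
  (infixl "\<star>" 70) where
  "p \<star> q = (\<Sum>m1\<in>Poly_Mapping.keys p. \<Sum>m2\<in>Poly_Mapping.keys q. mmul (Poly_Mapping.lookup p m1 * Poly_Mapping.lookup q m2) m1 m2)"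

definition sc :: "real \<Rightarrow> ('n, 'g) poly \<Rightarrow> ('n, 'g) poly" where
  "sc r p = (\<Sum>m\<in>Poly_Mapping.keys p. Poly_Mapping.single m (r * Poly_Mapping.lookup p m))"

definition one :: "('n, 'g) poly" where
  "one = Poly_Mapping.single ({#}, {}) 1"

definition gv :: "('n, 'g) gen \<Rightarrow> ('n, 'g) poly" where
  "gv x = (if gen_odd x then Poly_Mapping.single ({#}, {x}) 1 else Poly_Mapping.single ({#x#}, {}) 1)"

definition monp :: "('n, 'g) mon \<Rightarrow> ('n, 'g) poly" where
  "monp m = Poly_Mapping.single m 1"

definition sorted_odd :: "('n::{finite,countable}, 'g::countable) gen set \<Rightarrow> ('n, 'g) gen list" where
  "sorted_odd S = sorted_key_list_of_set to_nat S"

text \<open>Extension of a map on generators to a (left) derivation of parity pd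
  (pd = 0: even, pd = 1: odd), acting by the graded Leibniz rule
  D(x y) = D(x) y + (-1)^(pd |x|) x D(y).\<close>

fun dlist :: "nat \<Rightarrow> (('n::{finite,countable}, 'g::countable) gen \<Rightarrow> ('n, 'g) poly) \<Rightarrow> ('n, 'g) gen list \<Rightarrow> ('n, 'g) poly" where
  "dlist pd f [] = 0"
| "dlist pd f (x # xs) = f x \<star> foldr (\<lambda>y q. gv y \<star> q) xs one
      + sc ((-1) ^ (pd * (if gen_odd x then 1 else 0))) (gv x \<star> dlist pd f xs)"

definition dmon :: "nat \<Rightarrow> (('n::{finite,countable}, 'g::countable) gen \<Rightarrow> ('n, 'g) poly) \<Rightarrow> ('n, 'g) mon \<Rightarrow> ('n, 'g) poly" where
  "dmon pd f m = (\<Sum>e\<in>set_mset (fst m). sc (real (count (fst m) e)) (f e \<star> monp (fst m - {#e#}, snd m)))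
      + monp (fst m, {}) \<star> dlist pd f (sorted_odd (snd m))"

definition der :: "nat \<Rightarrow> (('n::{finite,countable}, 'g::countable) gen \<Rightarrow> ('n, 'g) poly) \<Rightarrow> ('n, 'g) poly \<Rightarrow> ('n, 'g) poly" where
  "der pd f p = (\<Sum>m\<in>Poly_Mapping.keys p. sc (Poly_Mapping.lookup p m) (dmon pd f m))"

fun pd_gen :: "'n \<Rightarrow> ('n::{finite,countable}, 'g::countable) gen \<Rightarrow> ('n, 'g) poly" where
  "pd_gen mu (Jet f J) = gv (Jet f (J(mu := Suc (J mu))))"
| "pd_gen mu (Dx nu) = 0"

definition PD :: "'n \<Rightarrow> ('n::{finite,countable}, 'g::countable) poly \<Rightarrow> ('n, 'g) poly" where
  "PD mu = der 0 (pd_gen mu)"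

definition PDJ :: "('n \<Rightarrow> nat) \<Rightarrow> ('n::{finite,countable,linorder}, 'g::countable) poly \<Rightarrow> ('n, 'g) poly" where
  "PDJ J p = fold (\<lambda>mu q. (PD mu ^^ J mu) q) (sorted_list_of_set UNIV) p"

text \<open>Minkowski metric: diagonal, -1 at the time index t0, +1 otherwise (so it is its own inverse).\<close>
definition msig :: "'n \<Rightarrow> 'n \<Rightarrow> real" where
  "msig t0 mu = (if mu = t0 then -1 else 1)"

definition undiff :: "'n \<Rightarrow> nat" where "undiff = (\<lambda>_. 0)"

definition fv :: "('n, 'g) fld \<Rightarrow> ('n, 'g) poly" where
  "fv f = gv (Jet f undiff)"

definition Afd :: "'g \<Rightarrow> 'n \<Rightarrow> ('n, 'g) poly" where "Afd a mu = fv (FA a mu)"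

definition Bfd :: "'n::linorder \<Rightarrow> 'n \<Rightarrow> ('n, 'g) poly" where
  "Bfd mu nu = (if mu < nu then fv (FB mu nu) else if nu < mu then - fv (FB nu mu) else 0)"

definition Bsfd :: "'n::linorder \<Rightarrow> 'n \<Rightarrow> ('n, 'g) poly" where
  "Bsfd mu nu = (if mu < nu then fv (FBs mu nu) else if nu < mu then - fv (FBs nu mu) else 0)"

text \<open>Lie algebra data: C a b c = C^a_{bc}, k a b = invariant metric k_{ab}.\<close>

definition Clow :: "('g::finite \<Rightarrow> 'g \<Rightarrow> real) \<Rightarrow> ('g \<Rightarrow> 'g \<Rightarrow> 'g \<Rightarrow> real) \<Rightarrow> 'g \<Rightarrow> 'g \<Rightarrow> 'g \<Rightarrow> real" where
  "Clow k C a b c = (\<Sum>d\<in>UNIV. k a d * C d b c)"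

definition kinv :: "('g::finite \<Rightarrow> 'g \<Rightarrow> real) \<Rightarrow> 'g \<Rightarrow> 'g \<Rightarrow> real" where
  "kinv k a b = matrix_inv (\<chi> i j. k i j) $ a $ b"

definition Ffd :: "('g::finite \<Rightarrow> 'g \<Rightarrow> 'g \<Rightarrow> real) \<Rightarrow> 'g \<Rightarrow> 'n::{finite,countable} \<Rightarrow> 'n \<Rightarrow> ('n, 'g) poly" where
  "Ffd C a mu nu = PD mu (Afd a nu) - PD nu (Afd a mu)
     - (\<Sum>b\<in>UNIV. \<Sum>c\<in>UNIV. sc (C a b c) (Afd b mu \<star> Afd c nu))"

definition Flow :: "('g::finite \<Rightarrow> 'g \<Rightarrow> real) \<Rightarrow> ('g \<Rightarrow> 'g \<Rightarrow> 'g \<Rightarrow> real) \<Rightarrow> 'g \<Rightarrow> 'n::{finite,countable} \<Rightarrow> 'n \<Rightarrow> ('n, 'g) poly" where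
  "Flow k C a mu nu = (\<Sum>b\<in>UNIV. sc (k a b) (Ffd C b mu nu))"

definition Hfd :: "real \<Rightarrow> ('g::finite \<Rightarrow> 'g \<Rightarrow> real) \<Rightarrow> ('g \<Rightarrow> 'g \<Rightarrow> 'g \<Rightarrow> real) \<Rightarrow> 'n::{finite,countable,linorder} \<Rightarrow> 'n \<Rightarrow> 'n \<Rightarrow> ('n, 'g) poly" where
  "Hfd lam k C mu nu rho =
     PD mu (Bfd nu rho) + PD nu (Bfd rho mu) + PD rho (Bfd mu nu)
     - sc (2 * lam) (\<Sum>a\<in>UNIV. \<Sum>b\<in>UNIV. \<Sum>c\<in>UNIV. sc (Clow k C a b c) (Afd a mu \<star> Afd b nu \<star> Afd c rho))
     - sc (2 * lam) (\<Sum>a\<in>UNIV. Afd a mu \<star> Flow k C a nu rho + Afd a nu \<star> Flow k C a rho mu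
                                + Afd a rho \<star> Flow k C a mu nu)"

text \<open>Indices raised with the (diagonal) Minkowski metric.\<close>
definition Hup :: "'n \<Rightarrow> real \<Rightarrow> ('g::finite \<Rightarrow> 'g \<Rightarrow> real) \<Rightarrow> ('g \<Rightarrow> 'g \<Rightarrow> 'g \<Rightarrow> real) \<Rightarrow> 'n::{finite,countable,linorder} \<Rightarrow> 'n \<Rightarrow> 'n \<Rightarrow> ('n, 'g) poly" where
  "Hup t0 lam k C mu nu rho = sc (msig t0 mu * msig t0 nu * msig t0 rho) (Hfd lam k C mu nu rho)"

definition Fup :: "'n \<Rightarrow> ('g::finite \<Rightarrow> 'g \<Rightarrow> 'g \<Rightarrow> real) \<Rightarrow> 'g \<Rightarrow> 'n::{finite,countable} \<Rightarrow> 'n \<Rightarrow> ('n, 'g) poly" where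
  "Fup t0 C a mu nu = sc (msig t0 mu * msig t0 nu) (Ffd C a mu nu)"

definition Flowup :: "'n \<Rightarrow> ('g::finite \<Rightarrow> 'g \<Rightarrow> real) \<Rightarrow> ('g \<Rightarrow> 'g \<Rightarrow> 'g \<Rightarrow> real) \<Rightarrow> 'g \<Rightarrow> 'n::{finite,countable} \<Rightarrow> 'n \<Rightarrow> ('n, 'g) poly" where
  "Flowup t0 k C a mu nu = sc (msig t0 mu * msig t0 nu) (Flow k C a mu nu)"

fun delta0 :: "'n \<Rightarrow> real \<Rightarrow> ('g::finite \<Rightarrow> 'g \<Rightarrow> real) \<Rightarrow> ('g \<Rightarrow> 'g \<Rightarrow> 'g \<Rightarrow> real) \<Rightarrow> ('n::{finite,countable,linorder}, 'g) fld \<Rightarrow> ('n, 'g) poly" where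
  "delta0 t0 lam k C (FBs mu nu) = (\<Sum>rho\<in>UNIV. PD rho (Hup t0 lam k C rho mu nu))"
| "delta0 t0 lam k C (Fetas mu) = - (\<Sum>nu\<in>UNIV. PD nu (Bsfd nu mu))"
| "delta0 t0 lam k C Frhos = - (\<Sum>mu\<in>UNIV. PD mu (fv (Fetas mu)))"
| "delta0 t0 lam k C (FAs a mu) =
     (\<Sum>nu\<in>UNIV. PD nu (Flowup t0 k C a nu mu)
        - (\<Sum>b\<in>UNIV. \<Sum>c\<in>UNIV. sc (Clow k C a b c) (Afd b nu \<star> Fup t0 C c nu mu)))
     + sc (2 * lam) (\<Sum>nu\<in>UNIV. \<Sum>rho\<in>UNIV. Hup t0 lam k C mu nu rho \<star> Flow k C a nu rho)"
| "delta0 t0 lam k C (FCs a) =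
     sc (2 * lam) (\<Sum>mu\<in>UNIV. \<Sum>nu\<in>UNIV. Bsfd mu nu \<star> Flow k C a mu nu)
     - (\<Sum>mu\<in>UNIV. PD mu (fv (FAs a mu))
        - (\<Sum>b\<in>UNIV. \<Sum>c\<in>UNIV. sc (Clow k C a b c)
             (Afd b mu \<star> (\<Sum>e\<in>UNIV. sc (kinv k c e) (fv (FAs e mu))))))"
| "delta0 t0 lam k C _ = 0"

fun delta_gen :: "'n \<Rightarrow> real \<Rightarrow> ('g::finite \<Rightarrow> 'g \<Rightarrow> real) \<Rightarrow> ('g \<Rightarrow> 'g \<Rightarrow> 'g \<Rightarrow> real) \<Rightarrow> ('n::{finite,countable,linorder}, 'g) gen \<Rightarrow> ('n, 'g) poly" where
  "delta_gen t0 lam k C (Jet f J) = PDJ J (delta0 t0 lam k C f)"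
| "delta_gen t0 lam k C (Dx nu) = 0"

text \<open>The Koszul--Tate differential: odd derivation commuting with the total derivatives.\<close>
definition KT :: "'n \<Rightarrow> real \<Rightarrow> ('g::finite \<Rightarrow> 'g \<Rightarrow> real) \<Rightarrow> ('g \<Rightarrow> 'g \<Rightarrow> 'g \<Rightarrow> real) \<Rightarrow> ('n::{finite,countable,linorder}, 'g) poly \<Rightarrow> ('n, 'g) poly" where
  "KT t0 lam k C = der 1 (delta_gen t0 lam k C)"

definition mon_agh :: "('n, 'g) mon \<Rightarrow> nat" where
  "mon_agh m = sum_mset (image_mset gen_agh (fst m)) + sum gen_agh (snd m)"

definition has_agh :: "nat \<Rightarrow> ('n, 'g) poly \<Rightarrow> bool" where
  "has_agh i p = (\<forall>m\<in>Poly_Mapping.keys p. mon_agh m = i)"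

definition lbr :: "('g::finite \<Rightarrow> 'g \<Rightarrow> 'g \<Rightarrow> real) \<Rightarrow> ('g \<Rightarrow> real) \<Rightarrow> ('g \<Rightarrow> real) \<Rightarrow> 'g \<Rightarrow> real" where
  "lbr C x y = (\<lambda>a. \<Sum>b\<in>UNIV. \<Sum>c\<in>UNIV. C a b c * x b * y c)"

definition lie_ideal :: "('g::finite \<Rightarrow> 'g \<Rightarrow> 'g \<Rightarrow> real) \<Rightarrow> ('g \<Rightarrow> real) set \<Rightarrow> bool" where
  "lie_ideal C I = ((\<lambda>_. 0) \<in> I \<and> (\<forall>x\<in>I. \<forall>y\<in>I. (\<lambda>a. x a + y a) \<in> I)
      \<and> (\<forall>r. \<forall>x\<in>I. (\<lambda>a. r * x a) \<in> I) \<and> (\<forall>x. \<forall>y\<in>I. lbr C x y \<in> I))"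

definition simple_lie_algebra :: "('g::finite \<Rightarrow> 'g \<Rightarrow> 'g \<Rightarrow> real) \<Rightarrow> bool" where
  "simple_lie_algebra C =
     ((\<forall>a b c. C a b c = - C a c b)
      \<and> (\<forall>x y z. (\<lambda>a. lbr C (lbr C x y) z a + lbr C (lbr C y z) x a + lbr C (lbr C z x) y a) = (\<lambda>_. 0))
      \<and> (\<exists>x y. lbr C x y \<noteq> (\<lambda>_. 0))
      \<and> (\<forall>I. lie_ideal C I \<longrightarrow> I = {\<lambda>_. 0} \<or> I = UNIV))"

definition kform :: "('g::finite \<Rightarrow> 'g \<Rightarrow> real) \<Rightarrow> ('g \<Rightarrow> real) \<Rightarrow> ('g \<Rightarrow> real) \<Rightarrow> real" where
  "kform k x y = (\<Sum>a\<in>UNIV. \<Sum>b\<in>UNIV. k a b * x a * y b)"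

definition invariant_metric :: "('g::finite \<Rightarrow> 'g \<Rightarrow> 'g \<Rightarrow> real) \<Rightarrow> ('g \<Rightarrow> 'g \<Rightarrow> real) \<Rightarrow> bool" where
  "invariant_metric C k =
     ((\<forall>a b. k a b = k b a)
      \<and> (\<forall>x. (\<forall>y. kform k x y = 0) \<longrightarrow> x = (\<lambda>_. 0))
      \<and> (\<forall>x y z. kform k (lbr C x y) z = kform k x (lbr C y z)))"

end

theory Submission
  imports Defs
begin

text \<open>
  The differential is triangular with respect to a rank on jet coordinates. Fix the three smallest
  spacetime indices \<open>e0 < e1 < e2\<close>, weight a derivative along them by 4, 3, 2 and along the other
  directions by 1, and give \<open>B\<close> one unit more than \<open>A\<close>. Ranking antifields suitably, the image of an
  antifield jet is a leading linear term of equal rank plus terms all of whose factors have smaller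
  rank; in the equations of \<open>A\<^sup>*\<close> and \<open>B\<^sup>*\<close> the leading term is a second derivative of \<open>A\<close> or \<open>B\<close>,
  in the others it is a first derivative of an antifield. Every antifield jet that is not itself a
  leading term is paired in this way with its leading term, up to the metric of the Lie algebra.
  Hence the leading part of the differential has the inverse pairing as a contracting homotopy: their
  anticommutator counts paired generators, and this number is positive in positive antighost number.
  The field equations have degree at most five, so weighting a generator of rank \<open>r\<close> by \<open>6 ^ r\<close> makes
  the difference between the differential and its leading part strictly weight-decreasing. Since the
  differential squares to zero, which amounts to the Noether identities (Bianchi and Jacobi),
  subtracting from a cycle the boundary of its image under the homotopy leaves a cycle of smaller
  weight, and induction on the weight finishes the proof.
\<close>

section \<open>The graded-commutative algebra\<close>

lemma lookup_sc [simp]: "Poly_Mapping.lookup (sc r p) m = r * Poly_Mapping.lookup p m"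
  by (simp add: sc_def lookup_sum lookup_single when_def in_keys_iff)

lemma keys_sc_subset: "Poly_Mapping.keys (sc r p) \<subseteq> Poly_Mapping.keys p"
  by (auto simp: in_keys_iff)

lemma sc_add: "sc r (p + q) = sc r p + sc r q"
  and sc_add_left: "sc (r + s) p = sc r p + sc s p"
  and sc_sc: "sc r (sc s p) = sc (r * s) p"
  and sc_0 [simp]: "sc r 0 = 0"
  and sc_0_left [simp]: "sc 0 p = 0"
  and sc_1 [simp]: "sc 1 p = p"
  and sc_single: "sc r (Poly_Mapping.single m c) = Poly_Mapping.single m (r * c)"
  by (rule poly_mapping_eqI; simp add: lookup_add algebra_simps lookup_single when_def)+

lemma sc_sum: "sc r (sum f A) = (\<Sum>x\<in>A. sc r (f x))"
  by (induction A rule: infinite_finite_induct) (auto simp: sc_add)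

lemma poly_eq_sum_singles:
  "p = (\<Sum>m\<in>Poly_Mapping.keys p. Poly_Mapping.single m (Poly_Mapping.lookup p m))"
  by (rule poly_mapping_eqI) (simp add: lookup_sum lookup_single when_def in_keys_iff)

subsection \<open>Products of polynomials\<close>

lemma mmul_add: "mmul (c + d) m1 m2 = mmul c m1 m2 + mmul d m1 m2"
  by (simp add: mmul_def single_add distrib_left)

lemma mmul_0 [simp]: "mmul 0 m1 m2 = 0"
  by (simp add: mmul_def)

lemma sc_mmul: "sc r (mmul c m1 m2) = mmul (r * c) m1 m2"
  by (simp add: mmul_def sc_single mult.left_commute)

lemma pmul_eq_sum_superset:
  assumes "finite A" "Poly_Mapping.keys p \<subseteq> A" "finite B" "Poly_Mapping.keys q \<subseteq> B"
  shows "p \<star> q =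
    (\<Sum>m1\<in>A. \<Sum>m2\<in>B. mmul (Poly_Mapping.lookup p m1 * Poly_Mapping.lookup q m2) m1 m2)"
proof -
  have "p \<star> q = (\<Sum>m1\<in>Poly_Mapping.keys p. \<Sum>m2\<in>B.
      mmul (Poly_Mapping.lookup p m1 * Poly_Mapping.lookup q m2) m1 m2)"
    unfolding pmul_def
    by (intro sum.cong refl sum.mono_neutral_left) (use assms in \<open>auto simp: in_keys_iff\<close>)
  also have "\<dots> =
    (\<Sum>m1\<in>A. \<Sum>m2\<in>B. mmul (Poly_Mapping.lookup p m1 * Poly_Mapping.lookup q m2) m1 m2)"
    by (intro sum.mono_neutral_left) (use assms in \<open>auto simp: in_keys_iff\<close>)
  finally show ?thesis .
qed

lemma pmul_add_left: "(p + p') \<star> q = p \<star> q + p' \<star> q"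
  by (subst (1 2 3) pmul_eq_sum_superset
        [where A = "Poly_Mapping.keys p \<union> Poly_Mapping.keys p'" and B = "Poly_Mapping.keys q"])
    (use Poly_Mapping.keys_add[of p p'] in
      \<open>auto simp: lookup_add distrib_right mmul_add sum.distrib\<close>)

lemma pmul_add_right: "q \<star> (p + p') = q \<star> p + q \<star> p'"
  by (subst (1 2 3) pmul_eq_sum_superset
        [where A = "Poly_Mapping.keys q" and B = "Poly_Mapping.keys p \<union> Poly_Mapping.keys p'"])
    (use Poly_Mapping.keys_add[of p p'] in
      \<open>auto simp: lookup_add distrib_left mmul_add sum.distrib\<close>)

lemma pmul_sc_left: "sc r p \<star> q = sc r (p \<star> q)"
  by (subst (1 2) pmul_eq_sum_superset
        [where A = "Poly_Mapping.keys p" and B = "Poly_Mapping.keys q"])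
    (use keys_sc_subset[of r p] in \<open>auto simp: sc_sum sc_mmul mult.assoc\<close>)

lemma pmul_sc_right: "p \<star> sc r q = sc r (p \<star> q)"
  by (subst (1 2) pmul_eq_sum_superset
        [where A = "Poly_Mapping.keys p" and B = "Poly_Mapping.keys q"])
    (use keys_sc_subset[of r q] in \<open>auto simp: sc_sum sc_mmul mult.left_commute\<close>)

lemma pmul_single_single:
  "Poly_Mapping.single m c \<star> Poly_Mapping.single m' d = mmul (c * d) m m'"
  by (subst pmul_eq_sum_superset[where A = "{m}" and B = "{m'}"]) (auto simp: lookup_single)

lemma pmul_0 [simp]: "0 \<star> q = 0" "q \<star> 0 = 0"
  by (simp_all add: pmul_def)

lemma one_pmul: "one \<star> p = p"
  by (subst pmul_eq_sum_superset[where A = "{({#}, {})}" and B = "Poly_Mapping.keys p"])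
    (auto simp: one_def mmul_def osign_def poly_eq_sum_singles[of p, symmetric])

lemma pmul_one: "p \<star> one = p"
  by (subst pmul_eq_sum_superset[where A = "Poly_Mapping.keys p" and B = "{({#}, {})}"])
    (auto simp: one_def mmul_def osign_def poly_eq_sum_singles[of p, symmetric])

subsection \<open>Admissible polynomials\<close>

lemma PP_0 [simp]: "0 \<in> PP"
  by (simp add: PP_def)

lemma PP_add: "p \<in> PP \<Longrightarrow> q \<in> PP \<Longrightarrow> p + q \<in> PP"
  unfolding PP_def using Poly_Mapping.keys_add[of p q] by blast

lemma PP_uminus: "p \<in> PP \<Longrightarrow> - p \<in> PP"
  by (simp add: PP_def)

lemma PP_diff: "p \<in> PP \<Longrightarrow> q \<in> PP \<Longrightarrow> p - q \<in> PP"
  using PP_add[of p "- q"] PP_uminus[of q] by simp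

lemma PP_sum: "(\<And>x. x \<in> A \<Longrightarrow> f x \<in> PP) \<Longrightarrow> sum f A \<in> PP"
  by (induction A rule: infinite_finite_induct) (auto intro: PP_add)

lemma PP_sc: "p \<in> PP \<Longrightarrow> sc r p \<in> PP"
  unfolding PP_def using keys_sc_subset[of r p] by blast

lemma PP_single: "mon_ok m \<Longrightarrow> Poly_Mapping.single m c \<in> PP"
  by (auto simp: PP_def)

lemma PP_mmul: "mon_ok m1 \<Longrightarrow> mon_ok m2 \<Longrightarrow> mmul c m1 m2 \<in> PP"
  by (auto simp: mmul_def mon_ok_def intro!: PP_single)

lemma PP_pmul: "p \<in> PP \<Longrightarrow> q \<in> PP \<Longrightarrow> p \<star> q \<in> PP"
  unfolding pmul_def by (intro PP_sum PP_mmul) (auto simp: PP_def)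

lemma PP_one: "one \<in> PP"
  by (auto simp: one_def mon_ok_def intro!: PP_single)

lemma PP_gv: "gen_ok x \<Longrightarrow> gv x \<in> PP"
  by (auto simp: gv_def mon_ok_def intro!: PP_single)

lemma PP_monp: "mon_ok m \<Longrightarrow> monp m \<in> PP"
  by (auto simp: monp_def intro!: PP_single)

lemma PP_induct [consumes 1, case_names single zero add]:
  assumes "p \<in> PP" and single: "\<And>m c. mon_ok m \<Longrightarrow> P (Poly_Mapping.single m c)"
    and zero: "P 0" and add: "\<And>p q. p \<in> PP \<Longrightarrow> q \<in> PP \<Longrightarrow> P p \<Longrightarrow> P q \<Longrightarrow> P (p + q)"
  shows "P p"
proof -
  let ?single = "\<lambda>m. Poly_Mapping.single m (Poly_Mapping.lookup p m)"
  have "A \<subseteq> Poly_Mapping.keys p \<Longrightarrow> sum ?single A \<in> PP \<and> P (sum ?single A)" for A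
  proof (induction A rule: infinite_finite_induct)
    case (insert m A)
    then have "mon_ok m" using assms(1) by (auto simp: PP_def)
    with insert show ?case by (auto intro!: add single PP_single PP_add)
  qed (simp_all add: zero)
  from this[of "Poly_Mapping.keys p"] show ?thesis
    using poly_eq_sum_singles[of p] by simp
qed

subsection \<open>Associativity\<close>

lemma osign_eq_prod:
  assumes "finite S" "finite T"
  shows "osign S T = (\<Prod>x\<in>S. \<Prod>y\<in>T. if to_nat y < to_nat x then -1 else 1)"
proof -
  let ?inversions = "{(x, y). x \<in> S \<and> y \<in> T \<and> to_nat y < to_nat x}"
  have "(\<Prod>x\<in>S. \<Prod>y\<in>T. if to_nat y < to_nat x then -1 else 1) =
      (\<Prod>z\<in>S \<times> T. if to_nat (snd z) < to_nat (fst z) then -1 else (1 :: real))"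
    by (simp add: prod.cartesian_product case_prod_unfold)
  also have "\<dots> = (\<Prod>z\<in>{z \<in> S \<times> T. to_nat (snd z) < to_nat (fst z)}. -1)"
    using assms by (intro prod.inter_filter[symmetric]) simp
  also have "{z \<in> S \<times> T. to_nat (snd z) < to_nat (fst z)} = ?inversions"
    by auto
  finally show ?thesis by (simp add: osign_def)
qed

lemma osign_empty [simp]: "osign {} S = 1" "osign S {} = 1"
  by (simp_all add: osign_def)

lemma osign_Un_left:
  "finite S \<Longrightarrow> finite S' \<Longrightarrow> finite T \<Longrightarrow> S \<inter> S' = {} \<Longrightarrow> osign (S \<union> S') T = osign S T * osign S' T"
  by (simp add: osign_eq_prod prod.union_disjoint)

lemma osign_Un_right:
  "finite S \<Longrightarrow> finite T \<Longrightarrow> finite T' \<Longrightarrow> T \<inter> T' = {} \<Longrightarrow> osign S (T \<union> T') = osign S T * osign S T'"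
  by (simp add: osign_eq_prod prod.union_disjoint prod.distrib)

lemma osign_singletons: "osign {x} {y} = (if to_nat y < to_nat x then -1 else 1)"
  by (simp add: osign_eq_prod)

lemma osign_least: "finite S \<Longrightarrow> (\<And>y. y \<in> S \<Longrightarrow> to_nat x < to_nat y) \<Longrightarrow> osign {x} S = 1"
  by (simp add: osign_eq_prod) (fastforce intro: prod.neutral)

lemma mmul_assoc:
  assumes "mon_ok m1" "mon_ok m2" "mon_ok m3"
  shows "mmul c m1 m2 \<star> Poly_Mapping.single m3 d = Poly_Mapping.single m1 c \<star> mmul d m2 m3"
proof (cases "snd m1 \<inter> snd m2 = {} \<and> snd m2 \<inter> snd m3 = {} \<and> snd m1 \<inter> snd m3 = {}")
  case True
  have "finite (snd m1)" "finite (snd m2)" "finite (snd m3)"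
    using assms by (auto simp: mon_ok_def)
  with True show ?thesis
    by (simp add: mmul_def pmul_single_single Int_Un_distrib Int_Un_distrib2 osign_Un_left
        osign_Un_right Un_assoc ac_simps)
next
  case False
  then show ?thesis
    by (auto simp: mmul_def pmul_single_single Int_Un_distrib Int_Un_distrib2)
qed

lemma pmul_assoc:
  assumes "p \<in> PP" "q \<in> PP" "r \<in> PP"
  shows "(p \<star> q) \<star> r = p \<star> (q \<star> r)"
  using assms(1)
proof (induction rule: PP_induct)
  case (single m1 c)
  note m1 = single
  from assms(2) show ?case
  proof (induction rule: PP_induct)
    case (single m2 d)
    note m2 = single
    from assms(3) show ?case
    proof (induction rule: PP_induct)
      case (single m3 e)
      show ?case
        using mmul_assoc[OF m1 m2 single, of "c * d" e] mmul_assoc[OF m1 m2 single, of c "d * e"]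
        by (simp add: pmul_single_single mmul_def mult.assoc mult.left_commute)
    qed (simp_all add: pmul_add_right)
  qed (simp_all add: pmul_add_right pmul_add_left)
qed (simp_all add: pmul_add_left)

subsection \<open>The type of superalgebra elements\<close>

typedef (overloaded) ('n, 'g) superalg = "PP :: ('n::{finite,linorder}, 'g::finite) poly set"
  by (rule exI[of _ 0]) simp

setup_lifting type_definition_superalg

instantiation superalg :: ("{finite,linorder}", finite) real_algebra_1
begin

lift_definition zero_superalg :: "('a, 'b) superalg" is 0
  by simp
lift_definition one_superalg :: "('a, 'b) superalg" is one
  by (rule PP_one)
lift_definition plus_superalg :: "('a, 'b) superalg \<Rightarrow> ('a, 'b) superalg \<Rightarrow> ('a, 'b) superalg"
  is "(+)"
  by (rule PP_add)
lift_definition minus_superalg :: "('a, 'b) superalg \<Rightarrow> ('a, 'b) superalg \<Rightarrow> ('a, 'b) superalg"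
  is "(-)"
  by (rule PP_diff)
lift_definition uminus_superalg :: "('a, 'b) superalg \<Rightarrow> ('a, 'b) superalg" is uminus
  by (rule PP_uminus)
lift_definition times_superalg :: "('a, 'b) superalg \<Rightarrow> ('a, 'b) superalg \<Rightarrow> ('a, 'b) superalg"
  is "(\<star>)"
  by (rule PP_pmul)
lift_definition scaleR_superalg :: "real \<Rightarrow> ('a, 'b) superalg \<Rightarrow> ('a, 'b) superalg" is sc
  by (rule PP_sc)

instance
proof
  fix p q r :: "('a, 'b) superalg" and x y :: real
  show "p + q + r = p + (q + r)" by transfer (rule add.assoc)
  show "p + q = q + p" by transfer (rule add.commute)
  show "0 + p = p" by transfer simp
  show "- p + p = 0" by transfer simp
  show "p - q = p + - q" by transfer simp
  show "p * q * r = p * (q * r)" by transfer (rule pmul_assoc)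
  show "(p + q) * r = p * r + q * r" by transfer (rule pmul_add_left)
  show "p * (q + r) = p * q + p * r" by transfer (rule pmul_add_right)
  show "1 * p = p" by transfer (rule one_pmul)
  show "p * 1 = p" by transfer (rule pmul_one)
  show "(0 :: ('a, 'b) superalg) \<noteq> 1"
    by transfer (metis one_def one_neq_zero lookup_single_eq lookup_zero)
  show "x *\<^sub>R (p + q) = x *\<^sub>R p + x *\<^sub>R q" by transfer (rule sc_add)
  show "(x + y) *\<^sub>R p = x *\<^sub>R p + y *\<^sub>R p" by transfer (rule sc_add_left)
  show "x *\<^sub>R y *\<^sub>R p = (x * y) *\<^sub>R p" by transfer (rule sc_sc)
  show "1 *\<^sub>R p = p" by transfer (rule sc_1)
  show "x *\<^sub>R p * q = x *\<^sub>R (p * q)" by transfer (rule pmul_sc_left)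
  show "p * x *\<^sub>R q = x *\<^sub>R (p * q)" by transfer (rule pmul_sc_right)
qed

end

lemma Rep_superalg_sum: "Rep_superalg (sum f A) = (\<Sum>x\<in>A. Rep_superalg (f x))"
  by (induction A rule: infinite_finite_induct)
    (auto simp: zero_superalg.rep_eq plus_superalg.rep_eq)

lemmas Rep_superalg_simps = zero_superalg.rep_eq one_superalg.rep_eq plus_superalg.rep_eq
  minus_superalg.rep_eq uminus_superalg.rep_eq times_superalg.rep_eq scaleR_superalg.rep_eq
  Rep_superalg_sum

subsection \<open>Generators and monomials\<close>

lift_definition var :: "('n::{finite,linorder}, 'g::finite) gen \<Rightarrow> ('n, 'g) superalg"
  is "\<lambda>x. if gen_ok x then gv x else 0" by (simp add: PP_gv)

lift_definition monomial :: "('n::{finite,linorder}, 'g::finite) mon \<Rightarrow> ('n, 'g) superalg"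
  is "\<lambda>m. if mon_ok m then monp m else 0" by (simp add: PP_monp)

definition support :: "('n::{finite,linorder}, 'g::finite) superalg \<Rightarrow> ('n, 'g) mon set" where
  "support p = Poly_Mapping.keys (Rep_superalg p)"

definition coef :: "('n::{finite,linorder}, 'g::finite) superalg \<Rightarrow> ('n, 'g) mon \<Rightarrow> real" where
  "coef p m = Poly_Mapping.lookup (Rep_superalg p) m"

lemma superalg_eqI: "(\<And>m. coef p m = coef q m) \<Longrightarrow> p = q"
  by (simp add: coef_def poly_mapping_eqI flip: Rep_superalg_inject)

lemma coef_0 [simp]: "coef 0 m = 0"
  and coef_add [simp]: "coef (p + q) m = coef p m + coef q m"
  and coef_scaleR [simp]: "coef (r *\<^sub>R p) m = r * coef p m"
  by (simp_all add: coef_def Rep_superalg_simps lookup_add)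

lemma coef_sum: "coef (sum f A) m = (\<Sum>x\<in>A. coef (f x) m)"
  by (induction A rule: infinite_finite_induct) auto

lemma coef_monomial: "mon_ok m \<Longrightarrow> coef (monomial m) m' = (if m' = m then 1 else 0)"
  by (simp add: coef_def monomial.rep_eq monp_def lookup_single when_def)

lemma mem_support_iff: "m \<in> support p \<longleftrightarrow> coef p m \<noteq> 0"
  by (simp add: support_def coef_def in_keys_iff)

lemma finite_support [simp]: "finite (support p)"
  by (simp add: support_def)

lemma mon_ok_support: "m \<in> support p \<Longrightarrow> mon_ok m"
  using Rep_superalg[of p] by (auto simp: support_def PP_def)

lemma support_0 [simp]: "support 0 = {}"
  by (simp add: mem_support_iff set_eq_iff)

lemma support_monomial: "mon_ok m \<Longrightarrow> support (monomial m) = {m}"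
  by (auto simp: mem_support_iff coef_monomial split: if_splits)

lemma superalg_expand: "p = (\<Sum>m\<in>support p. coef p m *\<^sub>R monomial m)"
proof (rule superalg_eqI)
  fix m
  have "coef (\<Sum>m'\<in>support p. coef p m' *\<^sub>R monomial m') m =
      (\<Sum>m'\<in>support p. if m' = m then coef p m' else 0)"
    unfolding coef_sum by (intro sum.cong) (auto simp: coef_monomial mon_ok_support)
  also have "\<dots> = coef p m" by (simp add: mem_support_iff)
  finally show "coef p m = coef (\<Sum>m'\<in>support p. coef p m' *\<^sub>R monomial m') m" ..
qed

lemma support_eq_empty_iff: "support p = {} \<longleftrightarrow> p = 0"
  using superalg_expand[of p] by auto

lemma linear_eqI_monomial:
  assumes "linear f" "linear g" "\<And>m. m \<in> support p \<Longrightarrow> f (monomial m) = g (monomial m)"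
  shows "f p = g p"
  by (subst (1 2) superalg_expand[of p])
    (simp add: assms linear_sum[OF assms(1)] linear_sum[OF assms(2)]
      linear_scale[OF assms(1)] linear_scale[OF assms(2)])

lemma monomial_even_mult:
  "mon_ok (E, {}) \<Longrightarrow> mon_ok (E', S) \<Longrightarrow> monomial (E, {}) * monomial (E', S) = monomial (E + E', S)"
  by transfer (auto simp: monp_def pmul_single_single mmul_def mon_ok_def)

lemma monomial_even_central: "monomial (E, {}) * p = p * monomial (E, {})"
proof (rule linear_eqI_monomial[where f = "\<lambda>p. monomial (E, {}) * p" and
    g = "\<lambda>p. p * monomial (E, {})"])
  show "monomial (E, {}) * monomial m = monomial m * monomial (E, {})" for m
    by (transfer, cases m) (auto simp: monp_def pmul_single_single mmul_def add.commute)
qed (auto intro!: linearI simp: distrib_right)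

lemma monomial_empty: "monomial ({#}, {}) = 1"
  by transfer (auto simp: monp_def mon_ok_def one_def)

lemma var_not_ok: "\<not> gen_ok x \<Longrightarrow> var x = 0"
  by transfer simp

lemma var_even: "gen_ok x \<Longrightarrow> \<not> gen_odd x \<Longrightarrow> var x = monomial ({#x#}, {})"
  by transfer (auto simp: gv_def monp_def mon_ok_def)

lemma var_even_central: "\<not> gen_odd x \<Longrightarrow> var x * p = p * var x"
  by (cases "gen_ok x") (simp_all add: var_not_ok var_even monomial_even_central)

lemma var_odd_square: "gen_odd x \<Longrightarrow> var x * var x = 0"
  by transfer (simp add: gv_def pmul_single_single mmul_def)

lemma var_odd_anticommute:
  assumes "gen_odd x" "gen_odd y"
  shows "var x * var y = - (var y * var x)"
proof (cases "x = y")
  case False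
  then have "to_nat x \<noteq> to_nat y" by simp
  then show ?thesis using assms False
    by transfer
      (auto simp: gv_def pmul_single_single mmul_def osign_singletons insert_commute single_uminus)
qed (simp add: var_odd_square assms)

lemma var_mult_monomial_even:
  assumes "gen_ok x" "\<not> gen_odd x" "mon_ok (E, S)"
  shows "var x * monomial (E, S) = monomial (add_mset x E, S)"
  using assms monomial_even_mult[of "{#x#}" E S] by (simp add: var_even mon_ok_def)

lemma var_mult_monomial_odd:
  assumes "gen_ok x" "gen_odd x" "mon_ok (E, S)"
  obtains c where "var x * monomial (E, S) = c *\<^sub>R monomial (E, insert x S)"
proof
  show "var x * monomial (E, S) = (if x \<in> S then 0 else osign {x} S) *\<^sub>R monomial (E, insert x S)"
    using assms
    by transfer (auto simp: gv_def monp_def pmul_single_single mmul_def mon_ok_def sc_single)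
qed

lemma var_mult_monomial_least:
  assumes "gen_ok x" "gen_odd x" "mon_ok (E, S)" "\<And>y. y \<in> S \<Longrightarrow> to_nat x < to_nat y"
  shows "var x * monomial (E, S) = monomial (E, insert x S)"
proof -
  have "x \<notin> S" "osign {x} S = 1"
    using assms(3,4) osign_least[of S x] by (auto simp: mon_ok_def)
  then show ?thesis using assms(1-3)
    by transfer (auto simp: gv_def monp_def pmul_single_single mmul_def mon_ok_def)
qed

definition factors :: "('n, 'g) mon \<Rightarrow> ('n, 'g) gen multiset" where
  "factors m = fst m + mset_set (snd m)"

lemma factors_empty [simp]: "factors ({#}, {}) = {#}"
  by (simp add: factors_def)

lemma monomial_even_induct [consumes 1, case_names odd even]:
  assumes "mon_ok m" and "\<And>S. mon_ok ({#}, S) \<Longrightarrow> P ({#}, S)"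
    and "\<And>x E S. gen_ok x \<Longrightarrow> \<not> gen_odd x \<Longrightarrow> mon_ok (E, S) \<Longrightarrow> P (E, S) \<Longrightarrow> P (add_mset x E, S)"
  shows "P m"
proof -
  have "mon_ok (E, S) \<Longrightarrow> P (E, S)" for E S
  proof (induction E)
    case (add x E)
    then have "gen_ok x" "\<not> gen_odd x" "mon_ok (E, S)" by (auto simp: mon_ok_def)
    with add.IH show ?case by (simp add: assms(3))
  qed (rule assms(2))
  then show ?thesis using assms(1) by (cases m) simp
qed

lemma finite_least_induct [consumes 1, case_names empty insert]:
  fixes S :: "'a::countable set"
  assumes "finite S" and "P {}"
    and "\<And>x S. finite S \<Longrightarrow> (\<And>y. y \<in> S \<Longrightarrow> to_nat x < to_nat y) \<Longrightarrow> P S \<Longrightarrow> P (insert x S)"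
  shows "P S"
  using assms(1)
proof (induction S rule: finite_psubset_induct)
  case (psubset S)
  show ?case
  proof (cases "S = {}")
    case False
    obtain x where x: "x \<in> S" "\<And>y. y \<in> S \<Longrightarrow> to_nat x \<le> to_nat y"
      using arg_min_if_finite[OF psubset.hyps False, of to_nat] by (metis not_less)
    have "to_nat x < to_nat y" if "y \<in> S - {x}" for y
      using that x(2)[of y] by (auto simp: order_less_le)
    with psubset x(1) have "P (insert x (S - {x}))"
      by (intro assms(3)) auto
    with x(1) show ?thesis by (simp add: insert_absorb)
  qed (use assms(2) in simp)
qed

lemma monomial_induct [consumes 1, case_names empty var]:
  assumes "mon_ok m" and empty: "P ({#}, {})"
    and var: "\<And>x m m'. gen_ok x \<Longrightarrow> mon_ok m \<Longrightarrow> mon_ok m' \<Longrightarrow> monomial m' = var x * monomial m \<Longrightarrow>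
      factors m' = add_mset x (factors m) \<Longrightarrow> P m \<Longrightarrow> P m'"
  shows "P m"
  using assms(1)
proof (induction rule: monomial_even_induct)
  case (odd S)
  then have "finite S" by (simp add: mon_ok_def)
  then show ?case using odd
  proof (induction rule: finite_least_induct)
    case (insert x S)
    then have ok: "mon_ok ({#}, S)" "gen_ok x" "gen_odd x"
      by (auto simp: mon_ok_def)
    have "monomial ({#}, insert x S) = var x * monomial ({#}, S)"
      using var_mult_monomial_least[OF ok(2,3,1) insert.hyps(2)] by simp
    moreover have "factors ({#}, insert x S) = add_mset x (factors ({#}, S))"
    proof -
      have "x \<notin> S" using insert.hyps(2) by blast
      then show ?thesis using insert.hyps(1) by (simp add: factors_def)
    qed
    moreover have "P ({#}, S)" using insert.IH[OF ok(1)] .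
    ultimately show ?case by (rule var[OF ok(2,1) insert.prems])
  qed (rule empty)
next
  case (even x E S)
  then have "mon_ok (add_mset x E, S)" by (auto simp: mon_ok_def)
  show ?case
    by (rule var[OF even(1,3) \<open>mon_ok (add_mset x E, S)\<close>])
      (use even in \<open>simp_all add: var_mult_monomial_even factors_def\<close>)
qed

lemma superalg_induct [case_names one zero add scaleR var]:
  assumes one: "P 1" and zero: "P 0" and add: "\<And>p q. P p \<Longrightarrow> P q \<Longrightarrow> P (p + q)"
    and scaleR: "\<And>r p. P p \<Longrightarrow> P (r *\<^sub>R p)" and var: "\<And>x p. gen_ok x \<Longrightarrow> P p \<Longrightarrow> P (var x * p)"
  shows "P p"
proof -
  have monomial: "P (monomial m)" if "mon_ok m" for m
    using that by (induction rule: monomial_induct) (auto simp: monomial_empty one var)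
  have "A \<subseteq> support p \<Longrightarrow> P (\<Sum>m\<in>A. coef p m *\<^sub>R monomial m)" for A
    by (induction A rule: infinite_finite_induct)
      (auto intro: zero add scaleR monomial mon_ok_support)
  from this[of "support p"] show ?thesis using superalg_expand[of p] by simp
qed

subsection \<open>Conditions on the monomials of an element\<close>

definition supported ::
    "(('n, 'g) gen multiset \<Rightarrow> bool) \<Rightarrow> ('n::{finite,linorder}, 'g::finite) superalg \<Rightarrow> bool" where
  "supported P p \<longleftrightarrow> (\<forall>m\<in>support p. P (factors m))"

lemma supported_0 [simp]: "supported P 0"
  by (simp add: supported_def)

lemma supported_add: "supported P p \<Longrightarrow> supported P q \<Longrightarrow> supported P (p + q)"
  by (auto simp: supported_def mem_support_iff)

lemma supported_scaleR: "supported P p \<Longrightarrow> supported P (r *\<^sub>R p)"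
  by (auto simp: supported_def mem_support_iff)

lemma supported_uminus: "supported P p \<Longrightarrow> supported P (- p)"
  using supported_scaleR[of P p "-1"] by simp

lemma supported_diff: "supported P p \<Longrightarrow> supported P q \<Longrightarrow> supported P (p - q)"
  using supported_add[of P p "- q"] by (simp add: supported_uminus)

lemma supported_sum: "(\<And>x. x \<in> A \<Longrightarrow> supported P (f x)) \<Longrightarrow> supported P (sum f A)"
  by (induction A rule: infinite_finite_induct) (auto intro: supported_add)

lemmas supported_linear_intros =
  supported_0 supported_add supported_uminus supported_diff supported_scaleR supported_sum

lemma supported_monomial: "mon_ok m \<Longrightarrow> supported P (monomial m) \<longleftrightarrow> P (factors m)"
  by (simp add: supported_def support_monomial)

lemma supported_var: "P {#x#} \<Longrightarrow> supported P (var x)"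
  by (auto simp: supported_def support_def var.rep_eq gv_def factors_def split: if_splits)

lemma supported_mono: "supported P p \<Longrightarrow> (\<And>M. P M \<Longrightarrow> Q M) \<Longrightarrow> supported Q p"
  by (auto simp: supported_def)

lemma supported_False_iff: "supported (\<lambda>_. False) p \<longleftrightarrow> p = 0"
  by (auto simp: supported_def simp flip: support_eq_empty_iff)

lemma supported_mult:
  assumes "supported P p" "supported Q q" "\<And>M N. P M \<Longrightarrow> Q N \<Longrightarrow> R (M + N)"
  shows "supported R (p * q)"
  unfolding supported_def
proof
  fix m assume "m \<in> support (p * q)"
  then have "m \<in> Poly_Mapping.keys (Rep_superalg p \<star> Rep_superalg q)"
    by (simp add: support_def times_superalg.rep_eq)
  then obtain r m1 m2 where
      m: "m1 \<in> support p" "m2 \<in> support q" "m \<in> Poly_Mapping.keys (mmul r m1 m2)"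
    unfolding pmul_def support_def by (blast dest!: subsetD[OF Poly_Mapping.keys_sum])
  then have "m = (fst m1 + fst m2, snd m1 \<union> snd m2)" "snd m1 \<inter> snd m2 = {}"
    by (auto simp: mmul_def split: if_splits)
  moreover have "finite (snd m1)" "finite (snd m2)"
    using m(1,2)[THEN mon_ok_support] by (simp_all add: mon_ok_def)
  ultimately have "factors m = factors m1 + factors m2"
    by (simp add: factors_def mset_set_Union)
  with m(1,2) assms show "R (factors m)" by (simp add: supported_def)
qed

definition parity :: "bool \<Rightarrow> ('n, 'g) gen multiset \<Rightarrow> bool" where
  "parity b M \<longleftrightarrow> odd (size (filter_mset gen_odd M)) = b"

definition koszul_sign :: "bool \<Rightarrow> bool \<Rightarrow> real" where
  "koszul_sign a b = (if a \<and> b then -1 else 1)"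

lemma parity_mult_var:
  assumes "supported (parity b) p"
  shows "p * var y = koszul_sign b (gen_odd y) *\<^sub>R (var y * p)"
proof (cases "gen_odd y")
  case True
  let ?sign = "\<lambda>M. (-1) ^ size (filter_mset gen_odd M) :: real"
  have commute: "monomial m * var y = ?sign (factors m) *\<^sub>R (var y * monomial m)"
      if "mon_ok m" for m
    using that
  proof (induction rule: monomial_induct)
    case (var x m m')
    have "var x * (var y * monomial m) =
        (if gen_odd x then -1 else 1) *\<^sub>R (var y * (var x * monomial m))"
      using var_odd_anticommute[OF _ True, of x] var_even_central[of x "var y"]
      by (simp flip: mult.assoc)
    then show ?case by (simp add: var mult.assoc)
  qed (simp add: monomial_empty)
  show ?thesis
  proof (rule linear_eqI_monomial[where f = "\<lambda>p. p * var y"])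
    fix m assume "m \<in> support p"
    then have "?sign (factors m) = koszul_sign b (gen_odd y)"
      using assms True by (auto simp: supported_def parity_def koszul_sign_def)
    then show "monomial m * var y = koszul_sign b (gen_odd y) *\<^sub>R (var y * monomial m)"
      using True commute[OF mon_ok_support[OF \<open>m \<in> support p\<close>]] by simp
  qed (auto intro!: linearI simp: distrib_right distrib_left scaleR_add_right mult.commute)
qed (simp add: var_even_central koszul_sign_def)

subsection \<open>Rescaling of monomials\<close>

definition rescale ::
    "(('n, 'g) gen multiset \<Rightarrow> real) \<Rightarrow>
      ('n::{finite,linorder}, 'g::finite) superalg \<Rightarrow> ('n, 'g) superalg" where
  "rescale h p = (\<Sum>m\<in>support p. (h (factors m) * coef p m) *\<^sub>R monomial m)"

lemma coef_rescale [simp]: "coef (rescale h p) m = h (factors m) * coef p m"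
proof -
  have "coef (rescale h p) m = (\<Sum>m'\<in>support p. if m' = m then h (factors m') * coef p m' else 0)"
    unfolding rescale_def coef_sum by (intro sum.cong) (auto simp: coef_monomial mon_ok_support)
  then show ?thesis by (simp add: mem_support_iff)
qed

lemma linear_rescale: "linear (rescale h)"
  by (intro linearI superalg_eqI) (simp_all add: distrib_left)

lemma supported_rescale: "supported P p \<Longrightarrow> supported P (rescale h p)"
  by (auto simp: supported_def mem_support_iff)

lemma rescale_const: "supported (\<lambda>M. h M = r) p \<Longrightarrow> rescale h p = r *\<^sub>R p"
  by (rule superalg_eqI) (auto simp: supported_def mem_support_iff)

lemma rescale_rescale_inverse: "supported (\<lambda>M. h M * h' M = 1) p \<Longrightarrow> rescale h (rescale h' p) = p"
  by (rule superalg_eqI) (auto simp: supported_def mem_support_iff simp flip: mult.assoc)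

section \<open>Derivations\<close>

lemma PP_foldr_gv: "(\<And>x. x \<in> set xs \<Longrightarrow> gen_ok x) \<Longrightarrow> foldr (\<lambda>y q. gv y \<star> q) xs one \<in> PP"
  by (induction xs) (auto intro!: PP_one PP_pmul PP_gv)

lemma PP_dlist:
  "(\<And>x. f x \<in> PP) \<Longrightarrow> (\<And>x. x \<in> set xs \<Longrightarrow> gen_ok x) \<Longrightarrow> dlist d f xs \<in> PP"
  by (induction xs) (auto intro!: PP_add PP_pmul PP_sc PP_foldr_gv PP_gv)

lemma (in linorder)
  assumes "inj f"
  shows sorted_key_list_of_set_empty_inj: "sorted_key_list_of_set f {} = []"
    and set_sorted_key_list_of_set_inj: "finite A \<Longrightarrow> set (sorted_key_list_of_set f A) = A"
    and sorted_key_list_of_set_insert_least: "finite A \<Longrightarrow> (\<And>y. y \<in> A \<Longrightarrow> f x < f y) \<Longrightarrow>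
      sorted_key_list_of_set f (insert x A) = x # sorted_key_list_of_set f A"
proof -
  interpret folding_insort_key "(\<le>)" "(<)" UNIV f
    by unfold_locales (rule assms)
  show "sorted_key_list_of_set f {} = []"
    by simp
  show set: "set (sorted_key_list_of_set f A) = A" if "finite A" for A
    using that by simp
  assume A: "finite A" and least: "\<And>y. y \<in> A \<Longrightarrow> f x < f y"
  have "x \<notin> A" using least by blast
  then have "sorted_key_list_of_set f (insert x A) = insort_key f x (sorted_key_list_of_set f A)"
    using A by (intro sorted_key_list_of_set_insert) auto
  also have "\<dots> = x # sorted_key_list_of_set f A"
    using least by (intro insort_is_Cons) (auto simp: set[OF A] less_imp_le)
  finally show "sorted_key_list_of_set f (insert x A) = x # sorted_key_list_of_set f A" .
qed

lemma sorted_odd_empty [simp]: "sorted_odd {} = []"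
  and set_sorted_odd [simp]: "finite S \<Longrightarrow> set (sorted_odd S) = S"
  and sorted_odd_insert_least: "finite S \<Longrightarrow> (\<And>y. y \<in> S \<Longrightarrow> to_nat x < to_nat y) \<Longrightarrow>
    sorted_odd (insert x S) = x # sorted_odd S"
  by (simp_all add: sorted_odd_def sorted_key_list_of_set_empty_inj set_sorted_key_list_of_set_inj
      sorted_key_list_of_set_insert_least)

lemma PP_der: "(\<And>x. f x \<in> PP) \<Longrightarrow> p \<in> PP \<Longrightarrow> der d f p \<in> PP"
  unfolding der_def dmon_def
  by (intro PP_sum PP_sc PP_add PP_pmul PP_dlist PP_monp)
    (auto simp: PP_def mon_ok_def dest: in_diffD)

lift_definition derivation ::
    "nat \<Rightarrow> (('n::{finite,linorder}, 'g::finite) gen \<Rightarrow> ('n, 'g) superalg) \<Rightarrow>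
      ('n, 'g) superalg \<Rightarrow> ('n, 'g) superalg"
  is der by (rule PP_der) auto

lemma der_eq_sum_superset:
  assumes "finite A" "Poly_Mapping.keys p \<subseteq> A"
  shows "der d f p = (\<Sum>m\<in>A. sc (Poly_Mapping.lookup p m) (dmon d f m))"
  unfolding der_def
  by (intro sum.mono_neutral_left) (use assms in \<open>auto simp: in_keys_iff\<close>)

lemma linear_derivation: "linear (derivation d f)"
proof (rule linearI)
  show "derivation d f (p + q) = derivation d f p + derivation d f q" for p q
  proof (transfer, goal_cases)
    case (1 d f p q)
    show ?case
      by (subst (1 2 3) der_eq_sum_superset
            [where A = "Poly_Mapping.keys p \<union> Poly_Mapping.keys q"])
        (use Poly_Mapping.keys_add[of p q] in \<open>auto simp: lookup_add sc_add_left sum.distrib\<close>)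
  qed
  show "derivation d f (r *\<^sub>R p) = r *\<^sub>R derivation d f p" for r p
  proof (transfer, goal_cases)
    case (1 d f r p)
    show ?case
      by (subst (1 2) der_eq_sum_superset[where A = "Poly_Mapping.keys p"])
        (use keys_sc_subset[of r p] in \<open>auto simp: sc_sc sc_sum\<close>)
  qed
qed

lemmas derivation_linear_simps =
  linear_0[OF linear_derivation] linear_add[OF linear_derivation] linear_neg[OF linear_derivation]
  linear_diff[OF linear_derivation] linear_scale[OF linear_derivation]
  linear_sum[OF linear_derivation]

lemma dlist_cong: "(\<And>x. x \<in> set xs \<Longrightarrow> f x = g x) \<Longrightarrow> dlist d f xs = dlist d g xs"
  by (induction xs) auto

lemma der_cong:
  assumes "p \<in> PP" "\<And>x. gen_ok x \<Longrightarrow> f x = g x"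
  shows "der d f p = der d g p"
proof -
  have "dmon d f m = dmon d g m" if "mon_ok m" for m
    using that assms(2) unfolding dmon_def
    by (intro arg_cong2[of _ _ _ _ "(+)"] sum.cong arg_cong2[of _ _ _ _ "(\<star>)"] dlist_cong)
      (auto simp: mon_ok_def)
  then show ?thesis using assms(1) by (simp add: der_def PP_def)
qed

subsection \<open>Derivations of monomials\<close>

lemma sum_mset_count_scaleR:
  fixes h :: "'a \<Rightarrow> 'b::real_vector"
  shows "(\<Sum>e\<in>set_mset E. real (count E e) *\<^sub>R h e) = (\<Sum>e\<in>#E. h e)"
proof (induction E)
  case (add x E)
  have "(\<Sum>e\<in>set_mset (add_mset x E). real (count (add_mset x E) e) *\<^sub>R h e)
      = (\<Sum>e\<in>insert x (set_mset E). real (count E e) *\<^sub>R h e + (if e = x then h x else 0))"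
    by (intro sum.cong) (auto simp: scaleR_left_distrib)
  also have "\<dots> = (\<Sum>e\<in>set_mset E. real (count E e) *\<^sub>R h e) + h x"
    by (cases "x \<in># E") (auto simp: sum.distrib insert_absorb not_in_iff)
  finally show ?case using add by (simp add: add.commute)
qed simp

lemma scaleR_sum_mset: "r *\<^sub>R (\<Sum>e\<in>#E. h e) = (\<Sum>e\<in>#E. r *\<^sub>R h e :: 'b::real_vector)"
  by (induction E) (auto simp: scaleR_add_right)

lemma Rep_monomial: "mon_ok m \<Longrightarrow> Rep_superalg (monomial m) = monp m"
  by (simp add: monomial.rep_eq)

lemma Rep_derivation_monomial:
  assumes "mon_ok m"
  shows "Rep_superalg (derivation d f (monomial m)) = dmon d (\<lambda>x. Rep_superalg (f x)) m"
  using assms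
  by (simp add: derivation.rep_eq Rep_monomial der_eq_sum_superset[where A = "{m}"] monp_def
      comp_def)

lemma Rep_derivation_odd_monomial:
  "mon_ok ({#}, S) \<Longrightarrow>
    Rep_superalg (derivation d f (monomial ({#}, S))) =
        dlist d (\<lambda>x. Rep_superalg (f x)) (sorted_odd S)"
  by (simp add: Rep_derivation_monomial dmon_def monp_def one_pmul flip: one_def)

lemma derivation_monomial:
  assumes "mon_ok (E, S)"
  shows "derivation d f (monomial (E, S)) = (\<Sum>e\<in>#E. f e * monomial (E - {#e#}, S))
    + monomial (E, {}) * derivation d f (monomial ({#}, S))"
proof -
  have ok: "mon_ok (E, {})" "mon_ok ({#}, S)" "\<And>e. mon_ok (E - {#e#}, S)"
    using assms by (auto simp: mon_ok_def dest: in_diffD)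
  have "Rep_superalg (derivation d f (monomial (E, S))) =
      Rep_superalg ((\<Sum>e\<in>set_mset E. real (count E e) *\<^sub>R (f e * monomial (E - {#e#}, S)))
        + monomial (E, {}) * derivation d f (monomial ({#}, S)))"
    using assms ok
    by (simp add: Rep_derivation_odd_monomial Rep_derivation_monomial[OF assms] dmon_def
        Rep_superalg_simps Rep_monomial)
  then show ?thesis by (simp add: Rep_superalg_inject sum_mset_count_scaleR)
qed

lemma derivation_1 [simp]: "derivation d f 1 = 0"
proof -
  have "Rep_superalg (derivation d f 1) = 0"
    using Rep_derivation_odd_monomial[of "{}" d f]
    by (simp add: monomial_empty mon_ok_def)
  then show ?thesis by (simp add: zero_superalg.rep_eq flip: Rep_superalg_inject)
qed

lemma foldr_gv_sorted_odd:
  fixes S :: "('n::{finite,linorder}, 'g::finite) gen set"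
  shows "finite S \<Longrightarrow> mon_ok ({#}, S) \<Longrightarrow>
    foldr (\<lambda>y q. gv y \<star> q) (sorted_odd S) one = monp ({#}, S)"
proof (induction S rule: finite_least_induct)
  case (insert x S)
  then have ok: "gen_ok x" "gen_odd x" "mon_ok ({#}, S)" by (auto simp: mon_ok_def)
  have "Rep_superalg (var x * monomial ({#}, S)) = Rep_superalg (monomial ({#}, insert x S))"
    using var_mult_monomial_least[OF ok insert.hyps(2)] by simp
  then show ?case
    using ok insert.prems insert.IH sorted_odd_insert_least[OF insert.hyps(1,2)]
    by (simp add: Rep_superalg_simps Rep_monomial var.rep_eq)
qed (simp add: one_def monp_def)

lemma derivation_odd_monomial_insert_least:
  assumes "gen_ok x" "gen_odd x" "mon_ok ({#}, S)" and least: "\<And>y. y \<in> S \<Longrightarrow> to_nat x < to_nat y"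
  shows "derivation d f (monomial ({#}, insert x S)) =
    f x * monomial ({#}, S)
      + koszul_sign (odd d) True *\<^sub>R (var x * derivation d f (monomial ({#}, S)))"
proof -
  have fin: "finite S" and ok: "mon_ok ({#}, insert x S)" using assms by (auto simp: mon_ok_def)
  have "(-1) ^ d = koszul_sign (odd d) True" by (simp add: koszul_sign_def)
  then have "Rep_superalg (derivation d f (monomial ({#}, insert x S))) =
      Rep_superalg (f x * monomial ({#}, S)
        + koszul_sign (odd d) True *\<^sub>R (var x * derivation d f (monomial ({#}, S))))"
    using assms(1-3) ok sorted_odd_insert_least[OF fin least] foldr_gv_sorted_odd[OF fin assms(3)]
    by (simp add: Rep_derivation_odd_monomial Rep_superalg_simps Rep_monomial var.rep_eq)
  then show ?thesis by (simp add: Rep_superalg_inject)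
qed

subsection \<open>The graded Leibniz rule\<close>

definition graded_map ::
    "nat \<Rightarrow> (('n::{finite,linorder}, 'g::finite) gen \<Rightarrow> ('n, 'g) superalg) \<Rightarrow> bool" where
  "graded_map d f \<longleftrightarrow> (\<forall>x. gen_ok x \<longrightarrow> supported (parity (gen_odd x \<noteq> odd d)) (f x))"

lemma graded_map_mult_var:
  "graded_map d f \<Longrightarrow> gen_ok x \<Longrightarrow>
    f x * var y = koszul_sign (gen_odd x \<noteq> odd d) (gen_odd y) *\<^sub>R (var y * f x)"
  by (simp add: graded_map_def parity_mult_var)

lemma derivation_var_mult_even:
  assumes x: "gen_ok x" "\<not> gen_odd x" and m: "mon_ok (E, S)"
  shows "derivation d f (var x * monomial (E, S)) =
    f x * monomial (E, S) + var x * derivation d f (monomial (E, S))"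
proof -
  have ok: "mon_ok (add_mset x E, S)" "mon_ok (E, {})" "\<And>e. mon_ok (E - {#e#}, S)"
    using x m by (auto simp: mon_ok_def dest: in_diffD)
  have "f e * monomial (add_mset x E - {#e#}, S) = var x * (f e * monomial (E - {#e#}, S))"
    if "e \<in># E" for e
  proof -
    have "f e * monomial (add_mset x E - {#e#}, S) = f e * var x * monomial (E - {#e#}, S)"
      using that var_mult_monomial_even[OF x ok(3)[of e]] by (simp add: mult.assoc)
    then show ?thesis by (simp add: mult.assoc flip: var_even_central[OF x(2)])
  qed
  then have "(\<Sum>e\<in>#add_mset x E. f e * monomial (add_mset x E - {#e#}, S)) =
      f x * monomial (E, S) + var x * (\<Sum>e\<in>#E. f e * monomial (E - {#e#}, S))"
    by (simp add: sum_mset_distrib_left cong: image_mset_cong)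
  moreover have "monomial (add_mset x E, {}) = var x * monomial (E, {})"
    by (rule var_mult_monomial_even[OF x ok(2), symmetric])
  ultimately show ?thesis
    by (simp add: var_mult_monomial_even[OF x m] derivation_monomial[OF ok(1)]
        derivation_monomial[OF m] distrib_left mult.assoc)
qed

lemma derivation_var_mult_least:
  assumes f: "graded_map d f" and x: "gen_ok x" "gen_odd x" and m: "mon_ok (E, S)"
    and least: "\<And>y. y \<in> S \<Longrightarrow> to_nat x < to_nat y"
  shows "derivation d f (var x * monomial (E, S)) =
    f x * monomial (E, S) + koszul_sign (odd d) True *\<^sub>R (var x * derivation d f (monomial (E, S)))"
proof -
  let ?s = "koszul_sign (odd d) True"
  have ok: "mon_ok (E, insert x S)" "mon_ok ({#}, S)" "mon_ok (E, {})" "\<And>e. mon_ok (E - {#e#}, S)"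
    using x m by (auto simp: mon_ok_def dest: in_diffD)
  have "f e * monomial (E - {#e#}, insert x S) = ?s *\<^sub>R (var x * (f e * monomial (E - {#e#}, S)))"
    if "e \<in># E" for e
  proof -
    have "gen_ok e" "\<not> gen_odd e" using that m by (auto simp: mon_ok_def)
    then have "f e * var x = ?s *\<^sub>R (var x * f e)"
      using graded_map_mult_var[OF f, of e x] x by simp
    then have "f e * var x * monomial (E - {#e#}, S) =
        ?s *\<^sub>R (var x * f e * monomial (E - {#e#}, S))"
      by simp
    then show ?thesis
      using var_mult_monomial_least[OF x ok(4)[of e] least] by (simp add: mult.assoc)
  qed
  then have even_part: "(\<Sum>e\<in>#E. f e * monomial (E - {#e#}, insert x S)) =
      ?s *\<^sub>R (var x * (\<Sum>e\<in>#E. f e * monomial (E - {#e#}, S)))"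
    by (simp add: sum_mset_distrib_left scaleR_sum_mset cong: image_mset_cong)
  have odd_part: "monomial (E, {}) * derivation d f (monomial ({#}, insert x S)) =
      f x * monomial (E, S)
        + ?s *\<^sub>R (var x * (monomial (E, {}) * derivation d f (monomial ({#}, S))))"
    using monomial_even_mult[OF ok(3,2)]
    by (simp add: derivation_odd_monomial_insert_least[OF x ok(2) least] distrib_left
        monomial_even_central[of E "f x"] monomial_even_central[of E "var x"] mult.assoc
        flip: mult.assoc[of "monomial (E, {})"])
  show ?thesis
    by (simp add: var_mult_monomial_least[OF x m least] derivation_monomial[OF ok(1)]
        derivation_monomial[OF m] even_part odd_part distrib_left scaleR_add_right)
qed

lemma graded_map_mult_var_odd:
  assumes "graded_map d f" "gen_ok x" "gen_odd x" "gen_odd y"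
  shows "f x * (var y * p) = - (koszul_sign (odd d) True *\<^sub>R (var y * (f x * p)))"
proof -
  have "f x * var y = - (koszul_sign (odd d) True *\<^sub>R (var y * f x))"
    using graded_map_mult_var[OF assms(1,2), of y] assms(3,4) by (simp add: koszul_sign_def)
  then have "f x * var y * p = - (koszul_sign (odd d) True *\<^sub>R (var y * f x)) * p" by simp
  then show ?thesis by (simp add: mult.assoc)
qed

lemma derivation_var_mult_swap:
  assumes f: "graded_map d f" and x: "gen_ok x" "gen_odd x" and y: "gen_ok y" "gen_odd y"
    and Leibniz_x: "derivation d f (var x * p) =
        f x * p + koszul_sign (odd d) True *\<^sub>R (var x * derivation d f p)"
    and Leibniz_y: "derivation d f (var y * p) =
        f y * p + koszul_sign (odd d) True *\<^sub>R (var y * derivation d f p)"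
    and Leibniz_y_x: "derivation d f (var y * (var x * p)) =
      f y * (var x * p) + koszul_sign (odd d) True *\<^sub>R (var y * derivation d f (var x * p))"
  shows "derivation d f (var x * (var y * p)) =
    f x * (var y * p) + koszul_sign (odd d) True *\<^sub>R (var x * derivation d f (var y * p))"
proof -
  have swap: "var x * (var y * q) = - (var y * (var x * q))" for q
    using var_odd_anticommute[OF x(2) y(2)] by (simp flip: mult.assoc)
  have "derivation d f (var x * (var y * p)) = - derivation d f (var y * (var x * p))"
    by (simp add: swap derivation_linear_simps)
  then show ?thesis
    by (simp add: Leibniz_x Leibniz_y Leibniz_y_x swap graded_map_mult_var_odd[OF f] x y
        distrib_left scaleR_add_right koszul_sign_def)
qed

lemma derivation_var_mult_odd_insert_smaller:
  assumes f: "graded_map d f" and x: "gen_ok x" "gen_odd x" and y: "gen_ok y" "gen_odd y"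
    and S: "mon_ok (E, S)" and less: "to_nat y < to_nat x" "\<And>z. z \<in> S \<Longrightarrow> to_nat y < to_nat z"
    and Leibniz_x: "derivation d f (var x * monomial (E, S)) = f x * monomial (E, S)
      + koszul_sign (odd d) True *\<^sub>R (var x * derivation d f (monomial (E, S)))"
  shows "derivation d f (var x * (var y * monomial (E, S))) = f x * (var y * monomial (E, S))
    + koszul_sign (odd d) True *\<^sub>R (var x * derivation d f (var y * monomial (E, S)))"
proof (rule derivation_var_mult_swap[OF f x y Leibniz_x])
  show "derivation d f (var y * monomial (E, S)) = f y * monomial (E, S)
      + koszul_sign (odd d) True *\<^sub>R (var y * derivation d f (monomial (E, S)))"
    by (rule derivation_var_mult_least[OF f y S less(2)])
  obtain r where mult_x: "var x * monomial (E, S) = r *\<^sub>R monomial (E, insert x S)"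
    using var_mult_monomial_odd[OF x S] .
  have "mon_ok (E, insert x S)" using S x by (auto simp: mon_ok_def)
  moreover have "to_nat y < to_nat z" if "z \<in> insert x S" for z
    using that less by blast
  ultimately have "derivation d f (var y * monomial (E, insert x S)) =
      f y * monomial (E, insert x S)
      + koszul_sign (odd d) True *\<^sub>R (var y * derivation d f (monomial (E, insert x S)))"
    by (intro derivation_var_mult_least[OF f y])
  then show "derivation d f (var y * (var x * monomial (E, S))) = f y * (var x * monomial (E, S))
      + koszul_sign (odd d) True *\<^sub>R (var y * derivation d f (var x * monomial (E, S)))"
    by (simp add: mult_x derivation_linear_simps scaleR_add_right mult.commute)
qed

text \<open>Induction on the odd factors: the least one, \<open>y\<close>, is moved past \<open>x\<close> if it precedes \<open>x\<close>.\<close>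
lemma derivation_var_mult_odd:
  assumes f: "graded_map d f" and x: "gen_ok x" "gen_odd x" and "mon_ok (E, S)"
  shows "derivation d f (var x * monomial (E, S)) =
    f x * monomial (E, S) + koszul_sign (odd d) True *\<^sub>R (var x * derivation d f (monomial (E, S)))"
proof -
  have "finite S" using assms(4) by (simp add: mon_ok_def)
  then show ?thesis using assms(4)
  proof (induction S rule: finite_least_induct)
    case empty
    then show ?case using derivation_var_mult_least[OF f x, of E "{}"] by simp
  next
    case (insert y S)
    have y: "gen_ok y" "gen_odd y" and S: "mon_ok (E, S)"
      using insert.prems by (auto simp: mon_ok_def)
    have mult_y: "monomial (E, insert y S) = var y * monomial (E, S)"
      by (rule var_mult_monomial_least[OF y S insert.hyps(2), symmetric])
    consider (less) "to_nat x < to_nat y" | (equal) "x = y" | (greater) "to_nat y < to_nat x"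
      using linorder_cases[of "to_nat x" "to_nat y"] by (auto simp: inj_eq[OF inj_to_nat])
    then show ?case
    proof cases
      case less
      then have "\<And>z. z \<in> insert y S \<Longrightarrow> to_nat x < to_nat z"
        using insert.hyps(2) by (auto intro: less_trans)
      then show ?thesis by (rule derivation_var_mult_least[OF f x insert.prems])
    next
      case equal
      have "var x * (var x * q) = 0" for q
        using var_odd_square[OF x(2)] by (simp flip: mult.assoc)
      then show ?thesis
        using graded_map_mult_var_odd[OF f x x(2)]
          derivation_var_mult_least[OF f y S insert.hyps(2)]
        by (simp add: mult_y equal distrib_left derivation_linear_simps)
    next
      case greater
      then show ?thesis
        unfolding mult_y
        by (rule derivation_var_mult_odd_insert_smaller
              [OF f x y S _ insert.hyps(2) insert.IH[OF S]])
    qed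
  qed
qed

lemma derivation_var_mult:
  assumes f: "graded_map d f" and x: "gen_ok x"
  shows "derivation d f (var x * p) =
    f x * p + koszul_sign (odd d) (gen_odd x) *\<^sub>R (var x * derivation d f p)"
proof (rule linear_eqI_monomial[where f = "\<lambda>p. derivation d f (var x * p)"])
  fix m assume "m \<in> support p"
  then obtain E S where m: "m = (E, S)" "mon_ok (E, S)"
    using mon_ok_support by (cases m) blast
  show "derivation d f (var x * monomial m) =
      f x * monomial m + koszul_sign (odd d) (gen_odd x) *\<^sub>R (var x * derivation d f (monomial m))"
    using derivation_var_mult_odd[OF f x] derivation_var_mult_even[OF x]
    by (cases "gen_odd x") (simp_all add: m koszul_sign_def)
qed (auto intro!: linearI simp: distrib_left derivation_linear_simps scaleR_add_right mult.commute)

lemma derivation_var: "graded_map d f \<Longrightarrow> gen_ok x \<Longrightarrow> derivation d f (var x) = f x"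
  using derivation_var_mult[of d f x 1] by simp

lemma derivation_mult:
  assumes f: "graded_map d f" and p: "supported (parity b) p"
  shows "derivation d f (p * q) = derivation d f p * q
      + koszul_sign (odd d) b *\<^sub>R (p * derivation d f q)"
proof (rule linear_eqI_monomial[where p = p and f = "\<lambda>p. derivation d f (p * q)"])
  have Leibniz: "derivation d f (monomial m * q) = derivation d f (monomial m) * q +
      (-1) ^ (d * size (filter_mset gen_odd (factors m))) *\<^sub>R (monomial m * derivation d f q)"
    if "mon_ok m" for m
    using that
  proof (induction rule: monomial_induct)
    case (var x m m')
    have "(-1) ^ (d * size (filter_mset gen_odd (factors m'))) =
        koszul_sign (odd d) (gen_odd x) * (-1) ^ (d * size (filter_mset gen_odd (factors m)))"
      by (simp add: var.hyps koszul_sign_def power_add)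
    then show ?case
      by (simp add: var.hyps var.IH mult.assoc derivation_var_mult[OF f var.hyps(1)] algebra_simps)
  qed (simp add: monomial_empty)
  fix m assume m: "m \<in> support p"
  then have "(-1) ^ (d * size (filter_mset gen_odd (factors m))) = koszul_sign (odd d) b"
    using p by (auto simp: supported_def parity_def koszul_sign_def minus_one_power_iff)
  with Leibniz[OF mon_ok_support[OF m]]
  show "derivation d f (monomial m * q) =
      derivation d f (monomial m) * q + koszul_sign (odd d) b *\<^sub>R (monomial m * derivation d f q)"
    by simp
qed (auto intro!: linearI simp: distrib_right derivation_linear_simps scaleR_add_right mult.commute)

lemma derivation_even_mult:
  assumes "graded_map 0 f"
  shows "derivation 0 f (p * q) = derivation 0 f p * q + p * derivation 0 f q"
proof (rule linear_eqI_monomial[where p = p and f = "\<lambda>p. derivation 0 f (p * q)"])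
  fix m assume "m \<in> support p"
  then have "supported (parity (odd (size (filter_mset gen_odd (factors m))))) (monomial m)"
    by (simp add: supported_monomial mon_ok_support parity_def)
  from derivation_mult[OF assms this]
  show "derivation 0 f (monomial m * q) = derivation 0 f (monomial m) * q
      + monomial m * derivation 0 f q"
    by (simp add: koszul_sign_def)
qed (auto intro!: linearI simp: distrib_right derivation_linear_simps scaleR_add_right)

subsection \<open>Compositions of derivations\<close>

lemma derivation_square_zero:
  assumes f: "graded_map 1 f" and zero: "\<And>x. gen_ok x \<Longrightarrow> derivation 1 f (f x) = 0"
  shows "derivation 1 f (derivation 1 f p) = 0"
proof (induction p rule: superalg_induct)
  case (var x p)
  have "supported (parity (\<not> gen_odd x)) (f x)" using f var(1) by (simp add: graded_map_def)
  from derivation_mult[OF f this, of p] show ?case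
    using var zero
    by (simp add: derivation_var_mult[OF f var(1)] derivation_linear_simps koszul_sign_def
        del: One_nat_def)
qed (simp_all add: derivation_linear_simps)

lemma derivation_commute:
  assumes f: "graded_map d f" and g: "graded_map 0 g"
    and commute: "\<And>x. gen_ok x \<Longrightarrow> derivation d f (g x) = derivation 0 g (f x)"
  shows "derivation d f (derivation 0 g p) = derivation 0 g (derivation d f p)"
proof (induction p rule: superalg_induct)
  case (var x p)
  have "supported (parity (gen_odd x)) (g x)" using g var(1) by (simp add: graded_map_def)
  from derivation_mult[OF f this, of p] show ?case
    using var commute
    by (simp add: derivation_var_mult[OF f var(1)] derivation_even_mult[OF g]
        derivation_var[OF g var(1)] derivation_linear_simps koszul_sign_def algebra_simps)
qed (simp_all add: derivation_linear_simps)

lemma derivation_anticommutator_monomial: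
  assumes f: "graded_map 1 f" and g: "graded_map 1 g"
    and anticommute: "\<And>x. gen_ok x \<Longrightarrow> derivation 1 f (g x) + derivation 1 g (f x) = c x *\<^sub>R var x"
    and "mon_ok m"
  shows "derivation 1 f (derivation 1 g (monomial m))
      + derivation 1 g (derivation 1 f (monomial m)) =
    (\<Sum>x\<in>#factors m. c x) *\<^sub>R monomial m"
  using assms(4)
proof (induction rule: monomial_induct)
  case (var x m m')
  let ?p = "monomial m"
  let ?A = "\<lambda>p. derivation 1 f (derivation 1 g p) + derivation 1 g (derivation 1 f p)"
  have "supported (parity (\<not> gen_odd x)) (f x)" "supported (parity (\<not> gen_odd x)) (g x)"
    using f g var(1) by (simp_all add: graded_map_def)
  then have "?A (var x * ?p) = (derivation 1 f (g x) + derivation 1 g (f x)) * ?p + var x * ?A ?p"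
    using derivation_mult[OF f, of _ "g x" ?p] derivation_mult[OF g, of _ "f x" ?p]
    by (simp add: derivation_var_mult[OF f var(1)] derivation_var_mult[OF g var(1)]
        derivation_linear_simps koszul_sign_def algebra_simps del: One_nat_def)
  then show ?case
    by (simp add: var.hyps var.IH anticommute algebra_simps del: One_nat_def)
qed (simp add: monomial_empty derivation_linear_simps)

lemma derivation_anticommutator:
  assumes "graded_map 1 f" "graded_map 1 g"
    and "\<And>x. gen_ok x \<Longrightarrow> derivation 1 f (g x) + derivation 1 g (f x) = c x *\<^sub>R var x"
  shows "derivation 1 f (derivation 1 g p) + derivation 1 g (derivation 1 f p) =
    rescale (\<lambda>M. \<Sum>x\<in>#M. c x) p"
proof (rule linear_eqI_monomial[where
    f = "\<lambda>p. derivation 1 f (derivation 1 g p) + derivation 1 g (derivation 1 f p)"])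
  fix m assume "m \<in> support p"
  then have m: "mon_ok m" by (rule mon_ok_support)
  have "rescale (\<lambda>M. \<Sum>x\<in>#M. c x) (monomial m) = (\<Sum>x\<in>#factors m. c x) *\<^sub>R monomial m"
    by (rule rescale_const) (simp add: supported_monomial m)
  with derivation_anticommutator_monomial[OF assms m]
  show "derivation 1 f (derivation 1 g (monomial m))
      + derivation 1 g (derivation 1 f (monomial m)) =
      rescale (\<lambda>M. \<Sum>x\<in>#M. c x) (monomial m)"
    by (simp del: One_nat_def)
qed (auto intro!: linearI linear_rescale simp: derivation_linear_simps algebra_simps)

lemma graded_map_diff: "graded_map d f \<Longrightarrow> graded_map d g \<Longrightarrow> graded_map d (\<lambda>x. f x - g x)"
  by (simp add: graded_map_def supported_diff)

lemma derivation_diff_map: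
  assumes f: "graded_map d f" and g: "graded_map d g"
  shows "derivation d (\<lambda>x. f x - g x) p = derivation d f p - derivation d g p"
proof (induction p rule: superalg_induct)
  case (var x p)
  then show ?case
    using graded_map_diff[OF f g] f g
    by (simp add: derivation_var_mult left_diff_distrib right_diff_distrib scaleR_diff_right)
qed (simp_all add: derivation_linear_simps scaleR_diff_right add_diff_add)

subsection \<open>Monomials of a derivative\<close>

lemma supported_derivation_monomial:
  assumes f: "graded_map d f" and "mon_ok m"
    and "\<And>x M. gen_ok x \<Longrightarrow> factors m = add_mset x M \<Longrightarrow> supported (\<lambda>N. Q (M + N)) (f x)"
  shows "supported Q (derivation d f (monomial m))"
  using assms(2,3)
proof (induction arbitrary: Q rule: monomial_induct)
  case (var x m m')
  have "supported (\<lambda>N. Q (add_mset x N)) (derivation d f (monomial m))"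
    by (rule var.IH)
      (use var.prems[of _ "add_mset x _"] var.hyps(5) in \<open>auto simp: add_mset_commute\<close>)
  moreover have "supported (\<lambda>N. Q (factors m + N)) (f x)"
    using var.prems[OF var.hyps(1,5)] .
  moreover have "supported (\<lambda>M. M = factors m) (monomial m)"
    using var.hyps(2) by (simp add: supported_monomial)
  moreover have "supported (\<lambda>M. M = {#x#}) (var x)"
    by (simp add: supported_var)
  ultimately show ?case
    unfolding var.hyps(4) derivation_var_mult[OF f var.hyps(1)]
    by (intro supported_add supported_scaleR)
      (erule supported_mult, assumption, simp add: add.commute)+
qed (simp add: monomial_empty)

lemma supported_derivation:
  assumes f: "graded_map d f" and p: "supported P p"
    and step: "\<And>x M. gen_ok x \<Longrightarrow> P (add_mset x M) \<Longrightarrow> supported (\<lambda>N. Q (M + N)) (f x)"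
  shows "supported Q (derivation d f p)"
proof -
  have "supported Q (derivation d f (monomial m))" if "m \<in> support p" for m
    using p that by (intro supported_derivation_monomial[OF f mon_ok_support[OF that]] step)
      (auto simp: supported_def)
  then show ?thesis
    by (subst superalg_expand[of p])
      (auto simp: derivation_linear_simps intro!: supported_sum supported_scaleR)
qed

lemma rescale_derivation:
  assumes f: "graded_map d f"
    and invariant: "\<And>x M. gen_ok x \<Longrightarrow> supported (\<lambda>N. h (M + N) = h (add_mset x M)) (f x)"
  shows "rescale h (derivation d f p) = derivation d f (rescale h p)"
proof (rule linear_eqI_monomial[where f = "\<lambda>p. rescale h (derivation d f p)"])
  fix m assume "m \<in> support p"
  then have m: "mon_ok m" by (rule mon_ok_support)
  have "supported (\<lambda>M. h M = h (factors m)) (derivation d f (monomial m))"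
    by (rule supported_derivation_monomial[OF f m]) (use invariant in simp)
  then have "rescale h (derivation d f (monomial m)) =
      h (factors m) *\<^sub>R derivation d f (monomial m)"
    by (rule rescale_const)
  also have "\<dots> = derivation d f (rescale h (monomial m))"
    using m by (simp add: rescale_const[of h "h (factors m)"] supported_monomial
        derivation_linear_simps)
  finally show "rescale h (derivation d f (monomial m)) = derivation d f (rescale h (monomial m))" .
qed (auto intro!: linearI simp: derivation_linear_simps linear_add[OF linear_rescale]
    linear_scale[OF linear_rescale])

section \<open>Gauge theory over a real algebra with commuting derivations\<close>

subsection \<open>Central elements and finite sums\<close>

definition central :: "'v::times \<Rightarrow> bool" where
  "central p \<longleftrightarrow> (\<forall>q. p * q = q * p)"

lemma central_commute: "central p \<Longrightarrow> p * q = q * p"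
  by (simp add: central_def)

lemma central_left_commute: "central (p :: 'v::semigroup_mult) \<Longrightarrow> q * (p * r) = p * (q * r)"
  unfolding central_def by (metis mult.assoc)

lemma central_uminus: "central (p :: 'v::ring) \<Longrightarrow> central (- p)"
  and central_add: "central p \<Longrightarrow> central q \<Longrightarrow> central (p + q)"
  and central_diff: "central p \<Longrightarrow> central q \<Longrightarrow> central (p - q)"
  by (simp_all add: central_def algebra_simps)

lemma central_mult: "central (p :: 'v::semigroup_mult) \<Longrightarrow> central q \<Longrightarrow> central (p * q)"
  unfolding central_def by (metis mult.assoc)

lemma central_scaleR: "central (p :: 'v::real_algebra) \<Longrightarrow> central (r *\<^sub>R p)"
  by (simp add: central_def)

lemma central_sum: "(\<And>x. x \<in> S \<Longrightarrow> central (f x :: 'v::ring)) \<Longrightarrow> central (sum f S)"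
  by (simp add: central_def sum_distrib_left sum_distrib_right)

lemmas central_intros =
  central_uminus central_add central_diff central_mult central_scaleR central_sum

lemma eq_minus_self_iff: "x = - x \<longleftrightarrow> x = 0" for x :: "'v::real_vector"
  by (simp add: eq_neg_iff_add_eq_0 flip: scaleR_2)

lemma sum_antisym_eq_0:
  fixes f :: "'i \<Rightarrow> 'i \<Rightarrow> 'v::real_vector"
  assumes "\<And>x y. f x y = - f y x"
  shows "(\<Sum>x\<in>S. \<Sum>y\<in>S. f x y) = 0"
proof -
  have "(\<Sum>x\<in>S. \<Sum>y\<in>S. f x y) = (\<Sum>x\<in>S. \<Sum>y\<in>S. - f y x)"
    by (intro sum.cong refl) (rule assms)
  also have "\<dots> = - (\<Sum>x\<in>S. \<Sum>y\<in>S. f x y)"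
    by (subst sum.swap) (simp add: sum_negf)
  finally show ?thesis by (simp only: eq_minus_self_iff)
qed

lemma sum_rotate:
  "(\<Sum>x\<in>S. \<Sum>y\<in>T. \<Sum>z\<in>U. f x y z) = (\<Sum>z\<in>U. \<Sum>x\<in>S. \<Sum>y\<in>T. f x y z)"
proof -
  have "(\<Sum>x\<in>S. \<Sum>y\<in>T. \<Sum>z\<in>U. f x y z) = (\<Sum>x\<in>S. \<Sum>z\<in>U. \<Sum>y\<in>T. f x y z)"
    by (intro sum.cong refl sum.swap)
  then show ?thesis by (simp only: sum.swap[of _ U S])
qed

lemma sum_scaleR_inverse:
  fixes X :: "'i::finite \<Rightarrow> 'v::real_vector"
  assumes "\<And>b c. (\<Sum>a\<in>UNIV. p b a * q a c) = (if b = c then 1 else 0)"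
  shows "(\<Sum>a\<in>UNIV. p b a *\<^sub>R (\<Sum>c\<in>UNIV. q a c *\<^sub>R X c)) = X b"
proof -
  have "(\<Sum>a\<in>UNIV. p b a *\<^sub>R (\<Sum>c\<in>UNIV. q a c *\<^sub>R X c)) =
      (\<Sum>c\<in>UNIV. (\<Sum>a\<in>UNIV. p b a * q a c) *\<^sub>R X c)"
    by (simp add: scaleR_sum_right scaleR_sum_left) (rule sum.swap)
  also have "\<dots> = (\<Sum>c\<in>UNIV. if b = c then X c else 0)"
    by (intro sum.cong refl) (simp add: assms)
  finally show ?thesis by simp
qed

subsection \<open>Lie algebras with an invariant metric\<close>

locale metric_lie_algebra =
  fixes C :: "'g::finite \<Rightarrow> 'g \<Rightarrow> 'g \<Rightarrow> real" and k :: "'g \<Rightarrow> 'g \<Rightarrow> real"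
  assumes C_antisym: "C a b c = - C a c b"
    and C_jacobi: "(\<Sum>e\<in>UNIV. C a e d * C e b c) + (\<Sum>e\<in>UNIV. C a e b * C e c d)
      + (\<Sum>e\<in>UNIV. C a e c * C e d b) = 0"
    and k_sym: "k a b = k b a"
    and k_nondegenerate: "(\<And>b. (\<Sum>a\<in>UNIV. k b a * x a) = 0) \<Longrightarrow> x = (\<lambda>_. 0)"
    and Clow_cyclic: "Clow k C c a b = Clow k C a b c"
begin

lemma
  shows kinv_k: "(\<Sum>e\<in>UNIV. kinv k c e * k e d) = (if c = d then 1 else 0)"
    and k_kinv: "(\<Sum>e\<in>UNIV. k c e * kinv k e d) = (if c = d then 1 else 0)"
proof -
  let ?K = "(\<chi> i j. k i j) :: real ^ 'g ^ 'g"
  have "x = 0" if "?K *v x = 0" for x :: "real ^ 'g"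
  proof -
    have "(\<Sum>a\<in>UNIV. k b a * x $ a) = 0" for b
      using that by (simp add: vec_eq_iff matrix_vector_mult_def)
    then have "(\<lambda>i. x $ i) = (\<lambda>_. 0)" by (rule k_nondegenerate)
    then show ?thesis by (simp add: vec_eq_iff fun_eq_iff)
  qed
  then have "invertible ?K"
    using matrix_left_invertible_ker invertible_left_inverse by blast
  then have "matrix_inv ?K ** ?K = mat 1" "?K ** matrix_inv ?K = mat 1"
    unfolding matrix_inv_def invertible_def by (rule someI2_ex, blast)+
  then have "(matrix_inv ?K ** ?K) $ c $ d = mat 1 $ c $ d"
    "(?K ** matrix_inv ?K) $ c $ d = mat 1 $ c $ d" by simp_all
  then show "(\<Sum>e\<in>UNIV. kinv k c e * k e d) = (if c = d then 1 else 0)"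
    "(\<Sum>e\<in>UNIV. k c e * kinv k e d) = (if c = d then 1 else 0)"
    by (simp_all add: matrix_matrix_mult_def mat_def kinv_def)
qed

definition lower :: "('g \<Rightarrow> 'v::real_vector) \<Rightarrow> 'g \<Rightarrow> 'v" where
  "lower X a = (\<Sum>b\<in>UNIV. k a b *\<^sub>R X b)"

definition raise :: "('g \<Rightarrow> 'v::real_vector) \<Rightarrow> 'g \<Rightarrow> 'v" where
  "raise X a = (\<Sum>b\<in>UNIV. kinv k a b *\<^sub>R X b)"

lemma raise_lower [simp]: "raise (lower X) = X"
  by (rule ext) (simp only: raise_def lower_def sum_scaleR_inverse[OF kinv_k])

lemma lower_raise [simp]: "lower (raise X) = X"
  by (rule ext) (simp only: raise_def lower_def sum_scaleR_inverse[OF k_kinv])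

lemma lower_add: "lower (\<lambda>a. X a + Y a) a = lower X a + lower Y a"
  and lower_diff: "lower (\<lambda>a. X a - Y a) a = lower X a - lower Y a"
  and lower_uminus: "lower (\<lambda>a. - X a) a = - lower X a"
  and lower_scaleR: "lower (\<lambda>a. r *\<^sub>R X a) a = r *\<^sub>R lower X a"
  and raise_uminus: "raise (\<lambda>a. - X a) a = - raise X a"
  and raise_scaleR: "raise (\<lambda>a. r *\<^sub>R X a) a = r *\<^sub>R raise X a"
  by (simp_all add: lower_def raise_def scaleR_add_right scaleR_diff_right sum.distrib
      sum_subtractf sum_negf scaleR_sum_right mult.commute)

lemma linear_lower: "linear T \<Longrightarrow> T (lower X a) = lower (\<lambda>b. T (X b)) a"
  and linear_raise: "linear T \<Longrightarrow> T (raise X a) = raise (\<lambda>b. T (X b)) a"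
  by (simp_all add: lower_def raise_def linear_sum linear_scale)

lemma lower_mult_left: "lower (\<lambda>a. p * X a) a = p * lower X a" for p :: "'v::real_algebra"
  by (simp add: lower_def sum_distrib_left)

lemma lower_sum: "lower (\<lambda>a. \<Sum>i\<in>I. X i a) a = (\<Sum>i\<in>I. lower (X i) a)"
  unfolding lower_def scaleR_sum_right by (rule sum.swap)

lemma central_lower: "(\<And>a. central (X a :: 'v::real_algebra)) \<Longrightarrow> central (lower X a)"
  unfolding lower_def by (intro central_intros)

definition bracket :: "('g \<Rightarrow> 'v::real_algebra) \<Rightarrow> ('g \<Rightarrow> 'v) \<Rightarrow> 'g \<Rightarrow> 'v" where
  "bracket X Y a = (\<Sum>b\<in>UNIV. \<Sum>c\<in>UNIV. C a b c *\<^sub>R (X b * Y c))"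

lemma bracket_diff_left: "bracket (\<lambda>a. X a - Y a) Z a = bracket X Z a - bracket Y Z a"
  and bracket_add_right: "bracket Z (\<lambda>a. X a + Y a) a = bracket Z X a + bracket Z Y a"
  and bracket_diff_right: "bracket Z (\<lambda>a. X a - Y a) a = bracket Z X a - bracket Z Y a"
  and bracket_uminus_right: "bracket Z (\<lambda>a. - X a) a = - bracket Z X a"
  and bracket_scaleR_right: "bracket Z (\<lambda>a. r *\<^sub>R X a) a = r *\<^sub>R bracket Z X a"
  by (simp_all add: bracket_def distrib_left left_diff_distrib right_diff_distrib
      scaleR_add_right scaleR_diff_right sum.distrib sum_subtractf sum_negf scaleR_sum_right
      mult.commute)

lemma bracket_sum_right: "bracket Z (\<lambda>a. \<Sum>i\<in>I. X i a) a = (\<Sum>i\<in>I. bracket Z (X i) a)"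
  by (induction I rule: infinite_finite_induct)
    (simp_all add: bracket_add_right, simp_all add: bracket_def)

lemma central_bracket:
  "(\<And>b. central (X b)) \<Longrightarrow> (\<And>c. central (Y c)) \<Longrightarrow> central (bracket X Y a)"
  unfolding bracket_def by (intro central_intros)

lemma bracket_antisym:
  assumes "\<And>b. central (X b)"
  shows "bracket X Y a = - bracket Y X a"
proof -
  have "C a b c *\<^sub>R (X b * Y c) = - (C a c b *\<^sub>R (Y c * X b))" for b c
    using C_antisym[of a b c] central_commute[OF assms, of b "Y c"] by simp
  then have "bracket X Y a = (\<Sum>b\<in>UNIV. \<Sum>c\<in>UNIV. - (C a c b *\<^sub>R (Y c * X b)))"
    by (simp add: bracket_def)
  also have "\<dots> = - bracket Y X a"
    unfolding bracket_def by (subst sum.swap) (simp add: sum_negf)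
  finally show ?thesis .
qed

lemma bracket_self: "(\<And>b. central (X b)) \<Longrightarrow> bracket X X a = 0"
  using bracket_antisym[of X X a] by (simp only: eq_minus_self_iff)

lemma bracket_bracket_left:
  "bracket (bracket X Y) Z a =
    (\<Sum>b\<in>UNIV. \<Sum>c\<in>UNIV. \<Sum>d\<in>UNIV. (\<Sum>e\<in>UNIV. C a e d * C e b c) *\<^sub>R (X b * (Y c * Z d)))"
proof -
  let ?t = "\<lambda>b c d e. (C a e d * C e b c) *\<^sub>R (X b * (Y c * Z d))"
  have "bracket (bracket X Y) Z a = (\<Sum>e\<in>UNIV. \<Sum>d\<in>UNIV. \<Sum>b\<in>UNIV. \<Sum>c\<in>UNIV. ?t b c d e)"
    by (simp add: bracket_def sum_distrib_right scaleR_sum_right mult.assoc)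
  also have "\<dots> = (\<Sum>b\<in>UNIV. \<Sum>e\<in>UNIV. \<Sum>d\<in>UNIV. \<Sum>c\<in>UNIV. ?t b c d e)"
    by (rule sum_rotate)
  also have "\<dots> = (\<Sum>b\<in>UNIV. \<Sum>c\<in>UNIV. \<Sum>e\<in>UNIV. \<Sum>d\<in>UNIV. ?t b c d e)"
    by (intro sum.cong refl sum_rotate)
  also have "\<dots> = (\<Sum>b\<in>UNIV. \<Sum>c\<in>UNIV. \<Sum>d\<in>UNIV. \<Sum>e\<in>UNIV. ?t b c d e)"
    by (intro sum.cong refl sum.swap)
  finally show ?thesis by (simp add: scaleR_sum_left)
qed

lemma bracket_bracket_right:
  "bracket X (bracket Y Z) a =
    (\<Sum>b\<in>UNIV. \<Sum>c\<in>UNIV. \<Sum>d\<in>UNIV. (\<Sum>e\<in>UNIV. C a b e * C e c d) *\<^sub>R (X b * (Y c * Z d)))"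
proof -
  let ?t = "\<lambda>b c d e. (C a b e * C e c d) *\<^sub>R (X b * (Y c * Z d))"
  have "bracket X (bracket Y Z) a = (\<Sum>b\<in>UNIV. \<Sum>e\<in>UNIV. \<Sum>c\<in>UNIV. \<Sum>d\<in>UNIV. ?t b c d e)"
    by (simp add: bracket_def sum_distrib_left scaleR_sum_right)
  also have "\<dots> = (\<Sum>b\<in>UNIV. \<Sum>c\<in>UNIV. \<Sum>d\<in>UNIV. \<Sum>e\<in>UNIV. ?t b c d e)"
    by (intro sum.cong refl sum_rotate[symmetric])
  finally show ?thesis by (simp add: scaleR_sum_left)
qed

lemma bracket_jacobi:
  assumes X: "\<And>b. central (X b)"
  shows "bracket X (bracket Y Z) a = bracket (bracket X Y) Z a + bracket Y (bracket X Z) a"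
proof -
  have C_derivation: "(\<Sum>e\<in>UNIV. C a e d * C e b c) + (\<Sum>e\<in>UNIV. C a c e * C e b d) =
      (\<Sum>e\<in>UNIV. C a b e * C e c d)" for b c d
  proof -
    have "C a e b * C e c d = - (C a b e * C e c d)" "C a e c * C e d b = C a c e * C e b d" for e
      using C_antisym[of a e b] C_antisym[of a e c] C_antisym[of e d b] by simp_all
    then show ?thesis using C_jacobi[of a d b c] by (simp add: sum_negf)
  qed
  have nested: "bracket Y (bracket X Z) a =
      (\<Sum>b\<in>UNIV. \<Sum>c\<in>UNIV. \<Sum>d\<in>UNIV. (\<Sum>e\<in>UNIV. C a c e * C e b d) *\<^sub>R (X b * (Y c * Z d)))"
    unfolding bracket_bracket_right central_left_commute[OF X, of "Y _"] by (rule sum.swap)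
  have "bracket X (bracket Y Z) a = (\<Sum>b\<in>UNIV. \<Sum>c\<in>UNIV. \<Sum>d\<in>UNIV.
      ((\<Sum>e\<in>UNIV. C a e d * C e b c) + (\<Sum>e\<in>UNIV. C a c e * C e b d)) *\<^sub>R (X b * (Y c * Z d)))"
    by (simp only: bracket_bracket_right C_derivation)
  then show ?thesis
    by (simp only: bracket_bracket_left nested scaleR_add_left sum.distrib)
qed

lemma sum_Clow_mult:
  "(\<Sum>b\<in>UNIV. \<Sum>c\<in>UNIV. Clow k C a b c *\<^sub>R (X b * Y c)) = lower (bracket X Y) a"
proof -
  have "(\<Sum>b\<in>UNIV. \<Sum>c\<in>UNIV. Clow k C a b c *\<^sub>R (X b * Y c)) =
      (\<Sum>b\<in>UNIV. \<Sum>c\<in>UNIV. \<Sum>d\<in>UNIV. (k a d * C d b c) *\<^sub>R (X b * Y c))"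
    by (simp add: Clow_def scaleR_sum_left)
  also have "\<dots> = (\<Sum>d\<in>UNIV. \<Sum>b\<in>UNIV. \<Sum>c\<in>UNIV. (k a d * C d b c) *\<^sub>R (X b * Y c))"
    by (rule sum_rotate)
  finally show ?thesis by (simp add: bracket_def lower_def scaleR_sum_right)
qed

definition triple_product :: "('g \<Rightarrow> 'v::real_algebra) \<Rightarrow> ('g \<Rightarrow> 'v) \<Rightarrow> ('g \<Rightarrow> 'v) \<Rightarrow> 'v" where
  "triple_product X Y Z = (\<Sum>a\<in>UNIV. \<Sum>b\<in>UNIV. \<Sum>c\<in>UNIV. Clow k C a b c *\<^sub>R (X a * Y b * Z c))"

lemma triple_product_eq_sum_bracket: "triple_product X Y Z = (\<Sum>a\<in>UNIV. X a * lower (bracket Y Z) a)"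
  by (simp add: triple_product_def mult.assoc sum_distrib_left flip: sum_Clow_mult)

lemma triple_product_swap: "(\<And>b. central (Y b)) \<Longrightarrow> triple_product X Y Z = - triple_product X Z Y"
proof -
  assume "\<And>b. central (Y b)"
  then have "bracket Y Z = (\<lambda>a. - bracket Z Y a)" by (intro ext bracket_antisym)
  then show ?thesis by (simp add: triple_product_eq_sum_bracket lower_uminus sum_negf)
qed

lemma triple_product_cyclic:
  assumes "\<And>c. central (Z c)"
  shows "triple_product X Y Z = triple_product Z X Y"
proof -
  have "Clow k C a b c *\<^sub>R (X a * Y b * Z c) = Clow k C c a b *\<^sub>R (Z c * X a * Y b)" for a b c
    using Clow_cyclic[of c a b] central_commute[OF assms, of c "X a * Y b"]
    by (simp add: mult.assoc)
  then show ?thesis by (simp add: triple_product_def) (rule sum_rotate)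
qed

end

subsection \<open>Gauge fields\<close>

locale commuting_derivations =
  fixes deriv :: "'n \<Rightarrow> 'v::real_algebra \<Rightarrow> 'v" (\<open>\<partial>\<close>)
  assumes linear_deriv: "linear (\<partial> mu)"
    and deriv_mult: "\<partial> mu (p * q) = \<partial> mu p * q + p * \<partial> mu q"
    and deriv_commute: "\<partial> mu (\<partial> nu p) = \<partial> nu (\<partial> mu p)"
begin

lemmas deriv_linear_simps =
  linear_0[OF linear_deriv] linear_add[OF linear_deriv] linear_neg[OF linear_deriv]
  linear_diff[OF linear_deriv] linear_scale[OF linear_deriv] linear_sum[OF linear_deriv]

lemma central_deriv:
  assumes "central p"
  shows "central (\<partial> mu p)"
  unfolding central_def
proof
  fix q
  have "\<partial> mu p * q + p * \<partial> mu q = \<partial> mu q * p + q * \<partial> mu p"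
    using central_commute[OF assms, of q] by (simp flip: deriv_mult)
  then show "\<partial> mu p * q = q * \<partial> mu p"
    using central_commute[OF assms, of "\<partial> mu q"] by simp
qed

end

locale gauge_fields =
  metric_lie_algebra C k + commuting_derivations deriv
  for C :: "'g::finite \<Rightarrow> 'g \<Rightarrow> 'g \<Rightarrow> real" and k :: "'g \<Rightarrow> 'g \<Rightarrow> real"
    and deriv :: "'n \<Rightarrow> 'v::real_algebra \<Rightarrow> 'v" (\<open>\<partial>\<close>) +
  fixes A :: "'n \<Rightarrow> 'g \<Rightarrow> 'v"
  assumes central_A: "central (A mu a)"
begin

definition F :: "'n \<Rightarrow> 'n \<Rightarrow> 'g \<Rightarrow> 'v" where
  "F mu nu a = \<partial> mu (A nu a) - \<partial> nu (A mu a) - bracket (A mu) (A nu) a"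

definition cov_deriv :: "'n \<Rightarrow> ('g \<Rightarrow> 'v) \<Rightarrow> 'g \<Rightarrow> 'v" where
  "cov_deriv mu X a = \<partial> mu (X a) - bracket (A mu) X a"

lemma central_F: "central (F mu nu a)"
  unfolding F_def by (intro central_intros central_deriv central_bracket central_A)

lemma F_antisym: "F mu nu a = - F nu mu a"
  using bracket_antisym[of "A mu" "A nu" a, OF central_A] by (simp add: F_def)

lemma F_diag: "F mu mu a = 0"
  using F_antisym[of mu mu a] by (simp only: eq_minus_self_iff)

lemma deriv_bracket:
  "\<partial> mu (bracket X Y a) = bracket (\<lambda>a. \<partial> mu (X a)) Y a + bracket X (\<lambda>a. \<partial> mu (Y a)) a"
  by (simp add: bracket_def deriv_linear_simps deriv_mult scaleR_add_right sum.distrib)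

lemma cov_deriv_add: "cov_deriv mu (\<lambda>a. X a + Y a) a = cov_deriv mu X a + cov_deriv mu Y a"
  and cov_deriv_uminus: "cov_deriv mu (\<lambda>a. - X a) a = - cov_deriv mu X a"
  and cov_deriv_scaleR: "cov_deriv mu (\<lambda>a. r *\<^sub>R X a) a = r *\<^sub>R cov_deriv mu X a"
  and cov_deriv_sum: "cov_deriv mu (\<lambda>a. \<Sum>i\<in>I. Y' i a) a = (\<Sum>i\<in>I. cov_deriv mu (Y' i) a)"
  by (simp_all add: cov_deriv_def bracket_add_right bracket_uminus_right bracket_scaleR_right
      bracket_sum_right deriv_linear_simps scaleR_diff_right sum_subtractf)

lemma cov_deriv_mult:
  assumes "central p"
  shows "cov_deriv mu (\<lambda>a. p * X a) a = \<partial> mu p * X a + p * cov_deriv mu X a"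
proof -
  have "bracket (A mu) (\<lambda>a. p * X a) a = p * bracket (A mu) X a"
    by (simp add: bracket_def sum_distrib_left central_left_commute[OF assms])
  then show ?thesis by (simp add: cov_deriv_def deriv_mult right_diff_distrib)
qed

lemma cov_deriv_lower: "lower (cov_deriv mu X) a = \<partial> mu (lower X a) - lower (bracket (A mu) X) a"
  by (simp add: cov_deriv_def[abs_def] lower_diff linear_lower[OF linear_deriv])

lemma cov_deriv_commutator:
  "cov_deriv mu (cov_deriv nu X) a - cov_deriv nu (cov_deriv mu X) a = - bracket (F mu nu) X a"
proof -
  have twice: "cov_deriv mu (cov_deriv nu X) a = \<partial> mu (\<partial> nu (X a)) - bracket (\<lambda>a. \<partial> mu (A nu a)) X a
      - bracket (A nu) (\<lambda>a. \<partial> mu (X a)) a - bracket (A mu) (\<lambda>a. \<partial> nu (X a)) a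
      + bracket (A mu) (bracket (A nu) X) a" for mu nu
    by (simp add: cov_deriv_def[abs_def] bracket_diff_right deriv_linear_simps deriv_bracket)
  have "bracket (F mu nu) X a = bracket (\<lambda>a. \<partial> mu (A nu a)) X a - bracket (\<lambda>a. \<partial> nu (A mu a)) X a
      - bracket (bracket (A mu) (A nu)) X a"
    by (simp add: F_def[abs_def] bracket_diff_left)
  then show ?thesis
    using bracket_jacobi[of "A mu" "A nu" X a, OF central_A]
    by (simp add: twice deriv_commute[of mu nu])
qed

lemma bianchi:
  "cov_deriv mu (F nu rho) a + cov_deriv nu (F rho mu) a + cov_deriv rho (F mu nu) a = 0"
proof -
  have expand: "cov_deriv mu (F nu rho) a = \<partial> mu (\<partial> nu (A rho a)) - \<partial> mu (\<partial> rho (A nu a))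
      + bracket (A rho) (\<lambda>a. \<partial> mu (A nu a)) a - bracket (A nu) (\<lambda>a. \<partial> mu (A rho a)) a
      - bracket (A mu) (\<lambda>a. \<partial> nu (A rho a)) a + bracket (A mu) (\<lambda>a. \<partial> rho (A nu a)) a
      + bracket (A mu) (bracket (A nu) (A rho)) a" for mu nu rho
    using bracket_antisym[of "A rho" "\<lambda>a. \<partial> mu (A nu a)" a, OF central_A]
    by (simp add: cov_deriv_def F_def[abs_def] bracket_diff_right deriv_linear_simps deriv_bracket)
  have "bracket (A mu) (A rho) = (\<lambda>a. - bracket (A rho) (A mu) a)"
    by (rule ext) (intro bracket_antisym central_A)
  then have "bracket (A nu) (bracket (A mu) (A rho)) a =
      - bracket (A nu) (bracket (A rho) (A mu)) a"
    by (simp add: bracket_uminus_right)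
  moreover have "bracket (bracket (A mu) (A nu)) (A rho) a =
      - bracket (A rho) (bracket (A mu) (A nu)) a"
    by (intro bracket_antisym central_bracket central_A)
  ultimately have "bracket (A mu) (bracket (A nu) (A rho)) a =
      - bracket (A rho) (bracket (A mu) (A nu)) a - bracket (A nu) (bracket (A rho) (A mu)) a"
    using bracket_jacobi[of "A mu" "A nu" "A rho" a, OF central_A] by simp
  then show ?thesis
    by (simp add: expand deriv_commute[of mu nu] deriv_commute[of rho nu] deriv_commute[of rho mu])
qed

end

subsection \<open>The Chapline--Manton field strengths\<close>

locale chapline_manton_fields =
  gauge_fields C k deriv A
  for C :: "'g::finite \<Rightarrow> 'g \<Rightarrow> 'g \<Rightarrow> real" and k :: "'g \<Rightarrow> 'g \<Rightarrow> real"
    and deriv :: "'n::finite \<Rightarrow> 'v::real_algebra \<Rightarrow> 'v" (\<open>\<partial>\<close>) and A :: "'n \<Rightarrow> 'g \<Rightarrow> 'v" +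
  fixes B :: "'n \<Rightarrow> 'n \<Rightarrow> 'v" and \<eta> :: "'n \<Rightarrow> real" and lam :: real
  assumes central_B: "central (B mu nu)" and B_antisym: "B mu nu = - B nu mu"
begin

definition F_up :: "'n \<Rightarrow> 'n \<Rightarrow> 'g \<Rightarrow> 'v" where
  "F_up mu nu a = (\<eta> mu * \<eta> nu) *\<^sub>R F mu nu a"

definition chern_simons :: "'n \<Rightarrow> 'n \<Rightarrow> 'n \<Rightarrow> 'v" where
  "chern_simons mu nu rho = (2 * lam) *\<^sub>R triple_product (A mu) (A nu) (A rho)
     + (2 * lam) *\<^sub>R (\<Sum>a\<in>UNIV. A mu a * lower (F nu rho) a + A nu a * lower (F rho mu) a
         + A rho a * lower (F mu nu) a)"

definition H :: "'n \<Rightarrow> 'n \<Rightarrow> 'n \<Rightarrow> 'v" where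
  "H mu nu rho = \<partial> mu (B nu rho) + \<partial> nu (B rho mu) + \<partial> rho (B mu nu) - chern_simons mu nu rho"

definition H_up :: "'n \<Rightarrow> 'n \<Rightarrow> 'n \<Rightarrow> 'v" where
  "H_up mu nu rho = (\<eta> mu * \<eta> nu * \<eta> rho) *\<^sub>R H mu nu rho"

definition eom :: "'n \<Rightarrow> 'g \<Rightarrow> 'v" where
  "eom mu a = (\<Sum>nu\<in>UNIV. cov_deriv nu (F_up nu mu) a)
     + (2 * lam) *\<^sub>R (\<Sum>nu\<in>UNIV. \<Sum>rho\<in>UNIV. H_up mu nu rho * F nu rho a)"

lemma central_H_up: "central (H_up mu nu rho)"
  unfolding H_up_def H_def chern_simons_def triple_product_def
  by (intro central_intros central_deriv central_lower central_A central_B central_F)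

lemma F_up_antisym: "F_up mu nu a = - F_up nu mu a"
  using F_antisym[of mu nu a] by (simp add: F_up_def mult.commute)

lemma lower_F_antisym: "lower (F mu nu) a = - lower (F nu mu) a"
  by (simp add: lower_def F_antisym[of mu nu] sum_negf)

lemma chern_simons_swap: "chern_simons mu nu rho = - chern_simons mu rho nu"
proof -
  have "A mu a * lower (F rho nu) a + A rho a * lower (F nu mu) a + A nu a * lower (F mu rho) a =
      - (A mu a * lower (F nu rho) a + A nu a * lower (F rho mu) a
        + A rho a * lower (F mu nu) a)" for a
    using lower_F_antisym[of rho nu a] lower_F_antisym[of nu mu a] lower_F_antisym[of mu rho a]
    by simp
  then show ?thesis
    using triple_product_swap[of "A nu" "A mu" "A rho", OF central_A]
    by (simp add: chern_simons_def sum_negf del: minus_add_distrib)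
qed

lemma chern_simons_cyclic: "chern_simons mu nu rho = chern_simons rho mu nu"
  using triple_product_cyclic[of "A rho" "A mu" "A nu", OF central_A]
  by (simp add: chern_simons_def add_ac)

lemma H_swap: "H mu nu rho = - H mu rho nu"
  using chern_simons_swap[of mu nu rho] B_antisym[of nu rho] B_antisym[of rho mu]
    B_antisym[of mu nu]
  by (simp add: H_def deriv_linear_simps)

lemma H_cyclic: "H mu nu rho = H rho mu nu"
  using chern_simons_cyclic[of mu nu rho] by (simp add: H_def add_ac)

lemma H_up_cyclic: "H_up mu nu rho = H_up rho mu nu"
  using H_cyclic[of mu nu rho] by (simp add: H_up_def mult_ac)

lemma H_up_swap: "H_up mu nu rho = - H_up mu rho nu"
  using H_swap[of mu nu rho] by (simp add: H_up_def mult_ac)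

lemma H_up_swap_left: "H_up mu nu rho = - H_up nu mu rho"
  using H_up_cyclic[of mu nu rho] H_up_swap[of rho mu nu] H_up_cyclic[of nu mu rho] by simp

lemma H_up_diag: "H_up mu nu nu = 0" "H_up mu mu nu = 0" "H_up mu nu mu = 0"
proof -
  show "H_up mu nu nu = 0" for mu nu
    using H_up_swap[of mu nu nu] by (simp only: eq_minus_self_iff)
  then show "H_up mu mu nu = 0" "H_up mu nu mu = 0"
    using H_up_cyclic[of mu mu nu] H_up_cyclic[of mu nu mu] by simp_all
qed

subsection \<open>Noether identities\<close>

lemma sum_deriv_deriv_H_up: "(\<Sum>mu\<in>UNIV. \<Sum>nu\<in>UNIV. \<partial> mu (\<partial> nu (H_up nu mu rho))) = 0"
proof (rule sum_antisym_eq_0)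
  show "\<partial> mu (\<partial> nu (H_up nu mu rho)) = - \<partial> nu (\<partial> mu (H_up mu nu rho))" for mu nu
    using H_up_swap_left[of nu mu rho] by (simp add: deriv_linear_simps deriv_commute[of mu nu])
qed

lemma sum_cov_deriv_cov_deriv_F:
  "(\<Sum>mu\<in>UNIV. \<Sum>nu\<in>UNIV. cov_deriv mu (cov_deriv nu (F_up nu mu)) a) = 0"
proof (rule sum_antisym_eq_0)
  fix mu nu
  have "F_up mu nu = (\<lambda>a. - F_up nu mu a)"
    by (rule ext) (rule F_up_antisym)
  then have "cov_deriv nu (cov_deriv mu (F_up mu nu)) a =
      - cov_deriv nu (cov_deriv mu (F_up nu mu)) a"
    by (simp add: cov_deriv_uminus[abs_def] cov_deriv_uminus)
  moreover have "bracket (F mu nu) (F_up nu mu) a = 0"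
    using F_antisym[of nu mu] bracket_self[of "F mu nu" a, OF central_F]
    by (simp add: F_up_def[abs_def] bracket_scaleR_right bracket_uminus_right)
  ultimately show "cov_deriv mu (cov_deriv nu (F_up nu mu)) a =
      - cov_deriv nu (cov_deriv mu (F_up mu nu)) a"
    using cov_deriv_commutator[of mu nu "F_up nu mu" a] by simp
qed

lemma sum_H_up_cov_deriv_F:
  "(\<Sum>mu\<in>UNIV. \<Sum>nu\<in>UNIV. \<Sum>rho\<in>UNIV. H_up mu nu rho * cov_deriv mu (F nu rho) a) = 0"
proof -
  let ?S = "\<lambda>f. \<Sum>mu\<in>UNIV. \<Sum>nu\<in>UNIV. \<Sum>rho\<in>UNIV. H_up mu nu rho * f mu nu rho"
  let ?f = "\<lambda>mu nu rho. cov_deriv mu (F nu rho) a"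
  have rotate: "?S f = ?S (\<lambda>mu nu rho. f nu rho mu)" for f
    by (subst sum_rotate) (intro sum.cong refl, subst H_up_cyclic, rule refl)
  have "3 *\<^sub>R ?S ?f = ?S ?f + ?S ?f + ?S ?f"
    using scaleR_left_distrib[of 2 1 "?S ?f"] by (simp add: scaleR_2)
  also have "\<dots> = ?S ?f + ?S (\<lambda>mu nu rho. ?f nu rho mu) + ?S (\<lambda>mu nu rho. ?f rho mu nu)"
    using rotate[of ?f] rotate[of "\<lambda>mu nu rho. ?f nu rho mu"] by simp
  also have "\<dots> = ?S (\<lambda>mu nu rho. ?f mu nu rho + ?f nu rho mu + ?f rho mu nu)"
    by (simp only: distrib_left sum.distrib)
  finally show ?thesis by (simp add: bianchi)
qed

theorem noether_identity:
  "(\<Sum>mu\<in>UNIV. cov_deriv mu (eom mu) a) =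
    (2 * lam) *\<^sub>R (\<Sum>mu\<in>UNIV. \<Sum>nu\<in>UNIV. \<Sum>rho\<in>UNIV. \<partial> mu (H_up mu nu rho) * F nu rho a)"
proof -
  have "cov_deriv mu (eom mu) a = (\<Sum>nu\<in>UNIV. cov_deriv mu (cov_deriv nu (F_up nu mu)) a)
      + (2 * lam) *\<^sub>R (\<Sum>nu\<in>UNIV. \<Sum>rho\<in>UNIV. \<partial> mu (H_up mu nu rho) * F nu rho a)
      + (2 * lam) *\<^sub>R (\<Sum>nu\<in>UNIV. \<Sum>rho\<in>UNIV. H_up mu nu rho * cov_deriv mu (F nu rho) a)" for mu
    by (simp add: eom_def[abs_def] cov_deriv_add cov_deriv_sum cov_deriv_scaleR
        cov_deriv_mult[OF central_H_up] sum.distrib scaleR_add_right)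
  then show ?thesis
    using sum_cov_deriv_cov_deriv_F[of a] sum_H_up_cov_deriv_F[of a]
    by (simp add: sum.distrib flip: scaleR_sum_right)
qed

end

section \<open>Total derivatives\<close>

definition incr :: "('n \<Rightarrow> nat) \<Rightarrow> 'n \<Rightarrow> 'n \<Rightarrow> nat" where
  "incr J mu = J(mu := Suc (J mu))"

definition decr :: "('n \<Rightarrow> nat) \<Rightarrow> 'n \<Rightarrow> 'n \<Rightarrow> nat" where
  "decr J mu = J(mu := J mu - 1)"

lemma incr_apply: "incr J mu nu = (if nu = mu then Suc (J nu) else J nu)"
  and decr_apply: "decr J mu nu = (if nu = mu then J nu - 1 else J nu)"
  by (simp_all add: incr_def decr_def)

lemma incr_commute: "incr (incr J mu) nu = incr (incr J nu) mu"
  by (auto simp: incr_apply)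

lemma decr_incr [simp]: "decr (incr J mu) mu = J"
  by (simp add: incr_def decr_def)

lemma incr_decr [simp]: "J mu \<noteq> 0 \<Longrightarrow> incr (decr J mu) mu = J"
  by (simp add: incr_def decr_def)

lemma multi_index_induct [case_names undiff incr]:
  fixes J :: "'n::finite \<Rightarrow> nat"
  assumes "P undiff" "\<And>J mu. P J \<Longrightarrow> P (incr J mu)"
  shows "P J"
proof (induction "\<Sum>mu\<in>UNIV. J mu" arbitrary: J rule: less_induct)
  case less
  show ?case
  proof (cases "J = undiff")
    case False
    then obtain mu where mu: "J mu \<noteq> 0" by (auto simp: undiff_def)
    then have "(\<Sum>nu\<in>UNIV. decr J mu nu) < (\<Sum>nu\<in>UNIV. J nu)"
      by (intro sum_strict_mono_ex1) (auto simp: decr_apply intro!: bexI[of _ mu])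
    then have "P (decr J mu)" by (rule less)
    then show ?thesis using assms(2)[of "decr J mu" mu] mu by simp
  qed (use assms(1) in simp)
qed

lemma gen_ok_Jet_cong: "gen_ok (Jet f J) = gen_ok (Jet f J')"
  by (cases f) auto

fun total_deriv_gen :: "'n \<Rightarrow> ('n::{finite,linorder}, 'g::finite) gen \<Rightarrow> ('n, 'g) superalg" where
  "total_deriv_gen mu (Jet f J) = var (Jet f (incr J mu))"
| "total_deriv_gen mu (Dx nu) = 0"

definition total_deriv ::
    "'n \<Rightarrow> ('n::{finite,linorder}, 'g::finite) superalg \<Rightarrow> ('n, 'g) superalg" (\<open>\<partial>\<close>) where
  "\<partial> mu = derivation 0 (total_deriv_gen mu)"

definition multi_deriv ::
    "('n \<Rightarrow> nat) \<Rightarrow> ('n::{finite,linorder}, 'g::finite) superalg \<Rightarrow> ('n, 'g) superalg" where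
  "multi_deriv J p = fold (\<lambda>mu q. (\<partial> mu ^^ J mu) q) (sorted_list_of_set UNIV) p"

lemma parity_empty [simp]: "parity b {#} \<longleftrightarrow> \<not> b"
  and parity_add_mset [simp]: "parity b (add_mset x M) \<longleftrightarrow> parity (gen_odd x \<noteq> b) M"
  by (auto simp: parity_def)

lemma supported_parity_total_deriv_gen: "supported (parity (gen_odd x)) (total_deriv_gen mu x)"
  by (cases x) (auto intro: supported_var)

lemma graded_total_deriv_gen: "graded_map 0 (total_deriv_gen mu)"
  by (simp add: graded_map_def supported_parity_total_deriv_gen)

lemma supported_total_deriv:
  assumes "supported P p"
    and "\<And>f J M. P (add_mset (Jet f J) M) \<Longrightarrow> Q (add_mset (Jet f (incr J mu)) M)"
  shows "supported Q (\<partial> mu p)"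
  unfolding total_deriv_def
proof (rule supported_derivation[OF graded_total_deriv_gen assms(1)])
  show "supported (\<lambda>N. Q (M + N)) (total_deriv_gen mu x)" if "P (add_mset x M)" for x M
    using that assms(2) by (cases x) (auto intro: supported_var)
qed

lemma total_deriv_var: "\<partial> mu (var (Jet f J)) = var (Jet f (incr J mu))"
proof (cases "gen_ok (Jet f J)")
  case True
  then show ?thesis by (simp add: total_deriv_def derivation_var graded_total_deriv_gen)
next
  case False
  then show ?thesis
    using gen_ok_Jet_cong[of f J "incr J mu"]
    by (simp add: total_deriv_def var_not_ok derivation_linear_simps)
qed

interpretation total_deriv: commuting_derivations
  "total_deriv :: 'n::{finite,linorder} \<Rightarrow> ('n, 'g::finite) superalg \<Rightarrow> ('n, 'g) superalg"
proof (rule commuting_derivations.intro)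
  fix mu nu :: 'n and p q :: "('n, 'g) superalg"
  show "linear (\<partial> mu :: ('n, 'g) superalg \<Rightarrow> _)"
    unfolding total_deriv_def by (rule linear_derivation)
  show "\<partial> mu (p * q) = \<partial> mu p * q + p * \<partial> mu q"
    unfolding total_deriv_def by (rule derivation_even_mult[OF graded_total_deriv_gen])
  have "\<partial> mu (total_deriv_gen nu x) = \<partial> nu (total_deriv_gen mu x)" for x :: "('n, 'g) gen"
  proof (cases x)
    case (Jet f J)
    then show ?thesis by (simp add: total_deriv_var incr_commute[of J mu nu])
  qed (simp add: total_deriv_def derivation_linear_simps)
  then show "\<partial> mu (\<partial> nu p) = \<partial> nu (\<partial> mu p)"
    unfolding total_deriv_def by (intro derivation_commute graded_total_deriv_gen)
qed

lemma Rep_total_deriv: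
  fixes p :: "('n::{finite,linorder}, 'g::finite) superalg"
  shows "Rep_superalg (\<partial> mu p) = PD mu (Rep_superalg p)"
proof -
  have "(Rep_superalg \<circ> total_deriv_gen mu) x = pd_gen mu x" if "gen_ok x" for x :: "('n, 'g) gen"
  proof (cases x)
    case (Jet f J)
    then have "gen_ok (Jet f (incr J mu))" using that gen_ok_Jet_cong by blast
    then show ?thesis by (simp add: Jet var.rep_eq incr_def)
  qed (simp add: zero_superalg.rep_eq)
  then show ?thesis
    unfolding total_deriv_def PD_def derivation.rep_eq comp_id by (rule der_cong[OF Rep_superalg])
qed

lemma Rep_multi_deriv: "Rep_superalg (multi_deriv J p) = PDJ J (Rep_superalg p)"
proof -
  have "Rep_superalg ((\<partial> mu ^^ n) p) = (PD mu ^^ n) (Rep_superalg p)"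
    for mu n and p :: "('a, 'b) superalg"
    by (induction n) (auto simp: Rep_total_deriv)
  then have "Rep_superalg (fold (\<lambda>mu q. (\<partial> mu ^^ J mu) q) xs p) =
      fold (\<lambda>mu q. (PD mu ^^ J mu) q) xs (Rep_superalg p)" for xs
    by (induction xs arbitrary: p) auto
  then show ?thesis by (simp add: multi_deriv_def PDJ_def)
qed

lemma multi_deriv_undiff [simp]: "multi_deriv undiff p = p"
proof -
  have "fold (\<lambda>mu q. (\<partial> mu ^^ 0) q) xs p = p" for xs
    by (induction xs) auto
  then show ?thesis by (simp add: multi_deriv_def undiff_def)
qed

lemma multi_deriv_incr:
  fixes p :: "('n::{finite,linorder}, 'g::finite) superalg"
  shows "multi_deriv (incr J mu) p = \<partial> mu (multi_deriv J p)"
proof -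
  let ?derivs = "\<lambda>J xs p. fold (\<lambda>mu q. (\<partial> mu ^^ J mu) q) xs p"
  have funpow: "\<partial> mu ((\<partial> nu ^^ n) p) = (\<partial> nu ^^ n) (\<partial> mu p)"
    for nu n and p :: "('n, 'g) superalg"
    by (induction n) (simp_all add: total_deriv.deriv_commute[of mu nu])
  have commute: "\<partial> mu (?derivs J xs p) = ?derivs J xs (\<partial> mu p)" for xs and p :: "('n, 'g) superalg"
    by (induction xs arbitrary: p) (auto simp: funpow)
  have "distinct xs \<Longrightarrow> ?derivs (incr J mu) xs p =
      (if mu \<in> set xs then \<partial> mu (?derivs J xs p) else ?derivs J xs p)" for xs
    by (induction xs arbitrary: p) (auto simp: commute funpow incr_apply)
  from this[of "sorted_list_of_set UNIV"] show ?thesis by (simp add: multi_deriv_def)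
qed

lemma linear_multi_deriv:
  "linear (multi_deriv J :: ('n::{finite,linorder}, 'g::finite) superalg \<Rightarrow> ('n, 'g) superalg)"
proof (induction J rule: multi_index_induct)
  case (incr J mu)
  then have "linear (\<partial> mu \<circ> multi_deriv J :: ('n, 'g) superalg \<Rightarrow> ('n, 'g) superalg)"
    by (rule linear_compose) (rule total_deriv.linear_deriv)
  then show ?case by (simp add: comp_def multi_deriv_incr[abs_def])
qed (auto intro: linearI)

lemmas multi_deriv_linear_simps =
  linear_0[OF linear_multi_deriv] linear_add[OF linear_multi_deriv]
  linear_neg[OF linear_multi_deriv] linear_diff[OF linear_multi_deriv]
  linear_scale[OF linear_multi_deriv] linear_sum[OF linear_multi_deriv]

lemma multi_deriv_commute_map:
  assumes "\<And>mu p. T (\<partial> mu p) = \<partial> mu (T p)"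
  shows "T (multi_deriv J p) = multi_deriv J (T p)"
  by (induction J rule: multi_index_induct) (simp_all add: multi_deriv_incr assms)

lemma multi_deriv_total_deriv: "multi_deriv J (\<partial> mu p) = \<partial> mu (multi_deriv J p)"
  by (rule multi_deriv_commute_map[symmetric]) (rule total_deriv.deriv_commute)

definition fld_var :: "('n::{finite,linorder}, 'g::finite) fld \<Rightarrow> ('n, 'g) superalg" where
  "fld_var f = var (Jet f undiff)"

lemma multi_deriv_fld_var: "multi_deriv J (fld_var f) = var (Jet f J)"
  by (induction J rule: multi_index_induct)
    (simp_all add: multi_deriv_incr total_deriv_var, simp add: fld_var_def)

lemma Rep_fld_var: "gen_ok (Jet f undiff) \<Longrightarrow> Rep_superalg (fld_var f) = fv f"
  by (simp add: fld_var_def fv_def var.rep_eq)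

subsection \<open>Parity and antighost number\<close>

definition total_agh :: "('n, 'g) gen multiset \<Rightarrow> nat" where
  "total_agh M = (\<Sum>x\<in>#M. gen_agh x)"

lemma total_agh_simps [simp]:
  "total_agh {#} = 0" "total_agh (add_mset x M) = gen_agh x + total_agh M"
  "total_agh (M + N) = total_agh M + total_agh N"
  by (simp_all add: total_agh_def)

lemma parity_union: "parity b M \<Longrightarrow> parity b' N \<Longrightarrow> parity (b \<noteq> b') (M + N)"
  by (auto simp: parity_def)

definition bidegree :: "bool \<Rightarrow> nat \<Rightarrow> ('n, 'g) gen multiset \<Rightarrow> bool" where
  "bidegree b n M \<longleftrightarrow> parity b M \<and> total_agh M = n"

lemma supported_bidegree_parity: "supported (bidegree b n) p \<Longrightarrow> supported (parity b) p"
  by (erule supported_mono) (simp add: bidegree_def)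

lemma supported_bidegree_mult_left:
  "supported (bidegree False 0) p \<Longrightarrow> supported (bidegree b n) q \<Longrightarrow> supported (bidegree b n) (p * q)"
  by (rule supported_mult[of "bidegree False 0" p "bidegree b n" q])
    (auto simp: bidegree_def dest: parity_union)

lemma supported_bidegree_mult_right:
  "supported (bidegree b n) p \<Longrightarrow> supported (bidegree False 0) q \<Longrightarrow> supported (bidegree b n) (p * q)"
  by (rule supported_mult[of "bidegree b n" p "bidegree False 0" q])
    (auto simp: bidegree_def dest: parity_union)

lemma supported_bidegree_fld_var: "supported (bidegree (fld_odd f) (fld_agh f)) (fld_var f)"
  unfolding fld_var_def by (rule supported_var) (simp add: bidegree_def)

lemma supported_bidegree_total_deriv:
  "supported (bidegree b n) p \<Longrightarrow> supported (bidegree b n) (\<partial> mu p)"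
  by (erule supported_total_deriv) (simp add: bidegree_def)

lemma supported_bidegree_multi_deriv:
  "supported (bidegree b n) p \<Longrightarrow> supported (bidegree b n) (multi_deriv J p)"
  by (induction J rule: multi_index_induct)
    (auto simp: multi_deriv_incr intro: supported_bidegree_total_deriv)

context metric_lie_algebra
begin

lemma supported_lower: "(\<And>a. supported P (X a)) \<Longrightarrow> supported P (lower X a)"
  and supported_raise: "(\<And>a. supported P (X a)) \<Longrightarrow> supported P (raise X a)"
  unfolding lower_def raise_def by (intro supported_linear_intros, assumption)+

end

lemmas bidegree_intros = supported_linear_intros supported_bidegree_mult_left
  supported_bidegree_total_deriv supported_bidegree_multi_deriv

section \<open>The Koszul--Tate differential\<close>

locale chapline_manton = metric_lie_algebra C k
  for C :: "'g::finite \<Rightarrow> 'g \<Rightarrow> 'g \<Rightarrow> real" and k :: "'g \<Rightarrow> 'g \<Rightarrow> real" +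
  fixes t0 :: "'n::{finite,linorder}" and lam :: real
begin

definition A :: "'n \<Rightarrow> 'g \<Rightarrow> ('n, 'g) superalg" where
  "A mu a = fld_var (FA a mu)"

definition B :: "'n \<Rightarrow> 'n \<Rightarrow> ('n, 'g) superalg" where
  "B mu nu = (if mu < nu then fld_var (FB mu nu) else if nu < mu then - fld_var (FB nu mu) else 0)"

definition A_star :: "'n \<Rightarrow> 'g \<Rightarrow> ('n, 'g) superalg" where
  "A_star mu a = fld_var (FAs a mu)"

definition B_star :: "'n \<Rightarrow> 'n \<Rightarrow> ('n, 'g) superalg" where
  "B_star mu nu =
      (if mu < nu then fld_var (FBs mu nu) else if nu < mu then - fld_var (FBs nu mu) else 0)"

lemma B_star_antisym: "B_star mu nu = - B_star nu mu"
  by (auto simp: B_star_def)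

sublocale chapline_manton_fields C k total_deriv A B "msig t0" lam
proof
  show "central (A mu a)" for mu a
    by (simp add: central_def A_def fld_var_def var_even_central)
  show "central (B mu nu)" for mu nu
    by (simp add: central_def B_def fld_var_def var_even_central)
  show "B mu nu = - B nu mu" for mu nu
    by (auto simp: B_def)
qed

fun delta_fld :: "('n, 'g) fld \<Rightarrow> ('n, 'g) superalg" where
  "delta_fld (FBs mu nu) = (\<Sum>rho\<in>UNIV. \<partial> rho (H_up rho mu nu))"
| "delta_fld (Fetas mu) = - (\<Sum>nu\<in>UNIV. \<partial> nu (B_star nu mu))"
| "delta_fld Frhos = - (\<Sum>mu\<in>UNIV. \<partial> mu (fld_var (Fetas mu)))"
| "delta_fld (FAs a mu) = lower (eom mu) a"
| "delta_fld (FCs a) = (2 * lam) *\<^sub>R (\<Sum>mu\<in>UNIV. \<Sum>nu\<in>UNIV. B_star mu nu * lower (F mu nu) a)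
     - (\<Sum>mu\<in>UNIV. lower (cov_deriv mu (raise (A_star mu))) a)"
| "delta_fld _ = 0"

fun delta_var :: "('n, 'g) gen \<Rightarrow> ('n, 'g) superalg" where
  "delta_var (Jet f J) = multi_deriv J (delta_fld f)"
| "delta_var (Dx nu) = 0"

definition delta :: "('n, 'g) superalg \<Rightarrow> ('n, 'g) superalg" (\<open>\<delta>\<close>) where
  "\<delta> = derivation 1 delta_var"

lemma linear_delta: "linear \<delta>"
  unfolding delta_def by (rule linear_derivation)

lemmas delta_linear_simps =
  linear_0[OF linear_delta] linear_add[OF linear_delta] linear_neg[OF linear_delta]
  linear_diff[OF linear_delta] linear_scale[OF linear_delta] linear_sum[OF linear_delta]

subsection \<open>Agreement with the polynomial model\<close>

lemma Rep_A: "Rep_superalg (A mu a) = Afd a mu"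
  by (simp add: A_def Afd_def Rep_fld_var)

lemma Rep_B: "Rep_superalg (B mu nu) = Bfd mu nu"
  by (simp add: B_def Bfd_def Rep_fld_var Rep_superalg_simps)

lemma Rep_B_star: "Rep_superalg (B_star mu nu) = Bsfd mu nu"
  by (simp add: B_star_def Bsfd_def Rep_fld_var Rep_superalg_simps)

lemma Rep_F: "Rep_superalg (F mu nu a) = Ffd C a mu nu"
  by (simp add: F_def Ffd_def bracket_def Rep_A Rep_superalg_simps Rep_total_deriv)

lemma Rep_lower_F: "Rep_superalg (lower (F mu nu) a) = Flow k C a mu nu"
  by (simp add: lower_def Flow_def Rep_F Rep_superalg_simps)

lemma Rep_H: "Rep_superalg (H mu nu rho) = Hfd lam k C mu nu rho"
  by (simp add: H_def chern_simons_def triple_product_def Hfd_def Rep_A Rep_B Rep_lower_F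
      Rep_superalg_simps Rep_total_deriv)

lemma Rep_H_up: "Rep_superalg (H_up mu nu rho) = Hup t0 lam k C mu nu rho"
  by (simp add: H_up_def Hup_def Rep_H Rep_superalg_simps)

lemma Rep_F_up: "Rep_superalg (F_up mu nu a) = Fup t0 C a mu nu"
  by (simp add: F_up_def Fup_def Rep_F Rep_superalg_simps)

lemma Rep_lower_F_up: "Rep_superalg (lower (F_up mu nu) a) = Flowup t0 k C a mu nu"
  by (simp add: F_up_def[abs_def] lower_scaleR Flowup_def Rep_lower_F Rep_superalg_simps)

lemma lower_eom:
  "lower (eom mu) a =
      (\<Sum>nu\<in>UNIV. \<partial> nu (lower (F_up nu mu) a) - lower (bracket (A nu) (F_up nu mu)) a)
    + (2 * lam) *\<^sub>R (\<Sum>nu\<in>UNIV. \<Sum>rho\<in>UNIV. H_up mu nu rho * lower (F nu rho) a)"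
  by (simp add: eom_def[abs_def] lower_add lower_sum lower_scaleR lower_mult_left cov_deriv_lower)

lemma Rep_raise_A_star:
  "Rep_superalg (raise (A_star mu) c) = (\<Sum>e\<in>UNIV. sc (kinv k c e) (fv (FAs e mu)))"
  by (simp add: raise_def A_star_def Rep_superalg_simps Rep_fld_var)

lemma Rep_A_star: "Rep_superalg (A_star mu a) = fv (FAs a mu)"
  by (simp add: A_star_def Rep_fld_var)

lemma Rep_delta_fld: "Rep_superalg (delta_fld f) = delta0 t0 lam k C f"
proof (cases f)
  case (FAs a mu)
  then show ?thesis
    by (simp add: lower_eom Rep_superalg_simps Rep_total_deriv Rep_lower_F_up Rep_H_up Rep_lower_F
        Rep_A Rep_F_up flip: sum_Clow_mult)
next
  case (FCs a)
  then show ?thesis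
    by (simp add: cov_deriv_lower Rep_superalg_simps Rep_total_deriv Rep_lower_F Rep_B_star Rep_A
        Rep_A_star Rep_raise_A_star flip: sum_Clow_mult)
qed (simp_all add: Rep_superalg_simps Rep_total_deriv Rep_H_up Rep_B_star Rep_fld_var)

lemma Rep_delta_var: "Rep_superalg (delta_var x) = delta_gen t0 lam k C x"
  by (cases x) (simp_all add: Rep_superalg_simps Rep_multi_deriv Rep_delta_fld)

lemma Rep_delta: "Rep_superalg (\<delta> p) = KT t0 lam k C (Rep_superalg p)"
proof -
  have "Rep_superalg \<circ> delta_var = delta_gen t0 lam k C" by (auto simp: Rep_delta_var)
  then show ?thesis by (simp add: delta_def KT_def derivation.rep_eq)
qed

subsection \<open>Nilpotency\<close>

lemma bidegree_A: "supported (bidegree False 0) (A mu a)"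
  and bidegree_B: "supported (bidegree False 0) (B mu nu)"
  and bidegree_A_star: "supported (bidegree True 1) (A_star mu a)"
  and bidegree_B_star: "supported (bidegree True 1) (B_star mu nu)"
  using supported_bidegree_fld_var[of "FA a mu"] supported_bidegree_fld_var[of "FAs a mu"]
    supported_bidegree_fld_var[of "FB _ _"] supported_bidegree_fld_var[of "FBs _ _"]
  by (auto simp: A_def B_def A_star_def B_star_def intro!: supported_uminus)

lemma bidegree_bracket_A:
  "(\<And>a. supported (bidegree b n) (X a)) \<Longrightarrow> supported (bidegree b n) (bracket (A mu) X a)"
  unfolding bracket_def by (intro bidegree_intros bidegree_A)

lemma bidegree_F: "supported (bidegree False 0) (F mu nu a)"
  unfolding F_def by (intro bidegree_intros bidegree_bracket_A bidegree_A)

lemma bidegree_F_up: "supported (bidegree False 0) (F_up mu nu a)"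
  unfolding F_up_def by (intro bidegree_intros bidegree_F)

lemma bidegree_H_up: "supported (bidegree False 0) (H_up mu nu rho)"
  unfolding H_up_def H_def chern_simons_def triple_product_def
  by (intro bidegree_intros supported_lower bidegree_A bidegree_B bidegree_F)

lemma bidegree_delta_fld: "supported (bidegree (\<not> fld_odd f) (fld_agh f - 1)) (delta_fld f)"
proof (cases f)
  case (FAs a mu)
  show ?thesis
    unfolding FAs by (simp add: lower_eom)
      (intro bidegree_intros supported_lower bidegree_bracket_A bidegree_F bidegree_F_up
          bidegree_H_up)
next
  case (FCs a)
  have "supported (bidegree True 1) (raise (A_star mu) a)" for mu a
    by (intro supported_raise bidegree_A_star)
  then have "supported (bidegree True 1) (lower (cov_deriv mu (raise (A_star mu))) a)" for mu
    unfolding cov_deriv_lower lower_raise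
    by (intro bidegree_intros supported_lower bidegree_bracket_A bidegree_A_star)
  then have "supported (bidegree True 1) (delta_fld f)"
    unfolding FCs delta_fld.simps
    by (intro supported_linear_intros supported_bidegree_mult_right supported_lower[OF bidegree_F]
        bidegree_B_star)
  then show ?thesis by (simp add: FCs)
next
  case (FBs mu nu)
  show ?thesis unfolding FBs by (simp, intro bidegree_intros bidegree_H_up)
next
  case (Fetas mu)
  show ?thesis
    unfolding Fetas using bidegree_B_star by (simp, intro bidegree_intros) simp
next
  case Frhos
  have "supported (bidegree False 2) (fld_var (Fetas mu))" for mu
    using supported_bidegree_fld_var[of "Fetas mu"] by simp
  then show ?thesis unfolding Frhos by (simp, intro bidegree_intros) simp
qed simp_all

lemma bidegree_delta_var: "supported (bidegree (\<not> gen_odd x) (gen_agh x - 1)) (delta_var x)"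
  by (cases x) (simp_all add: supported_bidegree_multi_deriv bidegree_delta_fld del: One_nat_def)

lemma delta_var_agh_0:
  assumes "gen_agh x = 0"
  shows "delta_var x = 0"
proof (cases x)
  case (Jet f J)
  then show ?thesis using assms by (cases f) (auto simp: multi_deriv_linear_simps)
qed simp

lemma graded_delta_var: "graded_map 1 delta_var"
  using bidegree_delta_var by (auto simp: graded_map_def intro: supported_bidegree_parity)

lemma delta_agh_0:
  assumes "supported (bidegree b 0) p"
  shows "\<delta> p = 0"
proof -
  have "supported (\<lambda>_. False) (\<delta> p)"
    unfolding delta_def
    by (rule supported_derivation[OF graded_delta_var assms])
      (simp add: bidegree_def delta_var_agh_0)
  then show ?thesis by (simp add: supported_False_iff)
qed

lemma delta_mult_left: "supported (bidegree False 0) p \<Longrightarrow> \<delta> (p * q) = p * \<delta> q"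
  using derivation_mult[OF graded_delta_var supported_bidegree_parity] delta_agh_0[of False p]
  by (simp add: delta_def koszul_sign_def)

lemma delta_mult_right:
  "supported (bidegree b n) p \<Longrightarrow> supported (bidegree False 0) q \<Longrightarrow> \<delta> (p * q) = \<delta> p * q"
  using derivation_mult[OF graded_delta_var supported_bidegree_parity] delta_agh_0[of False q]
  by (simp add: delta_def)

lemma delta_total_deriv: "\<delta> (\<partial> mu p) = \<partial> mu (\<delta> p)"
  unfolding delta_def total_deriv_def
proof (rule derivation_commute[OF graded_delta_var graded_total_deriv_gen])
  fix x :: "('n, 'g) gen" assume "gen_ok x"
  show "derivation 1 delta_var (total_deriv_gen mu x) =
      derivation 0 (total_deriv_gen mu) (delta_var x)"
  proof (cases x)
    case (Jet f J)
    then have "gen_ok (Jet f (incr J mu))" using \<open>gen_ok x\<close> gen_ok_Jet_cong by blast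
    then show ?thesis
      by (simp add: Jet derivation_var[OF graded_delta_var] multi_deriv_incr total_deriv_def
          del: One_nat_def)
  qed (simp add: derivation_linear_simps)
qed

lemma delta_multi_deriv: "\<delta> (multi_deriv J p) = multi_deriv J (\<delta> p)"
  by (rule multi_deriv_commute_map) (rule delta_total_deriv)

lemma delta_fld_var: "gen_ok (Jet f undiff) \<Longrightarrow> \<delta> (fld_var f) = delta_fld f"
  by (simp add: delta_def fld_var_def derivation_var[OF graded_delta_var] del: One_nat_def)

lemma delta_A_star: "\<delta> (A_star mu a) = lower (eom mu) a"
  by (simp add: A_star_def delta_fld_var)

lemma delta_B_star: "\<delta> (B_star mu nu) = (\<Sum>rho\<in>UNIV. \<partial> rho (H_up rho mu nu))"
proof (cases mu nu rule: linorder_cases)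
  case greater
  then have "\<delta> (B_star mu nu) = (\<Sum>rho\<in>UNIV. \<partial> rho (- H_up rho nu mu))"
    by (simp add: B_star_def delta_linear_simps delta_fld_var total_deriv.deriv_linear_simps
        sum_negf)
  then show ?thesis by (simp flip: H_up_swap)
qed (simp_all add: B_star_def delta_fld_var H_up_diag delta_linear_simps
    total_deriv.deriv_linear_simps)

lemma delta_delta_fld_Fetas: "\<delta> (delta_fld (Fetas mu)) = 0"
  using sum_deriv_deriv_H_up[of mu]
  by (simp add: delta_linear_simps delta_total_deriv delta_B_star total_deriv.deriv_linear_simps)

lemma delta_delta_fld_Frhos: "\<delta> (delta_fld Frhos) = 0"
proof -
  have "\<delta> (delta_fld Frhos) = (\<Sum>mu\<in>UNIV. \<Sum>nu\<in>UNIV. \<partial> mu (\<partial> nu (B_star nu mu)))"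
    by (simp add: delta_linear_simps delta_total_deriv delta_fld_var total_deriv.deriv_linear_simps
        sum_negf)
  also have "\<dots> = 0"
  proof (rule sum_antisym_eq_0)
    show "\<partial> mu (\<partial> nu (B_star nu mu)) = - \<partial> nu (\<partial> mu (B_star mu nu))" for mu nu
      using B_star_antisym[of nu mu]
      by (simp add: total_deriv.deriv_linear_simps total_deriv.deriv_commute[of mu nu])
  qed
  finally show ?thesis .
qed

lemma delta_cov_deriv: "\<delta> (cov_deriv mu X a) = cov_deriv mu (\<lambda>a. \<delta> (X a)) a"
  by (simp add: cov_deriv_def bracket_def delta_linear_simps delta_total_deriv delta_mult_left
      bidegree_A)

lemma delta_delta_fld_FCs: "\<delta> (delta_fld (FCs a)) = 0"
proof -
  have "\<delta> (B_star mu nu * lower (F mu nu) a) = \<delta> (B_star mu nu) * lower (F mu nu) a" for mu nu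
    by (intro delta_mult_right[OF bidegree_B_star] supported_lower bidegree_F)
  then have "\<delta> (\<Sum>mu\<in>UNIV. \<Sum>nu\<in>UNIV. B_star mu nu * lower (F mu nu) a) =
      (\<Sum>mu\<in>UNIV. \<Sum>nu\<in>UNIV. \<Sum>rho\<in>UNIV. \<partial> rho (H_up rho mu nu) * lower (F mu nu) a)"
    by (simp add: delta_linear_simps delta_B_star sum_distrib_right)
  also have "\<dots> = (\<Sum>mu\<in>UNIV. \<Sum>nu\<in>UNIV. \<Sum>rho\<in>UNIV. \<partial> mu (H_up mu nu rho) * lower (F nu rho) a)"
    by (rule sum_rotate)
  finally have current: "(2 * lam) *\<^sub>R \<delta> (\<Sum>mu\<in>UNIV. \<Sum>nu\<in>UNIV. B_star mu nu * lower (F mu nu) a) =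
      lower (\<lambda>a. \<Sum>mu\<in>UNIV. cov_deriv mu (eom mu) a) a"
    by (simp add: noether_identity lower_scaleR lower_sum lower_mult_left)
  have "\<delta> (\<Sum>mu\<in>UNIV. lower (cov_deriv mu (raise (A_star mu))) a) =
      lower (\<lambda>a. \<Sum>mu\<in>UNIV. cov_deriv mu (eom mu) a) a"
    by (simp add: delta_linear_simps linear_lower[OF linear_delta] linear_raise[OF linear_delta]
        delta_cov_deriv delta_A_star lower_sum)
  with current show ?thesis by (simp add: delta_linear_simps)
qed

theorem delta_delta: "\<delta> (\<delta> p) = 0"
  unfolding delta_def
proof (rule derivation_square_zero[OF graded_delta_var])
  fix x :: "('n, 'g) gen"
  show "derivation 1 delta_var (delta_var x) = 0"
  proof (cases x)
    case (Jet f J)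
    have "\<delta> (delta_fld f) = 0"
    proof (cases f)
      case (FAs a mu)
      then show ?thesis using delta_agh_0 bidegree_delta_fld[of f] by simp
    next
      case (FBs mu nu)
      then show ?thesis using delta_agh_0 bidegree_delta_fld[of f] by simp
    qed (use delta_delta_fld_FCs delta_delta_fld_Frhos delta_delta_fld_Fetas in
        \<open>auto simp: delta_linear_simps\<close>)
    then have "\<delta> (delta_var x) = 0"
      by (simp add: Jet delta_multi_deriv multi_deriv_linear_simps)
    then show ?thesis by (simp only: delta_def)
  qed (simp add: derivation_linear_simps)
qed

end

section \<open>Degrees and ranks\<close>

lemma supported_sum_remove:
  fixes f :: "'i::finite \<Rightarrow> ('n::{finite,linorder}, 'g::finite) superalg"
  assumes "supported P (f i - l)" "\<And>j. j \<noteq> i \<Longrightarrow> supported P (f j)"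
  shows "supported P (sum f UNIV - l)"
proof -
  have "sum f UNIV - l = (f i - l) + sum f (UNIV - {i})"
    by (simp add: sum.remove[of UNIV i])
  moreover have "supported P \<dots>"
    using assms by (intro supported_add supported_sum) auto
  ultimately show ?thesis by (simp only:)
qed

definition deg_le :: "nat \<Rightarrow> ('n, 'g) gen multiset \<Rightarrow> bool" where
  "deg_le d M \<longleftrightarrow> size M \<le> d"

lemma supported_deg_le_mono: "supported (deg_le d) p \<Longrightarrow> d \<le> d' \<Longrightarrow> supported (deg_le d') p"
  by (erule supported_mono) (simp add: deg_le_def)

lemma supported_deg_le_mult:
  "supported (deg_le d) p \<Longrightarrow> supported (deg_le d') q \<Longrightarrow> d + d' \<le> n \<Longrightarrow> supported (deg_le n) (p * q)"
  by (erule supported_mult, assumption) (simp add: deg_le_def)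

lemma supported_deg_le_total_deriv: "supported (deg_le d) p \<Longrightarrow> supported (deg_le d) (\<partial> mu p)"
  by (erule supported_total_deriv) (simp add: deg_le_def)

lemma supported_deg_le_multi_deriv:
  "supported (deg_le d) p \<Longrightarrow> supported (deg_le d) (multi_deriv J p)"
  by (induction J rule: multi_index_induct)
    (auto simp: multi_deriv_incr intro: supported_deg_le_total_deriv)

lemma supported_deg_le_fld_var: "1 \<le> d \<Longrightarrow> supported (deg_le d) (fld_var f)"
  unfolding fld_var_def by (rule supported_var) (simp add: deg_le_def)

lemmas deg_le_intros = supported_linear_intros supported_deg_le_total_deriv

context chapline_manton
begin

lemma deg_le_A: "1 \<le> d \<Longrightarrow> supported (deg_le d) (A mu a)"
  and deg_le_B: "1 \<le> d \<Longrightarrow> supported (deg_le d) (B mu nu)"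
  and deg_le_A_star: "1 \<le> d \<Longrightarrow> supported (deg_le d) (A_star mu a)"
  and deg_le_B_star: "1 \<le> d \<Longrightarrow> supported (deg_le d) (B_star mu nu)"
  unfolding A_def B_def A_star_def B_star_def
  by (simp_all add: supported_deg_le_fld_var supported_uminus)

lemma deg_le_bracket_A:
  assumes "\<And>a. supported (deg_le d) (X a)" "Suc d \<le> n"
  shows "supported (deg_le n) (bracket (A mu) X a)"
  unfolding bracket_def
  by (intro supported_linear_intros supported_deg_le_mult[OF deg_le_A assms(1)])
    (use assms(2) in auto)

lemma deg_le_F: "supported (deg_le 2) (F mu nu a)"
  unfolding F_def by (intro deg_le_intros deg_le_bracket_A[OF deg_le_A[of 1]] deg_le_A) simp_all

lemma deg_le_F_up: "supported (deg_le 2) (F_up mu nu a)"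
  unfolding F_up_def by (intro supported_scaleR deg_le_F)

lemma deg_le_H_up: "supported (deg_le 3) (H_up mu nu rho)"
proof -
  have "supported (deg_le 3) (A mu a * A nu b * A rho c)" for mu nu rho a b c
    by (intro supported_deg_le_mult[OF supported_deg_le_mult[OF deg_le_A deg_le_A] deg_le_A,
          of 1 1 2 1])
      simp_all
  moreover have "supported (deg_le 3) (A mu a * lower (F nu rho) a)" for mu nu rho a
    by (intro supported_deg_le_mult[OF deg_le_A[of 1] supported_lower[OF deg_le_F]]) simp_all
  ultimately show ?thesis
    unfolding H_up_def H_def chern_simons_def triple_product_def
    by (intro deg_le_intros deg_le_B) simp_all
qed

lemma deg_le_delta_fld: "supported (deg_le 5) (delta_fld f)"
proof (cases f)
  case (FAs a mu)
  have "supported (deg_le 5) (lower (bracket (A nu) (F_up nu mu)) a)" for nu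
    by (intro supported_lower deg_le_bracket_A[OF deg_le_F_up]) simp
  moreover have "supported (deg_le 5) (\<partial> nu (lower (F_up nu mu) a))" for nu
    by (intro supported_deg_le_total_deriv supported_lower supported_deg_le_mono[OF deg_le_F_up])
        simp
  moreover have "supported (deg_le 5) (H_up mu nu rho * lower (F nu rho) a)" for nu rho
    by (intro supported_deg_le_mult[OF deg_le_H_up supported_lower[OF deg_le_F]]) simp
  ultimately show ?thesis
    unfolding FAs delta_fld.simps lower_eom by (intro supported_linear_intros)
next
  case (FCs a)
  have "supported (deg_le 5) (B_star mu nu * lower (F mu nu) a)" for mu nu
    by (intro supported_deg_le_mult[OF deg_le_B_star[of 1] supported_lower[OF deg_le_F]]) simp_all
  moreover have "supported (deg_le 5) (\<partial> mu (A_star mu a))" for mu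
    by (intro supported_deg_le_total_deriv deg_le_A_star) simp
  moreover have "supported (deg_le 5) (lower (bracket (A mu) (raise (A_star mu))) a)" for mu
    by (intro supported_lower deg_le_bracket_A[OF supported_raise[OF deg_le_A_star[of 1]]]) simp_all
  ultimately show ?thesis
    unfolding FCs delta_fld.simps cov_deriv_lower lower_raise by (intro supported_linear_intros)
next
  case (FBs mu nu)
  show ?thesis
    unfolding FBs delta_fld.simps
    by (intro deg_le_intros supported_deg_le_mono[OF deg_le_H_up]) simp
qed (simp_all, (intro deg_le_intros deg_le_B_star supported_deg_le_fld_var, simp)+)

lemma deg_le_delta_var: "supported (deg_le 5) (delta_var x)"
  by (cases x) (simp_all add: supported_deg_le_multi_deriv deg_le_delta_fld)

end

subsection \<open>Weighted orders\<close>

locale three_directions =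
  fixes e0 e1 e2 :: "'n::{finite,linorder}"
  assumes e0_least: "x \<noteq> e0 \<Longrightarrow> e0 < x" and e1_least: "x \<noteq> e0 \<Longrightarrow> x \<noteq> e1 \<Longrightarrow> e1 < x"
    and e_neq: "e1 \<noteq> e0" "e2 \<noteq> e0" "e2 \<noteq> e1"
begin

lemmas e_distinct = e_neq e_neq[symmetric]

lemma e_order: "e0 < e1" "e0 < e2" "e1 < e2" "\<not> x < e0" "e0 < x \<longleftrightarrow> x \<noteq> e0"
    "e1 < x \<longleftrightarrow> x \<noteq> e0 \<and> x \<noteq> e1"
  using e0_least e1_least e_neq by (metis less_asym order_less_irrefl)+

definition dir_weight :: "'n \<Rightarrow> nat" where
  "dir_weight mu = (if mu = e0 then 4 else if mu = e1 then 3 else if mu = e2 then 2 else 1)"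

definition jet_order :: "('n \<Rightarrow> nat) \<Rightarrow> nat" where
  "jet_order J = (\<Sum>mu\<in>UNIV. dir_weight mu * J mu)"

lemma dir_weight_e [simp]: "dir_weight e0 = 4" "dir_weight e1 = 3" "dir_weight e2 = 2"
  using e_neq by (auto simp: dir_weight_def)

lemma dir_weight_le:
  "dir_weight mu \<le> 4" "mu \<noteq> e0 \<Longrightarrow> dir_weight mu \<le> 3" "mu \<noteq> e0 \<Longrightarrow> mu \<noteq> e1 \<Longrightarrow> dir_weight mu \<le> 2"
  "mu \<noteq> e0 \<Longrightarrow> mu \<noteq> e1 \<Longrightarrow> mu \<noteq> e2 \<Longrightarrow> dir_weight mu \<le> 1"
  by (auto simp: dir_weight_def)

lemma jet_order_undiff [simp]: "jet_order undiff = 0"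
  by (simp add: jet_order_def undiff_def)

lemma jet_order_incr [simp]: "jet_order (incr J mu) = jet_order J + dir_weight mu"
proof -
  have "jet_order (incr J mu) =
      (\<Sum>nu\<in>UNIV. dir_weight nu * J nu + (if nu = mu then dir_weight mu else 0))"
    unfolding jet_order_def by (intro sum.cong) (auto simp: incr_apply)
  then show ?thesis by (simp add: sum.distrib jet_order_def)
qed

lemma jet_order_decr: "J mu \<noteq> 0 \<Longrightarrow> jet_order (decr J mu) + dir_weight mu = jet_order J"
  using jet_order_incr[of "decr J mu" mu] by simp

fun fld_rank :: "('n, 'g) fld \<Rightarrow> nat" where
  "fld_rank (FB m n) = 1" | "fld_rank (FAs a m) = 8" | "fld_rank (FBs m n) = 9"
| "fld_rank (FCs a) = 12" | "fld_rank (Fetas m) = 13" | "fld_rank Frhos = 17" | "fld_rank _ = 0"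

fun naive_rank :: "('n, 'g) gen \<Rightarrow> nat" where
  "naive_rank (Jet f J) = jet_order J + fld_rank f" | "naive_rank (Dx m) = 0"

text \<open>The equations of the antifields with an index \<open>e0\<close> contain no second derivative along \<open>e0\<close>, so
  their leading terms have smaller rank than \<open>naive_rank\<close> predicts.\<close>
fun jet_rank :: "('n, 'g) gen \<Rightarrow> nat" where
  "jet_rank (Jet (FA a m) J) = jet_order J"
| "jet_rank (Jet (FB m n) J) = jet_order J + 1"
| "jet_rank (Jet (FAs a m) J) = jet_order J + (if m = e0 \<and> J e0 = 0 then 7 else 8)"
| "jet_rank (Jet (FBs m n) J) =
     jet_order J + (if m = e0 \<and> J e0 = 0 then (if n = e1 \<and> J e1 = 0 then 7 else 8) else 9)"
| "jet_rank (Jet (FCs a) J) = jet_order J + 12"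
| "jet_rank (Jet (Fetas m) J) = jet_order J + (if m = e0 \<and> J e0 = 0 then 11 else 13)"
| "jet_rank (Jet Frhos J) = jet_order J + 17"
| "jet_rank _ = 0"

lemma jet_rank_le_naive_rank: "jet_rank x \<le> naive_rank x"
  by (cases x rule: jet_rank.cases) auto

definition naive_ranks_le :: "nat \<Rightarrow> ('n, 'g) gen multiset \<Rightarrow> bool" where
  "naive_ranks_le r M \<longleftrightarrow> (\<forall>x\<in>#M. naive_rank x \<le> r)"

lemma supported_naive_ranks_le_mult:
  "supported (naive_ranks_le r) p \<Longrightarrow> supported (naive_ranks_le r) q \<Longrightarrow>
      supported (naive_ranks_le r) (p * q)"
  by (erule supported_mult, assumption) (auto simp: naive_ranks_le_def)

lemma supported_naive_ranks_le_total_deriv: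
  "supported (naive_ranks_le (r - dir_weight mu)) p \<Longrightarrow> dir_weight mu \<le> r \<Longrightarrow>
      supported (naive_ranks_le r) (\<partial> mu p)"
  by (erule supported_total_deriv) (fastforce simp: naive_ranks_le_def)

lemma supported_naive_ranks_le_multi_deriv:
  "supported (naive_ranks_le r) p \<Longrightarrow> supported (naive_ranks_le (r + jet_order J)) (multi_deriv J p)"
  by (induction J rule: multi_index_induct)
    (auto simp: multi_deriv_incr intro!: supported_naive_ranks_le_total_deriv)

lemma supported_naive_ranks_le_fld_var: "fld_rank f \<le> r \<Longrightarrow> supported (naive_ranks_le r) (fld_var f)"
  unfolding fld_var_def by (rule supported_var) (simp add: naive_ranks_le_def)

definition ranks_less :: "nat \<Rightarrow> ('n, 'g) gen multiset \<Rightarrow> bool" where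
  "ranks_less r M \<longleftrightarrow> (\<forall>x\<in>#M. jet_rank x < r)"

lemma supported_naive_ranks_less:
  assumes "supported (naive_ranks_le r) p" "r < n"
  shows "supported (ranks_less n) p"
  using assms(1)
proof (rule supported_mono)
  show "ranks_less n M" if "naive_ranks_le r M" for M :: "('n, 'g) gen multiset"
    using that assms(2) by (fastforce simp: naive_ranks_le_def ranks_less_def
        intro: le_less_trans[OF order_trans[OF jet_rank_le_naive_rank]])
qed

definition weight :: "('n, 'g) gen multiset \<Rightarrow> nat" where
  "weight M = (\<Sum>x\<in>#M. 6 ^ jet_rank x)"

lemma weight_simps [simp]:
  "weight {#} = 0" "weight (add_mset x M) = 6 ^ jet_rank x + weight M"
  "weight (M + N) = weight M + weight N"
  by (simp_all add: weight_def)

text \<open>The base 6 exceeds the degree 5 of the field equations.\<close>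
lemma weight_less:
  assumes "deg_le 5 M" "ranks_less n M"
  shows "weight M < 6 ^ n"
proof (cases "M = {#}")
  case False
  then obtain r where n: "n = Suc r"
    using assms(2) by (cases n) (auto simp: ranks_less_def)
  have "weight M \<le> (\<Sum>x\<in>#M. 6 ^ r)"
    unfolding weight_def using assms(2)
    by (intro sum_mset_mono power_increasing) (auto simp: ranks_less_def n)
  also have "\<dots> \<le> 5 * 6 ^ r" using assms(1) by (simp add: deg_le_def sum_mset_constant)
  also have "\<dots> < 6 ^ n" by (simp add: n)
  finally show ?thesis .
qed simp

end

section \<open>Leading terms of the field equations\<close>

locale directed_chapline_manton = chapline_manton C k t0 lam + three_directions e0 e1 e2
  for C :: "'g::finite \<Rightarrow> 'g \<Rightarrow> 'g \<Rightarrow> real" and k :: "'g \<Rightarrow> 'g \<Rightarrow> real"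
    and t0 :: "'n::{finite,linorder}" and lam :: real and e0 e1 e2 :: 'n
begin

abbreviation \<eta> :: "'n \<Rightarrow> real" where "\<eta> \<equiv> msig t0"

lemma naive_ranks_le_A: "supported (naive_ranks_le r) (A mu a)"
  and naive_ranks_le_B: "1 \<le> r \<Longrightarrow> supported (naive_ranks_le r) (B mu nu)"
  and naive_ranks_le_A_star: "8 \<le> r \<Longrightarrow> supported (naive_ranks_le r) (A_star mu a)"
  and naive_ranks_le_B_star: "9 \<le> r \<Longrightarrow> supported (naive_ranks_le r) (B_star mu nu)"
  unfolding A_def B_def A_star_def B_star_def
  by (auto intro!: supported_naive_ranks_le_fld_var supported_uminus)

lemmas naive_ranks_le_intros =
  supported_linear_intros supported_naive_ranks_le_mult supported_naive_ranks_le_total_deriv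
  supported_lower supported_raise

lemma naive_ranks_le_bracket_A:
  "(\<And>a. supported (naive_ranks_le r) (X a)) \<Longrightarrow> supported (naive_ranks_le r) (bracket (A mu) X a)"
  unfolding bracket_def by (intro naive_ranks_le_intros naive_ranks_le_A)

lemma naive_ranks_le_F:
  "dir_weight mu \<le> r \<Longrightarrow> dir_weight nu \<le> r \<Longrightarrow> supported (naive_ranks_le r) (F mu nu a)"
  unfolding F_def by (intro naive_ranks_le_intros naive_ranks_le_bracket_A naive_ranks_le_A)

lemma naive_ranks_le_F_up:
  "dir_weight mu \<le> r \<Longrightarrow> dir_weight nu \<le> r \<Longrightarrow> supported (naive_ranks_le r) (F_up mu nu a)"
  unfolding F_up_def by (intro supported_scaleR naive_ranks_le_F)

lemma naive_ranks_le_chern_simons: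
  "dir_weight mu \<le> r \<Longrightarrow> dir_weight nu \<le> r \<Longrightarrow> dir_weight rho \<le> r \<Longrightarrow>
    supported (naive_ranks_le r) (chern_simons mu nu rho)"
  unfolding chern_simons_def triple_product_def
  by (intro naive_ranks_le_intros naive_ranks_le_A naive_ranks_le_F)

lemma naive_ranks_le_H_up:
  assumes "dir_weight mu < r" "dir_weight nu < r" "dir_weight rho < r"
  shows "supported (naive_ranks_le r) (H_up mu nu rho)"
  unfolding H_up_def H_def using assms
  by (intro naive_ranks_le_intros naive_ranks_le_B naive_ranks_le_chern_simons) simp_all

lemma naive_ranks_le_deriv_H_up:
  assumes "2 * dir_weight mu < r" "dir_weight mu + dir_weight nu < r"
    "dir_weight mu + dir_weight rho < r"
  shows "supported (naive_ranks_le r) (\<partial> mu (H_up mu nu rho))"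
  using assms by (intro supported_naive_ranks_le_total_deriv naive_ranks_le_H_up) simp_all

subsection \<open>The equation of the two-form\<close>

lemma deriv_H_up:
  "\<partial> rho (H_up rho m n) = (\<eta> rho * \<eta> m * \<eta> n) *\<^sub>R (\<partial> rho (\<partial> rho (B m n)) + \<partial> rho (\<partial> m (B n rho))
     + \<partial> rho (\<partial> n (B rho m)) - \<partial> rho (chern_simons rho m n))"
  by (simp add: H_up_def H_def total_deriv.deriv_linear_simps)

lemma naive_ranks_le_deriv_deriv_B:
  "dir_weight mu + dir_weight nu < r \<Longrightarrow> supported (naive_ranks_le r) (\<partial> mu (\<partial> nu (B x y)))"
  by (intro supported_naive_ranks_le_total_deriv naive_ranks_le_B) simp_all

lemma naive_ranks_le_deriv_chern_simons:
  assumes "2 * dir_weight mu \<le> r" "dir_weight mu + dir_weight nu \<le> r"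
    "dir_weight mu + dir_weight rho \<le> r"
  shows "supported (naive_ranks_le r) (\<partial> mu (chern_simons mu nu rho))"
  using assms by (intro supported_naive_ranks_le_total_deriv naive_ranks_le_chern_simons) simp_all

lemma naive_ranks_le_delta_FBs_spatial:
  assumes "m \<noteq> e0" "n \<noteq> e0"
  shows "supported (naive_ranks_le 8)
      (delta_fld (FBs m n) - (\<eta> e0 * \<eta> m * \<eta> n) *\<^sub>R \<partial> e0 (\<partial> e0 (B m n)))"
  unfolding delta_fld.simps
proof (rule supported_sum_remove[of _ _ e0])
  have "\<partial> e0 (H_up e0 m n) - (\<eta> e0 * \<eta> m * \<eta> n) *\<^sub>R \<partial> e0 (\<partial> e0 (B m n)) =
      (\<eta> e0 * \<eta> m * \<eta> n) *\<^sub>R (\<partial> e0 (\<partial> m (B n e0)) + \<partial> e0 (\<partial> n (B e0 m))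
          - \<partial> e0 (chern_simons e0 m n))"
    by (simp add: deriv_H_up flip: scaleR_diff_right)
  also have "supported (naive_ranks_le 8) \<dots>"
    using assms[THEN dir_weight_le(2)]
    by (intro supported_linear_intros naive_ranks_le_deriv_deriv_B
        naive_ranks_le_deriv_chern_simons) simp_all
  finally show "supported (naive_ranks_le 8)
      (\<partial> e0 (H_up e0 m n) - (\<eta> e0 * \<eta> m * \<eta> n) *\<^sub>R \<partial> e0 (\<partial> e0 (B m n)))" .
  show "supported (naive_ranks_le 8) (\<partial> mu (H_up mu m n))" if "mu \<noteq> e0" for mu
    using assms[THEN dir_weight_le(2)] that[THEN dir_weight_le(2)]
    by (intro naive_ranks_le_deriv_H_up) simp_all
qed

lemma naive_ranks_le_delta_FBs_mixed:
  assumes "n \<noteq> e0" "n \<noteq> e1"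
  shows "supported (naive_ranks_le 7)
      (delta_fld (FBs e0 n) - (- (\<eta> e1 * \<eta> e0 * \<eta> n)) *\<^sub>R \<partial> e1 (\<partial> e0 (B e1 n)))"
  unfolding delta_fld.simps
proof (rule supported_sum_remove[of _ _ e1])
  have "\<partial> e1 (H_up e1 e0 n) - (- (\<eta> e1 * \<eta> e0 * \<eta> n)) *\<^sub>R \<partial> e1 (\<partial> e0 (B e1 n)) =
      (\<eta> e1 * \<eta> e0 * \<eta> n) *\<^sub>R
        (\<partial> e1 (\<partial> e1 (B e0 n)) + \<partial> e1 (\<partial> n (B e1 e0)) - \<partial> e1 (chern_simons e1 e0 n))"
    unfolding deriv_H_up B_antisym[of n e1]
    by (simp add: total_deriv.deriv_linear_simps scaleR_add_right scaleR_diff_right)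
  also have "supported (naive_ranks_le 7) \<dots>"
    using dir_weight_le(3)[OF assms]
    by (intro supported_linear_intros naive_ranks_le_deriv_deriv_B
        naive_ranks_le_deriv_chern_simons) simp_all
  finally show "supported (naive_ranks_le 7)
      (\<partial> e1 (H_up e1 e0 n) - (- (\<eta> e1 * \<eta> e0 * \<eta> n)) *\<^sub>R \<partial> e1 (\<partial> e0 (B e1 n)))" .
  show "supported (naive_ranks_le 7) (\<partial> mu (H_up mu e0 n))" if "mu \<noteq> e1" for mu
  proof (cases "mu = e0")
    case False
    then show ?thesis
      using dir_weight_le(3)[OF False that] dir_weight_le(3)[OF assms]
      by (intro naive_ranks_le_deriv_H_up) simp_all
  qed (simp add: H_up_diag total_deriv.deriv_linear_simps)
qed

lemma naive_ranks_le_delta_FBs_e0_e1: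
  "supported (naive_ranks_le 6)
      (delta_fld (FBs e0 e1) - (\<eta> e2 * \<eta> e0 * \<eta> e1) *\<^sub>R \<partial> e2 (\<partial> e0 (B e1 e2)))"
  unfolding delta_fld.simps
proof (rule supported_sum_remove[of _ _ e2])
  have "\<partial> e2 (H_up e2 e0 e1) - (\<eta> e2 * \<eta> e0 * \<eta> e1) *\<^sub>R \<partial> e2 (\<partial> e0 (B e1 e2)) =
      (\<eta> e2 * \<eta> e0 * \<eta> e1) *\<^sub>R
        (\<partial> e2 (\<partial> e2 (B e0 e1)) + \<partial> e2 (\<partial> e1 (B e2 e0)) - \<partial> e2 (chern_simons e2 e0 e1))"
    unfolding deriv_H_up by (simp add: scaleR_add_right scaleR_diff_right)
  also have "supported (naive_ranks_le 6) \<dots>"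
    by (intro supported_linear_intros naive_ranks_le_deriv_deriv_B
        naive_ranks_le_deriv_chern_simons) simp_all
  finally show "supported (naive_ranks_le 6)
      (\<partial> e2 (H_up e2 e0 e1) - (\<eta> e2 * \<eta> e0 * \<eta> e1) *\<^sub>R \<partial> e2 (\<partial> e0 (B e1 e2)))" .
  show "supported (naive_ranks_le 6) (\<partial> mu (H_up mu e0 e1))" if "mu \<noteq> e2" for mu
  proof (cases "mu = e0 \<or> mu = e1")
    case False
    then show ?thesis
      using dir_weight_le(4)[of mu] that by (intro naive_ranks_le_deriv_H_up) simp_all
  qed (auto simp: H_up_diag total_deriv.deriv_linear_simps)
qed

lemma naive_ranks_le_delta_FBs_e0: "supported (naive_ranks_le 8) (delta_fld (FBs e0 n))"
proof -
  have "supported (naive_ranks_le 8) (\<partial> mu (H_up mu e0 n))" for mu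
  proof (cases "mu = e0 \<or> mu = n")
    case False
    then show ?thesis
      using dir_weight_le(2)[of mu] dir_weight_le(1)[of n]
      by (intro naive_ranks_le_deriv_H_up) simp_all
  qed (auto simp: H_up_diag total_deriv.deriv_linear_simps)
  then show ?thesis by (simp add: supported_sum)
qed

lemma naive_ranks_le_delta_FBs_e0_e1_naive: "supported (naive_ranks_le 7) (delta_fld (FBs e0 e1))"
proof -
  have "supported (naive_ranks_le 7) (\<partial> mu (H_up mu e0 e1))" for mu
  proof (cases "mu = e0 \<or> mu = e1")
    case False
    then show ?thesis
      using dir_weight_le(3)[of mu] by (intro naive_ranks_le_deriv_H_up) simp_all
  qed (auto simp: H_up_diag total_deriv.deriv_linear_simps)
  then show ?thesis by (simp add: supported_sum)
qed

subsection \<open>The equation of the gauge field\<close>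

lemma cov_deriv_F_up:
  "cov_deriv nu (F_up nu mu) a = (\<eta> nu * \<eta> mu) *\<^sub>R (\<partial> nu (\<partial> nu (A mu a)) - \<partial> nu (\<partial> mu (A nu a))
     - \<partial> nu (bracket (A nu) (A mu) a)) - bracket (A nu) (F_up nu mu) a"
  by (simp add: cov_deriv_def F_up_def F_def total_deriv.deriv_linear_simps)

lemma naive_ranks_le_deriv_deriv_A:
  "dir_weight mu + dir_weight nu \<le> r \<Longrightarrow> supported (naive_ranks_le r) (\<partial> mu (\<partial> nu (A x a)))"
  by (intro supported_naive_ranks_le_total_deriv naive_ranks_le_A) simp_all

lemma naive_ranks_le_deriv_bracket_A_A:
  "dir_weight nu \<le> r \<Longrightarrow> supported (naive_ranks_le r) (\<partial> nu (bracket (A nu) (A mu) a))"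
  by (intro supported_naive_ranks_le_total_deriv naive_ranks_le_bracket_A naive_ranks_le_A)

lemma naive_ranks_le_bracket_A_F_up:
  "4 \<le> r \<Longrightarrow> supported (naive_ranks_le r) (bracket (A nu) (F_up nu mu) a)"
  using dir_weight_le(1) by (intro naive_ranks_le_bracket_A naive_ranks_le_F_up)
      (meson order_trans)+

lemma naive_ranks_le_cov_deriv_F_up:
  assumes "2 * dir_weight nu \<le> r" "dir_weight nu + dir_weight mu \<le> r" "4 \<le> r"
  shows "supported (naive_ranks_le r) (cov_deriv nu (F_up nu mu) a)"
  unfolding cov_deriv_F_up using assms
  by (intro supported_linear_intros naive_ranks_le_deriv_deriv_A naive_ranks_le_deriv_bracket_A_A
      naive_ranks_le_bracket_A_F_up) simp_all

lemma cov_deriv_F_up_diag: "cov_deriv mu (F_up mu mu) a = 0"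
  by (simp add: cov_deriv_def F_up_def F_diag bracket_def total_deriv.deriv_linear_simps)

lemma naive_ranks_le_eom_remainder:
  assumes "supported (naive_ranks_le r) ((\<Sum>nu\<in>UNIV. cov_deriv nu (F_up nu mu) a) - l)" "5 \<le> r"
  shows "supported (naive_ranks_le r) (eom mu a - l)"
proof -
  have "supported (naive_ranks_le r) (H_up mu nu rho * F nu rho a)" for nu rho
    using assms(2) dir_weight_le(1)[of mu] dir_weight_le(1)[of nu] dir_weight_le(1)[of rho]
    by (intro supported_naive_ranks_le_mult naive_ranks_le_H_up naive_ranks_le_F) simp_all
  then have "supported (naive_ranks_le r) (((\<Sum>nu\<in>UNIV. cov_deriv nu (F_up nu mu) a) - l)
      + (2 * lam) *\<^sub>R (\<Sum>nu\<in>UNIV. \<Sum>rho\<in>UNIV. H_up mu nu rho * F nu rho a))"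
    by (intro supported_linear_intros assms(1))
  then show ?thesis by (simp add: eom_def algebra_simps)
qed

lemma naive_ranks_le_eom_spatial:
  assumes "m \<noteq> e0"
  shows "supported (naive_ranks_le 7) (eom m a - (\<eta> e0 * \<eta> m) *\<^sub>R \<partial> e0 (\<partial> e0 (A m a)))"
proof (intro naive_ranks_le_eom_remainder supported_sum_remove[of _ _ e0])
  have "cov_deriv e0 (F_up e0 m) a - (\<eta> e0 * \<eta> m) *\<^sub>R \<partial> e0 (\<partial> e0 (A m a)) =
      (\<eta> e0 * \<eta> m) *\<^sub>R (- \<partial> e0 (\<partial> m (A e0 a)) - \<partial> e0 (bracket (A e0) (A m) a))
        - bracket (A e0) (F_up e0 m) a"
    by (simp add: cov_deriv_F_up scaleR_diff_right)
  also have "supported (naive_ranks_le 7) \<dots>"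
    using dir_weight_le(2)[OF assms]
    by (intro supported_linear_intros naive_ranks_le_deriv_deriv_A naive_ranks_le_deriv_bracket_A_A
        naive_ranks_le_bracket_A_F_up) simp_all
  finally show "supported (naive_ranks_le 7)
      (cov_deriv e0 (F_up e0 m) a - (\<eta> e0 * \<eta> m) *\<^sub>R \<partial> e0 (\<partial> e0 (A m a)))" .
  show "supported (naive_ranks_le 7) (cov_deriv nu (F_up nu m) a)" if "nu \<noteq> e0" for nu
    using dir_weight_le(2)[OF assms] dir_weight_le(2)[OF that]
    by (intro naive_ranks_le_cov_deriv_F_up) simp_all
qed simp

lemma naive_ranks_le_eom_e0:
  "supported (naive_ranks_le 6) (eom e0 a - (- (\<eta> e1 * \<eta> e0)) *\<^sub>R \<partial> e1 (\<partial> e0 (A e1 a)))"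
proof (intro naive_ranks_le_eom_remainder supported_sum_remove[of _ _ e1])
  have "cov_deriv e1 (F_up e1 e0) a - (- (\<eta> e1 * \<eta> e0)) *\<^sub>R \<partial> e1 (\<partial> e0 (A e1 a)) =
      (\<eta> e1 * \<eta> e0) *\<^sub>R (\<partial> e1 (\<partial> e1 (A e0 a)) - \<partial> e1 (bracket (A e1) (A e0) a))
        - bracket (A e1) (F_up e1 e0) a"
    by (simp add: cov_deriv_F_up scaleR_diff_right)
  also have "supported (naive_ranks_le 6) \<dots>"
    by (intro supported_linear_intros naive_ranks_le_deriv_deriv_A naive_ranks_le_deriv_bracket_A_A
        naive_ranks_le_bracket_A_F_up) simp_all
  finally show "supported (naive_ranks_le 6)
      (cov_deriv e1 (F_up e1 e0) a - (- (\<eta> e1 * \<eta> e0)) *\<^sub>R \<partial> e1 (\<partial> e0 (A e1 a)))" .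
  show "supported (naive_ranks_le 6) (cov_deriv nu (F_up nu e0) a)" if "nu \<noteq> e1" for nu
  proof (cases "nu = e0")
    case False
    then show ?thesis
      using dir_weight_le(3)[OF False that] by (intro naive_ranks_le_cov_deriv_F_up) simp_all
  qed (simp add: cov_deriv_F_up_diag)
qed simp

lemma naive_ranks_le_eom_e0_naive: "supported (naive_ranks_le 7) (eom e0 a)"
proof -
  have "supported (naive_ranks_le 7) (cov_deriv nu (F_up nu e0) a)" for nu
  proof (cases "nu = e0")
    case False
    then show ?thesis
      using dir_weight_le(2)[OF False] by (intro naive_ranks_le_cov_deriv_F_up) simp_all
  qed (simp add: cov_deriv_F_up_diag)
  then have "supported (naive_ranks_le 7) (eom e0 a - 0)"
    by (intro naive_ranks_le_eom_remainder) (simp_all add: supported_sum)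
  then show ?thesis by simp
qed

subsection \<open>The equations of the higher antifields\<close>

lemma naive_ranks_le_delta_FCs:
  "supported (naive_ranks_le 11) (delta_fld (FCs a) - (- \<partial> e0 (A_star e0 a)))"
proof -
  let ?div = "\<lambda>mu. lower (cov_deriv mu (raise (A_star mu))) a"
  have bracket: "supported (naive_ranks_le 11) (lower (bracket (A mu) (raise (A_star mu))) a)"
      for mu
    by (intro supported_lower supported_raise naive_ranks_le_bracket_A naive_ranks_le_A_star) simp
  have "supported (naive_ranks_le 11) (sum ?div UNIV - \<partial> e0 (A_star e0 a))"
  proof (rule supported_sum_remove[of _ _ e0])
    show "supported (naive_ranks_le 11) (?div e0 - \<partial> e0 (A_star e0 a))"
      using supported_uminus[OF bracket] by (simp add: cov_deriv_lower)
    show "supported (naive_ranks_le 11) (?div mu)" if "mu \<noteq> e0" for mu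
      unfolding cov_deriv_lower lower_raise using dir_weight_le(2)[OF that]
      by (intro supported_diff bracket supported_naive_ranks_le_total_deriv naive_ranks_le_A_star)
          simp_all
  qed
  moreover have "supported (naive_ranks_le 11) (B_star mu nu * lower (F mu nu) a)" for mu nu
    using dir_weight_le(1)[of mu] dir_weight_le(1)[of nu]
    by (intro supported_naive_ranks_le_mult supported_lower naive_ranks_le_B_star naive_ranks_le_F)
        simp_all
  then have "supported (naive_ranks_le 11)
      ((2 * lam) *\<^sub>R (\<Sum>mu\<in>UNIV. \<Sum>nu\<in>UNIV. B_star mu nu * lower (F mu nu) a))"
    by (intro supported_linear_intros)
  ultimately have "supported (naive_ranks_le 11)
      ((2 * lam) *\<^sub>R (\<Sum>mu\<in>UNIV. \<Sum>nu\<in>UNIV. B_star mu nu * lower (F mu nu) a)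
        - (sum ?div UNIV - \<partial> e0 (A_star e0 a)))"
    by (rule supported_diff[rotated])
  then show ?thesis by (simp add: algebra_simps)
qed

lemma naive_ranks_le_delta_Fetas:
  "supported (naive_ranks_le 12) (delta_fld (Fetas m) - (- \<partial> e0 (B_star e0 m)))"
proof -
  have "supported (naive_ranks_le 12) (\<partial> nu (B_star nu m))" if "nu \<noteq> e0" for nu
    using dir_weight_le(2)[OF that]
    by (intro supported_naive_ranks_le_total_deriv naive_ranks_le_B_star) simp_all
  then have "supported (naive_ranks_le 12) ((\<Sum>nu\<in>UNIV. \<partial> nu (B_star nu m)) - \<partial> e0 (B_star e0 m))"
    by (intro supported_sum_remove[of _ _ e0]) simp_all
  from supported_uminus[OF this] show ?thesis by simp
qed

lemma naive_ranks_le_delta_Fetas_e0: "supported (naive_ranks_le 12) (delta_fld (Fetas e0))"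
  using naive_ranks_le_delta_Fetas[of e0] by (simp add: B_star_def total_deriv.deriv_linear_simps)

lemma naive_ranks_le_delta_Frhos:
  "supported (naive_ranks_le 16) (delta_fld Frhos - (- \<partial> e0 (fld_var (Fetas e0))))"
proof -
  have "supported (naive_ranks_le 16) (\<partial> mu (fld_var (Fetas mu)))" if "mu \<noteq> e0" for mu
    using dir_weight_le(2)[OF that]
    by (intro supported_naive_ranks_le_total_deriv supported_naive_ranks_le_fld_var) simp_all
  then have "supported (naive_ranks_le 16)
      ((\<Sum>mu\<in>UNIV. \<partial> mu (fld_var (Fetas mu))) - \<partial> e0 (fld_var (Fetas e0)))"
    by (intro supported_sum_remove[of _ _ e0]) simp_all
  from supported_uminus[OF this] show ?thesis by simp
qed

end

section \<open>The leading part of the differential and its contracting homotopy\<close>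

context directed_chapline_manton
begin

text \<open>The jets that occur as leading terms of field equations. Each of them is the leading term of
  exactly one jet that is not itself of this kind.\<close>
fun leading :: "('n, 'g) gen \<Rightarrow> bool" where
  "leading (Jet (FA b m) J) \<longleftrightarrow> m \<noteq> e0 \<and> 2 \<le> J e0 \<or> m = e1 \<and> J e0 = 1 \<and> J e1 \<noteq> 0"
| "leading (Jet (FB m n) J) \<longleftrightarrow> m \<noteq> e0 \<and> 2 \<le> J e0
     \<or> m = e1 \<and> J e0 = 1 \<and> (J e1 \<noteq> 0 \<or> n = e2 \<and> J e2 \<noteq> 0)"
| "leading (Jet (FAs a m) J) \<longleftrightarrow> m = e0 \<and> J e0 \<noteq> 0"
| "leading (Jet (FBs m n) J) \<longleftrightarrow> m = e0 \<and> (J e0 \<noteq> 0 \<or> n = e1 \<and> J e1 \<noteq> 0)"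
| "leading (Jet (Fetas m) J) \<longleftrightarrow> m = e0 \<and> J e0 \<noteq> 0"
| "leading _ \<longleftrightarrow> False"

fun principal :: "('n, 'g) fld \<Rightarrow> ('n, 'g) superalg" where
  "principal (FAs a m) =
     (if m \<noteq> e0 then lower (\<lambda>b. (\<eta> e0 * \<eta> m) *\<^sub>R \<partial> e0 (\<partial> e0 (A m b))) a
      else lower (\<lambda>b. (- (\<eta> e1 * \<eta> e0)) *\<^sub>R \<partial> e1 (\<partial> e0 (A e1 b))) a)"
| "principal (FBs m n) =
     (if m \<noteq> e0 then (\<eta> e0 * \<eta> m * \<eta> n) *\<^sub>R \<partial> e0 (\<partial> e0 (B m n))
      else if n \<noteq> e1 then (- (\<eta> e1 * \<eta> e0 * \<eta> n)) *\<^sub>R \<partial> e1 (\<partial> e0 (B e1 n))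
      else (\<eta> e2 * \<eta> e0 * \<eta> e1) *\<^sub>R \<partial> e2 (\<partial> e0 (B e1 e2)))"
| "principal (FCs a) = - \<partial> e0 (A_star e0 a)"
| "principal (Fetas m) = (if m \<noteq> e0 then - \<partial> e0 (B_star e0 m) else \<partial> e1 (B_star e0 e1))"
| "principal Frhos = - \<partial> e0 (fld_var (Fetas e0))"
| "principal _ = 0"

fun lead_delta_var :: "('n, 'g) gen \<Rightarrow> ('n, 'g) superalg" where
  "lead_delta_var (Jet f J) = (if leading (Jet f J) then 0 else multi_deriv J (principal f))"
| "lead_delta_var (Dx nu) = 0"

text \<open>Inverse of \<open>lead_delta_var\<close> on the leading jets; its values on other jets are irrelevant.\<close>
fun preimage :: "('n, 'g) gen \<Rightarrow> ('n, 'g) superalg" where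
  "preimage (Jet (FA b m) J) =
     (if 2 \<le> J e0 then (\<eta> e0 * \<eta> m) *\<^sub>R raise (\<lambda>a. var (Jet (FAs a m) (decr (decr J e0) e0))) b
      else (- (\<eta> e1 * \<eta> e0)) *\<^sub>R raise (\<lambda>a. var (Jet (FAs a e0) (decr (decr J e1) e0))) b)"
| "preimage (Jet (FB m n) J) =
     (if 2 \<le> J e0 then (\<eta> e0 * \<eta> m * \<eta> n) *\<^sub>R var (Jet (FBs m n) (decr (decr J e0) e0))
      else if J e1 \<noteq> 0 then (- (\<eta> e1 * \<eta> e0 * \<eta> n)) *\<^sub>R var (Jet (FBs e0 n) (decr (decr J e1) e0))
      else (\<eta> e2 * \<eta> e0 * \<eta> e1) *\<^sub>R var (Jet (FBs e0 e1) (decr (decr J e2) e0)))"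
| "preimage (Jet (FAs a m) J) = - var (Jet (FCs a) (decr J e0))"
| "preimage (Jet (FBs m n) J) =
     (if J e0 \<noteq> 0 then - var (Jet (Fetas n) (decr J e0)) else var (Jet (Fetas e0) (decr J e1)))"
| "preimage (Jet (Fetas m) J) = - var (Jet Frhos (decr J e0))"
| "preimage _ = 0"

definition homotopy_var :: "('n, 'g) gen \<Rightarrow> ('n, 'g) superalg" where
  "homotopy_var x = (if leading x then preimage x else 0)"

definition paired :: "('n, 'g) gen \<Rightarrow> bool" where
  "paired x \<longleftrightarrow> leading x \<or> gen_agh x \<noteq> 0"

lemmas gen_cases = leading.cases[case_names FA FB FAs FBs Fetas]

lemma lead_delta_var_jet:
  "m \<noteq> e0 \<Longrightarrow> lead_delta_var (Jet (FAs a m) J) =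
     (\<eta> e0 * \<eta> m) *\<^sub>R lower (\<lambda>b. var (Jet (FA b m) (incr (incr J e0) e0))) a"
  "J e0 = 0 \<Longrightarrow> lead_delta_var (Jet (FAs a e0) J) =
     (- (\<eta> e1 * \<eta> e0)) *\<^sub>R lower (\<lambda>b. var (Jet (FA b e1) (incr (incr J e0) e1))) a"
  "m < n \<Longrightarrow> m \<noteq> e0 \<Longrightarrow> lead_delta_var (Jet (FBs m n) J) =
     (\<eta> e0 * \<eta> m * \<eta> n) *\<^sub>R var (Jet (FB m n) (incr (incr J e0) e0))"
  "n \<noteq> e0 \<Longrightarrow> n \<noteq> e1 \<Longrightarrow> J e0 = 0 \<Longrightarrow> lead_delta_var (Jet (FBs e0 n) J) =
     (- (\<eta> e1 * \<eta> e0 * \<eta> n)) *\<^sub>R var (Jet (FB e1 n) (incr (incr J e0) e1))"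
  "J e0 = 0 \<Longrightarrow> J e1 = 0 \<Longrightarrow> lead_delta_var (Jet (FBs e0 e1) J) =
     (\<eta> e2 * \<eta> e0 * \<eta> e1) *\<^sub>R var (Jet (FB e1 e2) (incr (incr J e0) e2))"
  "lead_delta_var (Jet (FCs a) J) = - var (Jet (FAs a e0) (incr J e0))"
  "m \<noteq> e0 \<Longrightarrow> lead_delta_var (Jet (Fetas m) J) = - var (Jet (FBs e0 m) (incr J e0))"
  "J e0 = 0 \<Longrightarrow> lead_delta_var (Jet (Fetas e0) J) = var (Jet (FBs e0 e1) (incr J e1))"
  "lead_delta_var (Jet Frhos J) = - var (Jet (Fetas e0) (incr J e0))"
  by (auto simp: multi_deriv_linear_simps multi_deriv_total_deriv multi_deriv_fld_var
      linear_lower[OF linear_multi_deriv] total_deriv_var lower_scaleR lower_uminus A_def B_def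
      A_star_def B_star_def e_order e_distinct)

lemma lead_delta_var_leading: "leading x \<Longrightarrow> lead_delta_var x = 0"
  by (cases x) simp_all

lemma lead_delta_var_agh_0: "gen_agh x = 0 \<Longrightarrow> lead_delta_var x = 0"
  by (cases x rule: gen_cases) (auto simp: multi_deriv_linear_simps)

declare lead_delta_var.simps [simp del]

lemma antifield_cases
    [consumes 3, case_names FAs FAs_e0 FBs FBs_e0 FBs_e0_e1 FCs Fetas Fetas_e0 Frhos]:
  assumes "gen_ok x" "\<not> leading x" "gen_agh x \<noteq> 0"
  obtains (FAs) a m J where "x = Jet (FAs a m) J" "m \<noteq> e0"
  | (FAs_e0) a J where "x = Jet (FAs a e0) J" "J e0 = 0"
  | (FBs) m n J where "x = Jet (FBs m n) J" "m < n" "m \<noteq> e0" "n \<noteq> e0"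
  | (FBs_e0) n J where "x = Jet (FBs e0 n) J" "n \<noteq> e0" "n \<noteq> e1" "J e0 = 0"
  | (FBs_e0_e1) J where "x = Jet (FBs e0 e1) J" "J e0 = 0" "J e1 = 0"
  | (FCs) a J where "x = Jet (FCs a) J"
  | (Fetas) m J where "x = Jet (Fetas m) J" "m \<noteq> e0"
  | (Fetas_e0) J where "x = Jet (Fetas e0) J" "J e0 = 0"
  | (Frhos) J where "x = Jet Frhos J"
proof (cases x)
  case (Jet f J)
  show ?thesis
  proof (cases f)
    case (FAs a m)
    then show ?thesis using assms that(1,2) Jet by (cases "m = e0") auto
  next
    case (FBs m n)
    then have "m < n" "n \<noteq> e0" using assms(1) Jet e_order(4) by auto
    then show ?thesis using assms that(3-5) Jet FBs by (cases "m = e0"; cases "n = e1") auto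
  next
    case (Fetas m)
    then show ?thesis using assms that(7,8) Jet by (cases "m = e0") auto
  qed (use assms that Jet in auto)
qed (use assms in simp)

subsection \<open>The homotopy identity\<close>

definition lead_delta :: "('n, 'g) superalg \<Rightarrow> ('n, 'g) superalg" where
  "lead_delta = derivation 1 lead_delta_var"

definition homotopy :: "('n, 'g) superalg \<Rightarrow> ('n, 'g) superalg" where
  "homotopy = derivation 1 homotopy_var"

definition linear_in :: "(('n, 'g) gen \<Rightarrow> bool) \<Rightarrow> ('n, 'g) gen multiset \<Rightarrow> bool" where
  "linear_in P M \<longleftrightarrow> (\<exists>y. M = {#y#} \<and> P y)"

lemma supported_linear_in_var: "P y \<Longrightarrow> supported (linear_in P) (var y)"
  by (rule supported_var) (simp add: linear_in_def)

lemmas supported_linear_in_intros =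
  supported_linear_intros supported_lower supported_raise supported_linear_in_var

lemma supported_lead_delta_var:
  assumes "gen_ok x"
  shows "supported (linear_in (\<lambda>y. leading y \<and> gen_agh x \<noteq> 0 \<and> gen_odd y \<noteq> gen_odd x))
      (lead_delta_var x)"
proof (cases "leading x \<or> gen_agh x = 0")
  case True
  then have "lead_delta_var x = 0" using lead_delta_var_leading lead_delta_var_agh_0 by blast
  then show ?thesis by simp
next
  case False
  then have "\<not> leading x" "gen_agh x \<noteq> 0" by simp_all
  with assms show ?thesis
    by (cases rule: antifield_cases)
      (auto simp: lead_delta_var_jet incr_apply e_distinct intro!: supported_linear_in_intros)
qed

lemma supported_homotopy_var:
  assumes "gen_ok x"
  shows "supported
      (linear_in (\<lambda>y. jet_rank y = jet_rank x \<and> gen_agh y = gen_agh x + 1 \<and> gen_odd y \<noteq> gen_odd x))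
      (homotopy_var x)"
proof (cases x rule: gen_cases)
  case (FA b m J)
  show ?thesis
    using jet_order_decr[of J e0] jet_order_decr[of J e1] jet_order_decr[of "decr J e0" e0]
      jet_order_decr[of "decr J e1" e0]
    by (auto simp: FA homotopy_var_def decr_apply e_distinct intro!: supported_linear_in_intros)
next
  case (FB m n J)
  then have "m < n" "n \<noteq> e0" using assms e_order(4) by auto
  then show ?thesis
    using jet_order_decr[of J e0] jet_order_decr[of J e1] jet_order_decr[of J e2]
      jet_order_decr[of "decr J e0" e0] jet_order_decr[of "decr J e1" e0]
      jet_order_decr[of "decr J e2" e0]
    by (auto simp: FB homotopy_var_def decr_apply e_distinct intro!: supported_linear_in_intros)
next
  case (FAs a m J)
  show ?thesis
    using jet_order_decr[of J e0]
    by (auto simp: FAs homotopy_var_def intro!: supported_linear_in_intros)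
next
  case (FBs m n J)
  then have "m < n" "n \<noteq> e0" using assms e_order(4) by auto
  then show ?thesis
    using jet_order_decr[of J e0] jet_order_decr[of J e1]
    by (auto simp: FBs homotopy_var_def decr_apply e_distinct intro!: supported_linear_in_intros)
next
  case (Fetas m J)
  show ?thesis
    using jet_order_decr[of J e0]
    by (auto simp: Fetas homotopy_var_def intro!: supported_linear_in_intros)
qed (simp_all add: homotopy_var_def)

lemma supported_linear_in_parity:
  "supported (linear_in P) p \<Longrightarrow> (\<And>y. P y \<Longrightarrow> gen_odd y = b) \<Longrightarrow> supported (parity b) p"
  by (erule supported_mono) (auto simp: linear_in_def)

lemma graded_lead_delta_var: "graded_map 1 lead_delta_var"
  unfolding graded_map_def by (auto intro: supported_linear_in_parity[OF supported_lead_delta_var])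

lemma graded_homotopy_var: "graded_map 1 homotopy_var"
  unfolding graded_map_def by (auto intro: supported_linear_in_parity[OF supported_homotopy_var])

lemma linear_lead_delta: "linear lead_delta"
  and linear_homotopy: "linear homotopy"
  unfolding lead_delta_def homotopy_def by (rule linear_derivation)+

lemma lead_delta_of_var: "gen_ok x \<Longrightarrow> lead_delta (var x) = lead_delta_var x"
  unfolding lead_delta_def by (rule derivation_var[OF graded_lead_delta_var])

lemma homotopy_of_var: "gen_ok x \<Longrightarrow> homotopy (var x) = homotopy_var x"
  unfolding homotopy_def by (rule derivation_var[OF graded_homotopy_var])

lemmas lead_delta_simps =
  linear_neg[OF linear_lead_delta] linear_scale[OF linear_lead_delta]
  linear_raise[OF linear_lead_delta] lead_delta_of_var lead_delta_var_jet

lemmas homotopy_simps = linear_neg[OF linear_homotopy] linear_scale[OF linear_homotopy]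
  linear_lower[OF linear_homotopy] homotopy_of_var homotopy_var_def

lemma \<eta>_square: "\<eta> x * \<eta> x = 1"
  by (simp add: msig_def)

lemma \<eta>_square_left: "\<eta> x * (\<eta> x * r) = r"
  by (simp add: msig_def)

lemmas \<eta>_simps = \<eta>_square \<eta>_square_left mult_ac

lemma lead_delta_homotopy_var:
  assumes "gen_ok x" "leading x"
  shows "lead_delta (homotopy_var x) = var x"
proof (cases x rule: gen_cases)
  case (FA b m J)
  show ?thesis
  proof (cases "2 \<le> J e0")
    case True
    then show ?thesis
      using assms
      by (auto simp: FA homotopy_var_def lead_delta_simps raise_scaleR raise_uminus decr_apply
          \<eta>_simps)
  next
    case False
    then show ?thesis
      using assms
      by (auto simp: FA homotopy_var_def lead_delta_simps raise_scaleR raise_uminus decr_apply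
          e_distinct \<eta>_simps)
  qed
next
  case (FB m n J)
  then have mn: "m < n" "n \<noteq> e0" using assms e_order(4) by auto
  consider "2 \<le> J e0" | "\<not> 2 \<le> J e0" "J e1 \<noteq> 0" | "\<not> 2 \<le> J e0" "J e1 = 0" by blast
  then show ?thesis
    using assms mn
    by cases (auto simp: FB homotopy_var_def lead_delta_simps decr_apply e_distinct e_order \<eta>_simps)
next
  case (FBs m n J)
  then have "m < n" "n \<noteq> e0" using assms e_order(4) by auto
  then show ?thesis
    using assms by (auto simp: FBs homotopy_var_def lead_delta_simps decr_apply e_distinct)
qed (use assms in \<open>auto simp: homotopy_var_def lead_delta_simps\<close>)

lemma homotopy_lead_delta_var:
  assumes "gen_ok x" "\<not> leading x" "gen_agh x \<noteq> 0"
  shows "homotopy (lead_delta_var x) = var x"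
  using assms
  by (cases rule: antifield_cases)
    (simp_all add: lead_delta_var_jet homotopy_simps lower_scaleR lower_uminus incr_apply
        e_distinct e_order \<eta>_simps)

lemma lead_delta_homotopy_gen:
  assumes "gen_ok x"
  shows "lead_delta (homotopy_var x) + homotopy (lead_delta_var x) =
      (if paired x then 1 else 0) *\<^sub>R var x"
proof (cases "leading x")
  case True
  then show ?thesis
    using lead_delta_homotopy_var[OF assms True]
    by (simp add: lead_delta_var_leading paired_def linear_0[OF linear_homotopy])
next
  case False
  then have "homotopy_var x = 0" by (simp add: homotopy_var_def)
  then show ?thesis
    using False homotopy_lead_delta_var[OF assms False]
    by (cases "gen_agh x = 0")
      (simp_all add: paired_def lead_delta_var_agh_0 linear_0[OF linear_lead_delta]
          linear_0[OF linear_homotopy])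
qed

end

section \<open>Acyclicity\<close>

subsection \<open>The remainder has smaller rank\<close>

context directed_chapline_manton
begin

definition triangular :: "('n, 'g) gen \<Rightarrow> bool" where
  "triangular x \<longleftrightarrow> supported (ranks_less (jet_rank x)) (delta_var x - lead_delta_var x)"

lemma triangular_jet:
  assumes "supported (naive_ranks_le r)
      (delta_fld f - (if leading (Jet f J) then 0 else principal f))"
    and "r + jet_order J < jet_rank (Jet f J)"
  shows "triangular (Jet f J)"
proof -
  have "delta_var (Jet f J) - lead_delta_var (Jet f J) =
      multi_deriv J (delta_fld f - (if leading (Jet f J) then 0 else principal f))"
    by (simp add: lead_delta_var.simps multi_deriv_linear_simps)
  with supported_naive_ranks_less[OF supported_naive_ranks_le_multi_deriv[OF assms(1)] assms(2)]
  show ?thesis by (simp only: triangular_def)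
qed

lemma triangular_FAs: "triangular (Jet (FAs a m) J)"
proof -
  consider (spatial) "m \<noteq> e0" | (e0) "m = e0" "J e0 = 0" | (leading) "m = e0" "J e0 \<noteq> 0" by blast
  then show ?thesis
  proof cases
    case spatial
    then show ?thesis
      by (intro triangular_jet[of 7])
        (simp_all add: supported_lower naive_ranks_le_eom_spatial flip: lower_diff)
  next
    case e0
    then show ?thesis
      using naive_ranks_le_eom_e0
      by (intro triangular_jet[of 6]) (simp_all add: supported_lower flip: lower_diff)
  next
    case leading
    then show ?thesis
      by (intro triangular_jet[of 7]) (simp_all add: supported_lower naive_ranks_le_eom_e0_naive)
  qed
qed

lemma triangular_FBs:
  assumes "m < n"
  shows "triangular (Jet (FBs m n) J)"
proof -
  have "n \<noteq> e0" using assms e_order(4) by blast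
  consider (spatial) "m \<noteq> e0" | (leading_e0) "m = e0" "J e0 \<noteq> 0"
    | (mixed) "m = e0" "J e0 = 0" "n \<noteq> e1"
    | (leading_e1) "m = e0" "J e0 = 0" "n = e1" "J e1 \<noteq> 0"
    | (e0_e1) "m = e0" "J e0 = 0" "n = e1" "J e1 = 0" by blast
  then show ?thesis
  proof cases
    case spatial
    then show ?thesis
      using naive_ranks_le_delta_FBs_spatial[OF spatial \<open>n \<noteq> e0\<close>]
      by (intro triangular_jet[of 8]) (simp_all del: delta_fld.simps)
  next
    case leading_e0
    then show ?thesis
      using naive_ranks_le_delta_FBs_e0[of n]
      by (intro triangular_jet[of 8]) (simp_all del: delta_fld.simps)
  next
    case mixed
    then show ?thesis
      using naive_ranks_le_delta_FBs_mixed[OF \<open>n \<noteq> e0\<close> mixed(3)]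
      by (intro triangular_jet[of 7]) (simp_all del: delta_fld.simps)
  next
    case leading_e1
    then show ?thesis
      using naive_ranks_le_delta_FBs_e0_e1_naive
      by (intro triangular_jet[of 7]) (simp_all del: delta_fld.simps)
  next
    case e0_e1
    then show ?thesis
      using naive_ranks_le_delta_FBs_e0_e1
      by (intro triangular_jet[of 6]) (simp_all del: delta_fld.simps)
  qed
qed

text \<open>Here \<open>naive_ranks_le\<close> is too coarse: the jets of \<open>B_star e0 nu\<close> involved have rank below
  \<open>naive_rank\<close>.\<close>
lemma triangular_Fetas_e0:
  assumes "J e0 = 0"
  shows "triangular (Jet (Fetas e0) J)"
proof -
  let ?T = "\<lambda>nu. if nu = e0 then 0 else var (Jet (FBs e0 nu) (incr J nu))"
  have "multi_deriv J (\<partial> nu (B_star nu e0)) = - ?T nu" for nu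
    by (simp add: B_star_def e_order multi_deriv_linear_simps multi_deriv_total_deriv
        multi_deriv_fld_var total_deriv.deriv_linear_simps total_deriv_var)
  then have delta: "delta_var (Jet (Fetas e0) J) = sum ?T UNIV"
    by (simp add: multi_deriv_linear_simps sum_negf)
  have "supported (ranks_less (jet_order J + 11)) (sum ?T UNIV - ?T e1)"
  proof (rule supported_sum_remove[of _ _ e1])
    fix nu assume "nu \<noteq> e1"
    then show "supported (ranks_less (jet_order J + 11)) (?T nu)"
      using assms dir_weight_le(3)[of nu]
      by (auto simp: ranks_less_def incr_apply e_distinct intro!: supported_var)
  qed simp
  then show ?thesis
    using assms by (simp add: triangular_def delta lead_delta_var_jet e_neq del: delta_var.simps)
qed

lemma triangular_Fetas: "triangular (Jet (Fetas m) J)"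
proof -
  consider (spatial) "m \<noteq> e0" | (leading) "m = e0" "J e0 \<noteq> 0" | (e0) "m = e0" "J e0 = 0" by blast
  then show ?thesis
  proof cases
    case spatial
    then show ?thesis
      using naive_ranks_le_delta_Fetas[of m]
      by (intro triangular_jet[of 12]) (simp_all del: delta_fld.simps)
  next
    case leading
    then show ?thesis
      using naive_ranks_le_delta_Fetas_e0
      by (intro triangular_jet[of 12]) (simp_all del: delta_fld.simps)
  qed (simp only: triangular_Fetas_e0)
qed

lemma triangular_gen:
  assumes "gen_ok x"
  shows "triangular x"
proof (cases "gen_agh x = 0")
  case True
  then show ?thesis by (simp add: triangular_def delta_var_agh_0 lead_delta_var_agh_0)
next
  case False
  then obtain f J where x: "x = Jet f J" by (cases x) auto
  show ?thesis
  proof (cases f)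
    case (FCs a)
    show ?thesis
      unfolding x FCs using naive_ranks_le_delta_FCs[of a]
      by (intro triangular_jet[of 11]) (simp_all del: delta_fld.simps)
  next
    case Frhos
    show ?thesis
      unfolding x Frhos using naive_ranks_le_delta_Frhos
      by (intro triangular_jet[of 16]) (simp_all del: delta_fld.simps)
  qed (use assms False x triangular_FAs triangular_FBs triangular_Fetas in simp_all)
qed

lemma weight_less_delta_diff_lead_delta:
  assumes "gen_ok x"
  shows "supported (\<lambda>M. weight M < 6 ^ jet_rank x) (delta_var x - lead_delta_var x)"
proof -
  have "supported (deg_le 5) (lead_delta_var x)"
    using supported_lead_delta_var[OF assms]
    by (rule supported_mono) (auto simp: linear_in_def deg_le_def)
  then have "supported (deg_le 5) (delta_var x - lead_delta_var x)"
    by (intro supported_diff deg_le_delta_var)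
  then show ?thesis
    using triangular_gen[OF assms] weight_less by (auto simp: triangular_def supported_def)
qed

end

subsection \<open>Perturbation of a contractible differential\<close>

text \<open>The cycle \<open>a\<close> and the boundary of \<open>h a\<close> differ by an element of lower filtration.\<close>
lemma filtered_homotopy_exact:
  fixes d d0 h :: "'a::ab_group_add \<Rightarrow> 'a" and G V :: "nat \<Rightarrow> 'a set"
  assumes d: "Modules.additive d" and d_d: "\<And>x. d (d x) = 0"
    and G_add: "\<And>i x y. x \<in> G i \<Longrightarrow> y \<in> G i \<Longrightarrow> x + y \<in> G i"
    and G_diff: "\<And>i x y. x \<in> G i \<Longrightarrow> y \<in> G i \<Longrightarrow> x - y \<in> G i"
    and d_G: "\<And>i x. x \<in> G (Suc i) \<Longrightarrow> d x \<in> G i" and h_G: "\<And>i x. x \<in> G i \<Longrightarrow> h x \<in> G (Suc i)"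
    and V_0: "V 0 = {0}" and V_uminus: "\<And>N x. x \<in> V N \<Longrightarrow> - x \<in> V N"
    and V_diff: "\<And>N x y. x \<in> V N \<Longrightarrow> y \<in> V N \<Longrightarrow> x - y \<in> V N"
    and h_V: "\<And>N x. x \<in> V N \<Longrightarrow> h x \<in> V N" and d_d0: "\<And>N x. x \<in> V (Suc N) \<Longrightarrow> d x - d0 x \<in> V N"
    and homotopy: "\<And>i x. 0 < i \<Longrightarrow> x \<in> G i \<Longrightarrow> d0 (h x) + h (d0 x) = x"
    and "a \<in> V N" "a \<in> G i" "0 < i" "d a = 0"
  shows "\<exists>b\<in>G (Suc i). a = d b"
  using assms(13-)
proof (induction N arbitrary: a)
  case 0
  then have "a = 0" "h a = 0" using h_V[of a 0] V_0 by auto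
  then have "a = d (h a)" using Modules.additive.zero[OF d] by simp
  then show ?case using h_G[OF 0(2)] by blast
next
  case (Suc N)
  have "d0 a \<in> V N"
    using V_uminus[OF d_d0[OF Suc.prems(1)]] Suc.prems(4) by simp
  then have "h (d0 a) - (d (h a) - d0 (h a)) \<in> V N"
    using Suc.prems(1) by (intro V_diff h_V d_d0)
  moreover have "a - d (h a) = h (d0 a) - (d (h a) - d0 (h a))"
    using homotopy[OF Suc.prems(3,2)] by (simp add: algebra_simps)
  ultimately have "a - d (h a) \<in> V N" by (simp only:)
  moreover have "a - d (h a) \<in> G i" using Suc.prems(2) by (intro G_diff d_G h_G)
  moreover have "d (a - d (h a)) = 0"
    by (simp add: Modules.additive.diff[OF d] d_d Suc.prems(4))
  ultimately obtain b where b: "b \<in> G (Suc i)" "a - d (h a) = d b"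
    using Suc.IH Suc.prems(3) by blast
  then have "a = d (h a + b)"
    by (simp add: Modules.additive.add[OF d] algebra_simps)
  moreover have "h a + b \<in> G (Suc i)" using b(1) h_G[OF Suc.prems(2)] by (intro G_add)
  ultimately show ?case by blast
qed

subsection \<open>Exactness of the Koszul--Tate differential\<close>

lemma supported_total_agh_iff: "supported (\<lambda>M. total_agh M = i) p \<longleftrightarrow> has_agh i (Rep_superalg p)"
proof -
  have "mon_agh m = total_agh (factors m)" for m :: "('a, 'b) mon"
    by (simp add: mon_agh_def factors_def total_agh_def sum_unfold_sum_mset)
  then show ?thesis by (simp add: supported_def has_agh_def support_def)
qed

lemma (in chapline_manton) total_agh_delta:
  assumes "supported (\<lambda>M. total_agh M = Suc i) p"
  shows "supported (\<lambda>M. total_agh M = i) (\<delta> p)"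
  unfolding delta_def
proof (rule supported_derivation[OF graded_delta_var assms])
  fix x and M :: "('n, 'g) gen multiset"
  assume "total_agh (add_mset x M) = Suc i"
  then show "supported (\<lambda>N. total_agh (M + N) = i) (delta_var x)"
    using bidegree_delta_var[of x]
    by (cases "gen_agh x = 0") (auto simp: delta_var_agh_0 bidegree_def elim: supported_mono)
qed

context directed_chapline_manton
begin

lemma total_agh_homotopy:
  "supported (\<lambda>M. total_agh M = i) p \<Longrightarrow> supported (\<lambda>M. total_agh M = Suc i) (homotopy p)"
  unfolding homotopy_def
  by (erule supported_derivation[OF graded_homotopy_var], drule supported_homotopy_var,
      erule supported_mono) (auto simp: linear_in_def)

lemma weight_homotopy:
  "supported (\<lambda>M. weight M < N) p \<Longrightarrow> supported (\<lambda>M. weight M < N) (homotopy p)"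
  unfolding homotopy_def
  by (erule supported_derivation[OF graded_homotopy_var], drule supported_homotopy_var,
      erule supported_mono) (auto simp: linear_in_def)

lemma weight_delta_diff_lead_delta:
  assumes "supported (\<lambda>M. weight M < Suc N) p"
  shows "supported (\<lambda>M. weight M < N) (\<delta> p - lead_delta p)"
proof -
  have "\<delta> p - lead_delta p = derivation 1 (\<lambda>x. delta_var x - lead_delta_var x) p"
    unfolding delta_def lead_delta_def
    by (rule derivation_diff_map[OF graded_delta_var graded_lead_delta_var, symmetric])
  also have "supported (\<lambda>M. weight M < N) \<dots>"
    by (rule supported_derivation[OF graded_map_diff[OF graded_delta_var graded_lead_delta_var]
        assms],
      drule weight_less_delta_diff_lead_delta, erule supported_mono) auto
  finally show ?thesis .
qed

definition paired_count :: "('n, 'g) gen multiset \<Rightarrow> real" where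
  "paired_count M = (\<Sum>x\<in>#M. if paired x then 1 else 0)"

lemma paired_count_nonneg: "0 \<le> paired_count M"
  by (induction M) (auto simp: paired_count_def)

lemma paired_count_pos: "0 < total_agh M \<Longrightarrow> 0 < paired_count M"
proof (induction M)
  case (add x M)
  show ?case
  proof (cases "gen_agh x = 0")
    case True
    then show ?thesis using add by (auto simp: paired_count_def)
  next
    case False
    then show ?thesis
      using paired_count_nonneg[of M] by (simp add: paired_count_def paired_def)
  qed
qed simp

definition normalized_homotopy :: "('n, 'g) superalg \<Rightarrow> ('n, 'g) superalg" where
  "normalized_homotopy p = homotopy (rescale (\<lambda>M. 1 / paired_count M) p)"

lemma total_agh_normalized_homotopy:
  "supported (\<lambda>M. total_agh M = i) p \<Longrightarrow> supported (\<lambda>M. total_agh M = Suc i) (normalized_homotopy p)"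
  and weight_normalized_homotopy:
  "supported (\<lambda>M. weight M < N) p \<Longrightarrow> supported (\<lambda>M. weight M < N) (normalized_homotopy p)"
  by (simp_all add: normalized_homotopy_def total_agh_homotopy weight_homotopy supported_rescale)

lemma rescale_lead_delta:
  "rescale (\<lambda>M. 1 / paired_count M) (lead_delta p) =
      lead_delta (rescale (\<lambda>M. 1 / paired_count M) p)"
  unfolding lead_delta_def
proof (rule rescale_derivation[OF graded_lead_delta_var])
  fix x :: "('n, 'g) gen" and M :: "('n, 'g) gen multiset"
  assume "gen_ok x"
  from supported_lead_delta_var[OF this]
  show "supported (\<lambda>N. 1 / paired_count (M + N) = 1 / paired_count (add_mset x M))
      (lead_delta_var x)"
    by (rule supported_mono) (auto simp: linear_in_def paired_count_def paired_def)
qed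

lemma lead_delta_normalized_homotopy:
  assumes "supported (\<lambda>M. total_agh M = i) p" "0 < i"
  shows "lead_delta (normalized_homotopy p) + normalized_homotopy (lead_delta p) = p"
proof -
  let ?q = "rescale (\<lambda>M. 1 / paired_count M) p"
  have "lead_delta (homotopy ?q) + homotopy (lead_delta ?q) = rescale paired_count ?q"
    unfolding lead_delta_def homotopy_def paired_count_def[abs_def]
    by (rule derivation_anticommutator[OF graded_lead_delta_var graded_homotopy_var
          lead_delta_homotopy_gen[unfolded lead_delta_def homotopy_def]])
  also have "\<dots> = p"
  proof (rule rescale_rescale_inverse, rule supported_mono[OF assms(1)])
    show "paired_count M * (1 / paired_count M) = 1"
      if "total_agh M = i" for M :: "('n, 'g) gen multiset"
      using paired_count_pos[of M] that assms(2) by simp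
  qed
  finally show ?thesis by (simp add: normalized_homotopy_def rescale_lead_delta)
qed

lemma ex_weight_bound: "\<exists>N. supported (\<lambda>M. weight M < N) p"
proof
  show "supported (\<lambda>M. weight M < Suc (\<Sum>m\<in>support p. weight (factors m))) p"
    by (auto simp: supported_def less_Suc_eq_le intro!: member_le_sum)
qed

theorem delta_exact:
  assumes "supported (\<lambda>M. total_agh M = i) a" "0 < i" "\<delta> a = 0"
  shows "\<exists>b. supported (\<lambda>M. total_agh M = Suc i) b \<and> a = \<delta> b"
proof -
  let ?G = "\<lambda>i. {p. supported (\<lambda>M. total_agh M = i) p}"
    and ?V = "\<lambda>N. {p. supported (\<lambda>M. weight M < N) p}"
  obtain N where "a \<in> ?V N" using ex_weight_bound by blast
  then have "\<exists>b\<in>?G (Suc i). a = \<delta> b"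
  proof (rule filtered_homotopy_exact[where d = \<delta> and ?d0.0 = lead_delta
      and h = normalized_homotopy and G = ?G and V = ?V, rotated -4])
  qed (use assms in
      \<open>auto simp: Modules.additive_def delta_linear_simps delta_delta supported_False_iff
        lead_delta_normalized_homotopy intro: supported_add supported_uminus supported_diff
        total_agh_delta total_agh_normalized_homotopy weight_normalized_homotopy
        weight_delta_diff_lead_delta\<close>)
  then show ?thesis by blast
qed

end

section \<open>The main theorem\<close>

definition basis_vec :: "'g \<Rightarrow> 'g \<Rightarrow> real" where
  "basis_vec b = (\<lambda>c. if c = b then 1 else 0)"

lemma lbr_basis_vec_right: "lbr C x (basis_vec d) a = (\<Sum>e\<in>UNIV. C a e d * x e)"
  by (simp add: lbr_def basis_vec_def if_distrib cong: if_cong)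

lemma lbr_basis_vecs: "lbr C (basis_vec b) (basis_vec c) a = C a b c"
  by (simp add: lbr_basis_vec_right) (simp add: basis_vec_def if_distrib cong: if_cong)

lemma kform_basis_vec_right: "kform k x (basis_vec c) = (\<Sum>a\<in>UNIV. k a c * x a)"
  by (simp add: kform_def basis_vec_def if_distrib cong: if_cong)

lemma kform_commute: "(\<And>a b. k a b = k b a) \<Longrightarrow> kform k x y = kform k y x"
  unfolding kform_def by (subst sum.swap) (simp add: mult_ac)

lemma metric_lie_algebraI:
  assumes "simple_lie_algebra C" "invariant_metric C k"
  shows "metric_lie_algebra C k"
proof
  have jacobi: "lbr C (lbr C x y) z a + lbr C (lbr C y z) x a + lbr C (lbr C z x) y a = 0"
    for x y z a
    using assms(1) unfolding simple_lie_algebra_def fun_eq_iff by blast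
  have invariant: "kform k (lbr C x y) z = kform k x (lbr C y z)" for x y z
    using assms(2) unfolding invariant_metric_def by blast
  show sym: "k a b = k b a" for a b
    using assms(2) unfolding invariant_metric_def by blast
  show "C a b c = - C a c b" for a b c
    using assms(1) unfolding simple_lie_algebra_def by blast
  show "(\<Sum>e\<in>UNIV. C a e d * C e b c) + (\<Sum>e\<in>UNIV. C a e b * C e c d)
      + (\<Sum>e\<in>UNIV. C a e c * C e d b) = 0" for a b c d
    using jacobi[of "basis_vec b" "basis_vec c" "basis_vec d" a]
    unfolding lbr_basis_vec_right[of C "lbr C _ _"] lbr_basis_vecs .
  show "Clow k C c a b = Clow k C a b c" for a b c
    using invariant[of "basis_vec a" "basis_vec b" "basis_vec c"]
      kform_commute[of k "basis_vec a" "lbr C (basis_vec b) (basis_vec c)", OF sym]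
    by (simp add: kform_basis_vec_right lbr_basis_vecs Clow_def sym[of _ a] sym[of _ c])
  show "x = (\<lambda>_. 0)" if "\<And>b. (\<Sum>a\<in>UNIV. k b a * x a) = 0" for x
  proof -
    have "kform k x y = (\<Sum>b\<in>UNIV. (\<Sum>a\<in>UNIV. k b a * x a) * y b)" for y
      unfolding kform_def by (subst sum.swap) (simp add: sum_distrib_right sym)
    then have "\<forall>y. kform k x y = 0" using that by simp
    then show ?thesis using assms(2) unfolding invariant_metric_def by blast
  qed
qed

lemma ex_three_directions:
  assumes "CARD('n::{finite,linorder}) \<ge> 3"
  shows "\<exists>e0 e1 e2 :: 'n. three_directions e0 e1 e2"
proof -
  define e0 :: 'n where "e0 = Min UNIV"
  define e1 :: 'n where "e1 = Min (UNIV - {e0})"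
  have card: "card (UNIV - {e0}) \<ge> 2" using assms by simp
  then have "UNIV - {e0} \<noteq> {}" by (metis card.empty not_numeral_le_zero)
  then have e1: "e1 \<noteq> e0" using Min_in[of "UNIV - {e0}"] by (simp add: e1_def)
  have "card (UNIV - {e0} - {e1}) \<ge> 1" using card e1 by simp
  then have "UNIV - {e0} - {e1} \<noteq> {}" by (metis card.empty not_one_le_zero)
  then obtain e2 where e2: "e2 \<noteq> e0" "e2 \<noteq> e1" by blast
  have "three_directions e0 e1 e2"
  proof
    show "e0 < x" if "x \<noteq> e0" for x
      using that Min_le[of UNIV x] by (simp add: e0_def order_less_le)
    show "e1 < x" if "x \<noteq> e0" "x \<noteq> e1" for x
      using that Min_le[of "UNIV - {e0}" x] by (simp add: e1_def order_less_le)
  qed (fact e1 e2)+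
  then show ?thesis by blast
qed

theorem theorem3p1:
  fixes t0 :: "'n::{finite,linorder}"
    and C :: "'g::finite \<Rightarrow> 'g \<Rightarrow> 'g \<Rightarrow> real"
    and k :: "'g \<Rightarrow> 'g \<Rightarrow> real"
    and lam :: real
    and i :: nat
    and a :: "('n, 'g) poly"
  assumes "CARD('n) \<ge> 3"
    and "simple_lie_algebra C"
    and "invariant_metric C k"
    and "a \<in> PP"
    and "has_agh i a"
    and "i > 0"
    and "KT t0 lam k C a = 0"
  shows "\<exists>b\<in>PP. has_agh (i + 1) b \<and> a = KT t0 lam k C b"
proof -
  obtain e0 e1 e2 :: 'n where "three_directions e0 e1 e2"
    using ex_three_directions[OF assms(1)] by blast
  with metric_lie_algebraI[OF assms(2,3)] interpret directed_chapline_manton C k t0 lam e0 e1 e2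
    by (simp add: directed_chapline_manton_def chapline_manton_def)
  obtain p where p: "a = Rep_superalg p"
    using assms(4) by (rule Rep_superalg_cases)
  have "\<delta> p = 0"
    using assms(7) by (simp add: Rep_delta p zero_superalg.rep_eq flip: Rep_superalg_inject)
  moreover have "supported (\<lambda>M. total_agh M = i) p"
    using assms(5) by (simp add: supported_total_agh_iff p)
  ultimately obtain q where "has_agh (i + 1) (Rep_superalg q)" "p = \<delta> q"
    using delta_exact assms(6) by (auto simp: supported_total_agh_iff)
  then show ?thesis
    using Rep_superalg[of q] p by (auto simp: Rep_delta)
qed

end
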